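(* Let $\mathcal{A} = (Q, q_{\mathsf{init}}, \Sigma, \Gamma, \delta^o, \delta^t)$ be a deterministic finite-state transducer, and let $x \in \Sigma^\omega$ be a uniformly recurrent word that satisfies Boshernitzan's condition. If $\mathcal{A}(x)$ is an infinite word, then it has a uniformly recurrent suffix $y$ that satisfies Boshernitzan's condition, and hence $y$ admits factor frequencies. If moreover $x$ is effectively uniformly recurrent, then $\mathcal{A}(x)$ (if infinite) has an effectively uniformly recurrent suffix $y$ that satisfies Boshernitzan's condition, and hence $y$ admits computable factor frequencies.
   Context: All alphabets are finite and non-empty; words are indexed from $0$, $x(n)$ is the $n$-th letter and $x(i,j)$ the factor at positions $i,\dots,j-1$. Transducer: $Q$ finite non-empty set of states, $q_{\mathsf{init}}\in Q$, $\delta^t\colon Q\times\Sigma\to Q$ the transition function, $\delta^o\colon Q\times\Sigma\to\Gamma^*$ the output function; $\mathcal{A}(x)=\delta^o(q_0,x(0))\,\delta^o(q_1,x(1))\cdots$ where $q_0=q_{\mathsf{init}}$, $q_{n+1}=\delta^t(q_n,x(n))$. Recurrence: $x$ is recurrent if every factor occurs infinitely often. A return word to a factor $u$ is a word $r$ such that $ru$ is a factor of $x$ containing exactly two occurrences of $u$, one as prefix and one as suffix. A recurrent word is uniformly recurrent if every factor has finitely many return words; $R_x(n)$ is the length of the longest return word to a length-$n$ factor. It is effectively uniformly recurrent if $n\mapsto x(n)$ and $n\mapsto R_x(n)$ are computable. Shifts: $T$ is the shift map on $\Sigma^\omega$ (delete the first letter), $\Sigma^\omega$ carries the product topology. A shift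 is a closed $X\subseteq\Sigma^\omega$ with $TX\subseteq X$; the shift generated by $x$ is the closure of $\{T^nx : n\in\mathbb{N}\}$; it is minimal (no non-empty proper closed $Y\subset X$ with $TY\subseteq Y$) iff $x$ is uniformly recurrent. $\mathcal{L}_n(X)$ is the set of length-$n$ factors of elements of $X$, and $[u]_X$ is the set of elements of $X$ with prefix $u$. An invariant measure is a Borel probability measure $\mu$ on $X$ with $\mu(T^{-1}B)=\mu(B)$ for all Borel $B$. Boshernitzan's condition: a minimal shift $X$ satisfies it if it admits an invariant measure $\mu$ such that $\kappa(n)=\min_{u\in\mathcal{L}_n(X)} n\cdot\mu([u]_X)$ satisfies $\limsup_{n\to\infty}\kappa(n)>0$. A uniformly recurrent word satisfies it if the shift it generates does. Frequencies: $f_x(u)=\lim_{N\to\infty}\frac1N|\{i<N : x(i,i+|u|)=u\}|$. A word admits factor frequencies if this limit exists for every factor $u$ occurring infinitely often in it; the frequencies are computable if moreover there is a Turing machine which, given a factor $u$ and a tolerance $\delta>0$, computes a rational $\rho$ with $|f_x(u)-\rho|<\delta$. *)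

theory Defs
  imports "HOL-Probability.Probability" "HOL-Library.Nat_Bijection" "HOL-Library.Countable"
begin

text \<open>Infinite words over an alphabet \<open>'a\<close> are functions \<open>nat \<Rightarrow> 'a\<close>, finite words are lists, and
  \<open>x(i,j)\<close> is \<open>map x [i..<j]\<close>.\<close>

section \<open>Factors, recurrence, return words\<close>

definition occurs_at :: "(nat \<Rightarrow> 'a) \<Rightarrow> 'a list \<Rightarrow> nat \<Rightarrow> bool" where
  "occurs_at x u i \<longleftrightarrow> map x [i..<i + length u] = u"

definition is_factor :: "'a list \<Rightarrow> (nat \<Rightarrow> 'a) \<Rightarrow> bool" where
  "is_factor u x \<longleftrightarrow> (\<exists>i. occurs_at x u i)"

definition occurs_infinitely_often :: "'a list \<Rightarrow> (nat \<Rightarrow> 'a) \<Rightarrow> bool" where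
  "occurs_infinitely_often u x \<longleftrightarrow> infinite {i. occurs_at x u i}"

definition recurrent :: "(nat \<Rightarrow> 'a) \<Rightarrow> bool" where
  "recurrent x \<longleftrightarrow> (\<forall>u. is_factor u x \<longrightarrow> occurs_infinitely_often u x)"

definition occurrences :: "'a list \<Rightarrow> 'a list \<Rightarrow> nat set" where
  "occurrences u w = {i. i + length u \<le> length w \<and> take (length u) (drop i w) = u}"

definition return_word :: "(nat \<Rightarrow> 'a) \<Rightarrow> 'a list \<Rightarrow> 'a list \<Rightarrow> bool" where
  "return_word x u r \<longleftrightarrow>
     is_factor (r @ u) x \<and> card (occurrences u (r @ u)) = 2 \<and>
     0 \<in> occurrences u (r @ u) \<and> length r \<in> occurrences u (r @ u)"

definition uniformly_recurrent :: "(nat \<Rightarrow> 'a) \<Rightarrow> bool" where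
  "uniformly_recurrent x \<longleftrightarrow>
     recurrent x \<and> (\<forall>u. is_factor u x \<longrightarrow> finite {r. return_word x u r})"

text \<open>The maximum is over a finite non-empty set when \<open>x\<close> is uniformly recurrent over a finite
  alphabet, the only case in which this function is used.\<close>

definition max_return :: "(nat \<Rightarrow> 'a) \<Rightarrow> nat \<Rightarrow> nat" where
  "max_return x n =
     Max {length r | r u. is_factor u x \<and> length u = n \<and> return_word x u r}"

section \<open>Shifts and Boshernitzan's condition\<close>

definition shift_map :: "(nat \<Rightarrow> 'a) \<Rightarrow> nat \<Rightarrow> 'a" where
  "shift_map x = (\<lambda>n. x (Suc n))"

definition is_suffix :: "(nat \<Rightarrow> 'a) \<Rightarrow> (nat \<Rightarrow> 'a) \<Rightarrow> bool" where
  "is_suffix y w \<longleftrightarrow> (\<exists>k. y = (shift_map ^^ k) w)"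

definition word_topology :: "(nat \<Rightarrow> 'a) topology" where
  "word_topology = product_topology (\<lambda>_. discrete_topology UNIV) UNIV"

definition is_shift :: "(nat \<Rightarrow> 'a) set \<Rightarrow> bool" where
  "is_shift X \<longleftrightarrow> closedin word_topology X \<and> shift_map ` X \<subseteq> X"

definition generated_shift :: "(nat \<Rightarrow> 'a) \<Rightarrow> (nat \<Rightarrow> 'a) set" where
  "generated_shift x = word_topology closure_of (range (\<lambda>n. (shift_map ^^ n) x))"

definition minimal_shift :: "(nat \<Rightarrow> 'a) set \<Rightarrow> bool" where
  "minimal_shift X \<longleftrightarrow> is_shift X \<and> \<not> (\<exists>Y. Y \<noteq> {} \<and> Y \<subset> X \<and> is_shift Y)"

definition language :: "(nat \<Rightarrow> 'a) set \<Rightarrow> nat \<Rightarrow> 'a list set" where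
  "language X n = {u. length u = n \<and> (\<exists>z\<in>X. is_factor u z)}"

definition cylinder :: "(nat \<Rightarrow> 'a) set \<Rightarrow> 'a list \<Rightarrow> (nat \<Rightarrow> 'a) set" where
  "cylinder X u = {z\<in>X. map z [0..<length u] = u}"

definition borel_of :: "'c topology \<Rightarrow> 'c measure" where
  "borel_of T = sigma (topspace T) {U. openin T U}"

text \<open>A measure on \<open>X\<close> has \<open>X\<close> itself as its space, so the preimage under the shift map is taken
  within \<open>X\<close>.\<close>

definition invariant_measure :: "(nat \<Rightarrow> 'a) set \<Rightarrow> (nat \<Rightarrow> 'a) measure \<Rightarrow> bool" where
  "invariant_measure X \<mu> \<longleftrightarrow>
     prob_space \<mu> \<and> sets \<mu> = sets (borel_of (subtopology word_topology X)) \<and>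
     (\<forall>B\<in>sets \<mu>. measure \<mu> (shift_map -` B \<inter> X) = measure \<mu> B)"

definition kappa :: "(nat \<Rightarrow> 'a) set \<Rightarrow> (nat \<Rightarrow> 'a) measure \<Rightarrow> nat \<Rightarrow> real" where
  "kappa X \<mu> n = Min ((\<lambda>u. real n * measure \<mu> (cylinder X u)) ` language X n)"

text \<open>The limes superior is taken in the extended reals, since \<open>kappa\<close> is unbounded for periodic
  shifts.\<close>

definition boshernitzan_shift :: "(nat \<Rightarrow> 'a) set \<Rightarrow> bool" where
  "boshernitzan_shift X \<longleftrightarrow>
     minimal_shift X \<and>
     (\<exists>\<mu>. invariant_measure X \<mu> \<and> limsup (\<lambda>n. ereal (kappa X \<mu> n)) > 0)"

definition boshernitzan :: "(nat \<Rightarrow> 'a) \<Rightarrow> bool" where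
  "boshernitzan x \<longleftrightarrow> boshernitzan_shift (generated_shift x)"

section \<open>Computability\<close>

text \<open>Partial recursive functions of several arguments. The arguments are passed as a list;
  \<open>partial_recursive n f\<close> constrains \<open>f\<close> meaningfully only on lists of length \<open>n\<close>.\<close>

fun prim_rec :: "(nat list \<Rightarrow> nat option) \<Rightarrow> (nat list \<Rightarrow> nat option) \<Rightarrow> nat \<Rightarrow> nat list \<Rightarrow> nat option"
  where
  "prim_rec f g 0 xs = f xs"
| "prim_rec f g (Suc n) xs = Option.bind (prim_rec f g n xs) (\<lambda>r. g (n # r # xs))"

definition is_mu :: "(nat list \<Rightarrow> nat option) \<Rightarrow> nat list \<Rightarrow> nat \<Rightarrow> bool" where
  "is_mu f xs n \<longleftrightarrow> f (n # xs) = Some 0 \<and> (\<forall>m<n. \<exists>k>0. f (m # xs) = Some k)"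

inductive partial_recursive :: "nat \<Rightarrow> (nat list \<Rightarrow> nat option) \<Rightarrow> bool" where
  zero: "partial_recursive n (\<lambda>xs. Some 0)"
| succ: "partial_recursive 1 (\<lambda>xs. Some (Suc (xs ! 0)))"
| proj: "i < n \<Longrightarrow> partial_recursive n (\<lambda>xs. Some (xs ! i))"
| comp: "partial_recursive (length gs) f \<Longrightarrow> (\<forall>g\<in>set gs. partial_recursive n g) \<Longrightarrow>
    partial_recursive n (\<lambda>xs. if \<forall>g\<in>set gs. g xs \<noteq> None
                              then f (map (\<lambda>g. the (g xs)) gs) else None)"
| prim: "partial_recursive n f \<Longrightarrow> partial_recursive (n + 2) g \<Longrightarrow>
    partial_recursive (n + 1) (\<lambda>xs. prim_rec f g (hd xs) (tl xs))"
| mu: "partial_recursive (n + 1) f \<Longrightarrow>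
    partial_recursive n (\<lambda>xs. if \<exists>k. is_mu f xs k then Some (THE k. is_mu f xs k) else None)"

definition computable :: "(nat \<Rightarrow> nat) \<Rightarrow> bool" where
  "computable f \<longleftrightarrow> (\<exists>g. partial_recursive 1 g \<and> (\<forall>n. g [n] = Some (f n)))"

text \<open>Letters are coded through the injection \<open>to_nat\<close>. As alphabets are finite, any two injections
  into \<open>nat\<close> give the same notions of computability.\<close>

definition word_code :: "'a::finite list \<Rightarrow> nat" where
  "word_code u = list_encode (map to_nat u)"

definition rat_of_code :: "nat \<Rightarrow> rat" where
  "rat_of_code c = (case prod_decode c of (a, b) \<Rightarrow> of_int (int_decode a) / of_nat (Suc b))"

lemma surj_rat_of_code: "surj rat_of_code"
proof (rule surjI)
  fix q :: rat
  let ?a = "fst (quotient_of q)" and ?b = "snd (quotient_of q)"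
  have "?b > 0"
    using quotient_of_denom_pos' by blast
  then have "of_nat (Suc (nat ?b - 1)) = (of_int ?b :: rat)"
    by simp
  then show "rat_of_code (prod_encode (int_encode ?a, nat ?b - 1)) = q"
    using quotient_of_div[of q ?a ?b] by (simp add: rat_of_code_def del: of_nat_Suc)
qed

definition effectively_uniformly_recurrent :: "(nat \<Rightarrow> 'a::finite) \<Rightarrow> bool" where
  "effectively_uniformly_recurrent x \<longleftrightarrow>
     uniformly_recurrent x \<and> computable (\<lambda>n. to_nat (x n)) \<and> computable (max_return x)"

section \<open>Factor frequencies\<close>

definition occurrence_rate :: "(nat \<Rightarrow> 'a) \<Rightarrow> 'a list \<Rightarrow> nat \<Rightarrow> real" where
  "occurrence_rate x u N = real (card {i. i < N \<and> occurs_at x u i}) / real N"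

definition frequency :: "(nat \<Rightarrow> 'a) \<Rightarrow> 'a list \<Rightarrow> real" where
  "frequency x u = lim (occurrence_rate x u)"

definition admits_factor_frequencies :: "(nat \<Rightarrow> 'a) \<Rightarrow> bool" where
  "admits_factor_frequencies x \<longleftrightarrow>
     (\<forall>u. is_factor u x \<and> occurs_infinitely_often u x \<longrightarrow> convergent (occurrence_rate x u))"

text \<open>The algorithm receives codes of a factor and of a positive rational tolerance; nothing is
  required of it (not even termination) on other inputs.\<close>

definition admits_computable_factor_frequencies :: "(nat \<Rightarrow> 'a::finite) \<Rightarrow> bool" where
  "admits_computable_factor_frequencies x \<longleftrightarrow>
     admits_factor_frequencies x \<and>
     (\<exists>g. partial_recursive 2 g \<and>
        (\<forall>u d. is_factor u x \<and> rat_of_code d > 0 \<longrightarrow>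
           (\<exists>c. g [word_code u, d] = Some c \<and>
                \<bar>frequency x u - of_rat (rat_of_code c)\<bar> < of_rat (rat_of_code d))))"

section \<open>Transducers\<close>

record ('q, 'a, 'b) transducer =
  init_state :: 'q
  next_state :: "'q \<Rightarrow> 'a \<Rightarrow> 'q"
  out_word :: "'q \<Rightarrow> 'a \<Rightarrow> 'b list"

primrec run_state :: "('q, 'a, 'b) transducer \<Rightarrow> (nat \<Rightarrow> 'a) \<Rightarrow> nat \<Rightarrow> 'q" where
  "run_state A x 0 = init_state A"
| "run_state A x (Suc n) = next_state A (run_state A x n) (x n)"

definition output_prefix :: "('q, 'a, 'b) transducer \<Rightarrow> (nat \<Rightarrow> 'a) \<Rightarrow> nat \<Rightarrow> 'b list" where
  "output_prefix A x N = concat (map (\<lambda>n. out_word A (run_state A x n) (x n)) [0..<N])"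

definition infinite_output :: "('q, 'a, 'b) transducer \<Rightarrow> (nat \<Rightarrow> 'a) \<Rightarrow> bool" where
  "infinite_output A x \<longleftrightarrow> (\<forall>n. \<exists>N. n < length (output_prefix A x N))"

text \<open>The infinite word \<open>A(x)\<close>; meaningful only if \<open>infinite_output A x\<close>.\<close>

definition transducer_output :: "('q, 'a, 'b) transducer \<Rightarrow> (nat \<Rightarrow> 'a) \<Rightarrow> nat \<Rightarrow> 'b" where
  "transducer_output A x n =
     output_prefix A x (LEAST N. n < length (output_prefix A x N)) ! n"

end

theory Submission
  imports Defs
begin

text \<open>Call a factor \<open>v\<close> of \<open>x\<close> minimal if the number of states that the transducer assumes infinitely
  often right after reading \<open>v\<close> is as small as possible. Extensions of minimal factors are minimal,
  and all factors of some length \<open>R\<close> are minimal; hence reading on acts bijectively on these sets of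
  states, and every admissible state after a factor of length \<open>R\<close> recurs with every continuation.
  This gives the uniform recurrence of the output and allows one to lift the invariant measure of \<open>x\<close>:
  put equal mass on the admissible states and build a tower over the letters produced in one step.
  Each factor of the output of length proportional to \<open>N\<close> contains in its cylinder the image of a
  cylinder of \<open>x\<close> of length \<open>N\<close>, which transfers Boshernitzan's condition.

  That this condition forces uniform frequencies is seen as follows. If the averages over windows
  of length \<open>N\<close> oscillated, a shortest path in the Rauzy graph of order about \<open>N\<close> would lead from a
  window with low to one with high average. Its vertices are distinct and each has measure at
  least \<open>\<epsilon> / N\<close>, so there are \<open>O(N)\<close> of them, and since the mean square deviation of the averages
  over short subwindows from the average over the window has a small integral, it is small for most
  vertices; overlapping windows with small deviation have almost the same average.

  Effectively, the factors of the output of a given length, the longest return words and the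
  frequencies are found by unbounded search with a decidable stopping condition.\<close>

section \<open>Factors and return words\<close>

text \<open>Boshernitzan's condition provides one invariant measure, not known to be ergodic, and
  good lengths that may be very sparse. Both facts shape the frequency argument. The integral
  \<open>V n\<close> of the squared average over \<open>n\<close> letters satisfies
  \<open>V N \<le> V n + 2 * n / N\<close>, and the slack in this inequality bounds the integrated
  dispersion; an \<open>n\<close> that nearly attains the infimum of \<open>V\<close> therefore
  works for all large \<open>N\<close>. One window length with small oscillation then controls all
  longer averages, so sparse good lengths suffice. Letters may have empty output. That the output
  nevertheless grows linearly follows from the bounded gaps of a single output letter, uniformly in
  the admissible starting state; this turns a bound at length \<open>N\<close> for \<open>x\<close>
  into one at a proportional length for the output. In the effective part, \<open>R\<close>,
  \<open>s0\<close>, \<open>G\<close> and \<open>J\<close> are constants built into the programs.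
  Their existence is enough; nothing computes them from \<open>A\<close> and \<open>x\<close>. Only
  what depends on a length, a factor or a tolerance is searched for.\<close>

definition fac :: "(nat \<Rightarrow> 'a) \<Rightarrow> nat \<Rightarrow> nat \<Rightarrow> 'a list" where
  "fac x i n = map x [i..<i + n]"

abbreviation (input) sh :: "nat \<Rightarrow> (nat \<Rightarrow> 'a) \<Rightarrow> nat \<Rightarrow> 'a" where
  "sh k x \<equiv> (\<lambda>i. x (i + k))"

lemma shift_map_funpow: "(shift_map ^^ k) x = sh k x"
  by (induction k) (auto simp: shift_map_def)

lemma length_fac [simp]: "length (fac x i n) = n"
  by (simp add: fac_def)

lemma nth_fac [simp]: "a < n \<Longrightarrow> fac x i n ! a = x (i + a)"
  by (simp add: fac_def)

lemma fac_0 [simp]: "fac x i 0 = []"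
  by (simp add: fac_def)

lemma fac_eq_iff: "fac x i n = fac y j n \<longleftrightarrow> (\<forall>a<n. x (i + a) = y (j + a))"
  by (simp add: list_eq_iff_nth_eq)

lemma fac_sh [simp]: "fac (sh k x) i n = fac x (i + k) n"
  by (simp add: list_eq_iff_nth_eq ac_simps)

lemma fac_add: "fac x i (m + n) = fac x i m @ fac x (i + m) n"
  by (rule nth_equalityI) (auto simp: nth_append)

lemma fac_Suc: "fac x i (Suc n) = fac x i n @ [x (i + n)]"
  by (rule nth_equalityI) (auto simp: nth_append less_Suc_eq)

lemma fac_eq_mono: "fac x i n = fac y j n \<Longrightarrow> a + m \<le> n \<Longrightarrow> fac x (i + a) m = fac y (j + a) m"
  by (auto simp: fac_eq_iff add.assoc)

lemma occurs_at_fac: "occurs_at x u i \<longleftrightarrow> fac x i (length u) = u"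
  by (simp add: occurs_at_def fac_def)

lemma is_factor_fac [simp]: "is_factor (fac x i n) x"
  by (auto simp: is_factor_def occurs_at_fac)

lemma is_factorE:
  assumes "is_factor u x" obtains i where "u = fac x i (length u)"
  using assms by (metis is_factor_def occurs_at_fac)

lemma is_factor_append:
  assumes "is_factor (u @ v) x" shows "is_factor u x" "is_factor v x"
proof -
  obtain i where "u @ v = fac x i (length u + length v)"
    using assms is_factorE by (metis length_append)
  then have "u @ v = fac x i (length u) @ fac x (i + length u) (length v)"
    by (simp add: fac_add)
  then have "u = fac x i (length u)" "v = fac x (i + length u) (length v)"
    by auto
  then show "is_factor u x" "is_factor v x"
    by (metis is_factor_fac)+
qed

lemma finite_lists_of_length [simp]: "finite {u :: 'a::finite list. length u = n}"
  using finite_lists_length_eq[of "UNIV :: 'a set" n] by simp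

lemma finite_range_fac: "finite (range (\<lambda>i. fac (x :: nat \<Rightarrow> 'a::finite) i n))"
  by (rule finite_subset[OF _ finite_lists_of_length[of n]]) auto

text \<open>The working form of uniform recurrence. It speaks of positions instead of return words,
  which is what can be followed through the transducer.\<close>

definition bounded_gaps :: "(nat \<Rightarrow> 'a) \<Rightarrow> bool" where
  "bounded_gaps x \<longleftrightarrow> (\<forall>i n. \<exists>M. \<forall>j. \<exists>k. j \<le> k \<and> k < j + M \<and> fac x k n = fac x i n)"

lemma return_word_fac:
  assumes "p < p'" "fac x p' n = fac x p n" "\<And>k. p < k \<Longrightarrow> k < p' \<Longrightarrow> fac x k n \<noteq> fac x p n"
  shows "return_word x (fac x p n) (fac x p (p' - p))"
proof -
  let ?u = "fac x p n" and ?r = "fac x p (p' - p)"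
  have ru: "?r @ ?u = fac x p (p' - p + n)"
    unfolding fac_add using assms by simp
  have sub: "take n (drop i (fac x p (p' - p + n))) = fac x (p + i) n" if "i \<le> p' - p" for i
    using that by (intro nth_equalityI) (auto simp: add.assoc)
  have "occurrences ?u (?r @ ?u) = {0, p' - p}"
  proof (intro set_eqI iffI)
    fix i assume "i \<in> occurrences ?u (?r @ ?u)"
    then have i: "i \<le> p' - p" "fac x (p + i) n = ?u"
      using sub[of i] unfolding ru by (auto simp: occurrences_def)
    show "i \<in> {0, p' - p}"
      using i assms(3)[of "p + i"] by (cases "p + i < p'"; cases "i = 0") auto
  next
    fix i assume "i \<in> {0, p' - p}"
    then show "i \<in> occurrences ?u (?r @ ?u)"
      using sub[of i] assms(1,2) unfolding ru by (auto simp: occurrences_def)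
  qed
  then show ?thesis
    using assms(1) by (auto simp: return_word_def ru)
qed

lemma return_word_gap:
  assumes "return_word x u r"
  obtains p where "fac x p (length u) = u" "fac x (p + length r) (length u) = u" "0 < length r"
    "\<And>k. p < k \<Longrightarrow> k < p + length r \<Longrightarrow> fac x k (length u) \<noteq> u"
proof -
  let ?n = "length u"
  have occ: "card (occurrences u (r @ u)) = 2" "0 \<in> occurrences u (r @ u)" "length r \<in> occurrences u (r @ u)"
    using assms by (auto simp: return_word_def)
  obtain p where p: "r @ u = fac x p (length r + ?n)"
    using assms is_factorE unfolding return_word_def by (metis length_append)
  have sub: "take ?n (drop i (r @ u)) = fac x (p + i) ?n" if "i \<le> length r" for i
    using that unfolding p by (intro nth_equalityI) (auto simp: add.assoc)
  have iff: "i \<in> occurrences u (r @ u) \<longleftrightarrow> i \<le> length r \<and> fac x (p + i) ?n = u" for i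
    using sub[of i] by (auto simp: occurrences_def)
  \<comment> \<open>With \<open>r\<close> empty, the two occurrences required by the definition
    would coincide.\<close>
  have pos: "0 < length r"
  proof (rule ccontr)
    assume "\<not> 0 < length r"
    then have "occurrences u (r @ u) \<subseteq> {0}" unfolding subset_iff iff by simp
    then have "card (occurrences u (r @ u)) \<le> 1"
      using card_mono by (metis finite.emptyI finite.insertI is_singletonI is_singleton_altdef)
    then show False using occ by simp
  qed
  have eq: "occurrences u (r @ u) = {0, length r}"
  proof (rule sym, rule card_subset_eq)
    show "finite (occurrences u (r @ u))" using occ(1) card.infinite by force
  qed (use occ pos in auto)
  show thesis
  proof (rule that[of p])
    show "fac x k ?n \<noteq> u" if "p < k" "k < p + length r" for k
    proof
      assume "fac x k ?n = u"
      then have "k - p \<in> occurrences u (r @ u)" using that by (simp add: iff)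
      then show False using that eq by auto
    qed
  qed (use occ iff pos in auto)
qed

lemma next_occurrence:
  assumes "infinite {i. fac x i n = u}"
  obtains p' where "p < p'" "fac x p' n = u" "\<And>k. p < k \<Longrightarrow> k < p' \<Longrightarrow> fac x k n \<noteq> u"
proof -
  define p' where "p' = (LEAST k. p < k \<and> fac x k n = u)"
  have "\<exists>k. p < k \<and> fac x k n = u"
    using assms by (metis (mono_tags, lifting) infinite_nat_iff_unbounded mem_Collect_eq)
  then have "p < p' \<and> fac x p' n = u"
    unfolding p'_def by (rule LeastI_ex)
  moreover have "fac x k n \<noteq> u" if "p < k" "k < p'" for k
    using that not_less_Least unfolding p'_def by blast
  ultimately show thesis using that by blast
qed

lemma uniformly_recurrent_iff_bounded_gaps:
  fixes x :: "nat \<Rightarrow> 'a::finite"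
  shows "uniformly_recurrent x \<longleftrightarrow> bounded_gaps x"
proof
  assume ur: "uniformly_recurrent x"
  show "bounded_gaps x"
    unfolding bounded_gaps_def
  proof (intro allI)
    fix i n
    let ?u = "fac x i n"
    have inf: "infinite {k. fac x k n = ?u}"
      using ur unfolding uniformly_recurrent_def recurrent_def occurs_infinitely_often_def occurs_at_fac
      by (metis is_factor_fac length_fac)
    have "finite {r. return_word x ?u r}"
      using ur by (simp add: uniformly_recurrent_def)
    then obtain B where B: "\<And>r. return_word x ?u r \<Longrightarrow> length r \<le> B"
      by (metis (mono_tags, lifting) finite_imageI finite_nat_set_iff_bounded_le imageI mem_Collect_eq)
    show "\<exists>M. \<forall>j. \<exists>k. j \<le> k \<and> k < j + M \<and> fac x k n = ?u"
    proof (rule exI, rule allI)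
      fix j
      \<comment> \<open>The summand \<open>i\<close> pays for windows that begin at or before the
        known occurrence \<open>i\<close>. Any later window has an occurrence before it, and the
        return from the last such occurrence takes at most \<open>B\<close> steps.\<close>
      show "\<exists>k. j \<le> k \<and> k < j + (i + B + 1) \<and> fac x k n = ?u"
      proof (cases "j \<le> i")
        case True then show ?thesis by (intro exI[of _ i]) auto
      next
        case False
        define p where "p = Max {k. k < j \<and> fac x k n = ?u}"
        have fin: "finite {k. k < j \<and> fac x k n = ?u}" by auto
        have ne: "{k. k < j \<and> fac x k n = ?u} \<noteq> {}" using False by (auto simp: not_le)
        have p: "p < j" "fac x p n = ?u" using Max_in[OF fin ne] by (auto simp: p_def)
        obtain p' where p': "p < p'" "fac x p' n = ?u" "\<And>k. p < k \<Longrightarrow> k < p' \<Longrightarrow> fac x k n \<noteq> ?u"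
          using next_occurrence[OF inf] by metis
        have "return_word x ?u (fac x p (p' - p))"
          using return_word_fac[of p p' x n] p' p by simp
        then have "p' - p \<le> B" using B by fastforce
        moreover have "j \<le> p'"
          using p' Max_ge[OF fin, of p'] by (force simp: p_def[symmetric])
        ultimately show ?thesis using p p' by (intro exI[of _ p']) auto
      qed
    qed
  qed
next
  assume bg: "bounded_gaps x"
  show "uniformly_recurrent x"
    unfolding uniformly_recurrent_def
  proof (intro conjI allI impI)
    show "recurrent x"
      unfolding recurrent_def occurs_infinitely_often_def occurs_at_fac
    proof (intro allI impI)
      fix u assume "is_factor u x"
      then obtain i where u: "u = fac x i (length u)" by (rule is_factorE)
      show "infinite {i. fac x i (length u) = u}"
        unfolding infinite_nat_iff_unbounded_le
        using bg u unfolding bounded_gaps_def by (metis (mono_tags, lifting) mem_Collect_eq)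
    qed
  next
    fix u assume "is_factor u x"
    then obtain i where u: "u = fac x i (length u)" by (rule is_factorE)
    obtain M where M: "\<And>j. \<exists>k. j \<le> k \<and> k < j + M \<and> fac x k (length u) = u"
      using bg u unfolding bounded_gaps_def by metis
    have "{r. return_word x u r} \<subseteq> {r. set r \<subseteq> UNIV \<and> length r \<le> M}"
    proof clarsimp
      fix r assume "return_word x u r"
      then obtain p where p: "\<And>k. p < k \<Longrightarrow> k < p + length r \<Longrightarrow> fac x k (length u) \<noteq> u"
        using return_word_gap by metis
      obtain k where "p + 1 \<le> k" "k < p + 1 + M" "fac x k (length u) = u"
        using M[of "p + 1"] by blast
      then show "length r \<le> M" using p[of k] by (cases "k < p + length r") auto
    qed
    then show "finite {r. return_word x u r}"
      by (rule finite_subset) (rule finite_lists_length_le, simp)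
  qed
qed

lemma bounded_gaps_infinite:
  assumes "bounded_gaps x" shows "infinite {k. fac x k n = fac x i n}"
  unfolding infinite_nat_iff_unbounded_le
  using assms unfolding bounded_gaps_def by (metis (mono_tags, lifting) mem_Collect_eq)

text \<open>\<open>max_return x n\<close> is the least \<open>R\<close> with this property. In
  contrast to a maximum over all return words, the property can be tested once the factors of length
  \<open>R + n\<close> are known.\<close>

definition returns_within :: "(nat \<Rightarrow> 'a) \<Rightarrow> nat \<Rightarrow> nat \<Rightarrow> bool" where
  "returns_within x n R \<longleftrightarrow> (\<forall>i. \<exists>j. 1 \<le> j \<and> j \<le> R \<and> fac x (i + j) n = fac x i n)"

lemma
  fixes x :: "nat \<Rightarrow> 'a::finite"
  assumes "uniformly_recurrent x"
  shows returns_within_max_return: "returns_within x n (max_return x n)"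
    and max_return_le: "returns_within x n R \<Longrightarrow> max_return x n \<le> R"
proof -
  have bg: "bounded_gaps x" using assms uniformly_recurrent_iff_bounded_gaps by blast
  let ?S = "{length r | r u. is_factor u x \<and> length u = n \<and> return_word x u r}"
  have "?S \<subseteq> (\<Union>u\<in>range (\<lambda>i. fac x i n). length ` {r. return_word x u r})"
  proof clarify
    fix r u assume "is_factor u x" "n = length u" "return_word x u r"
    then show "length r \<in> (\<Union>u\<in>range (\<lambda>i. fac x i (length u)). length ` {r. return_word x u r})"
      by (metis (mono_tags, lifting) UN_I image_eqI is_factorE mem_Collect_eq rangeI)
  qed
  moreover have "finite (\<Union>u\<in>range (\<lambda>i. fac x i n). length ` {r. return_word x u r})"
  proof (intro finite_UN_I finite_range_fac)
    fix u assume "u \<in> range (\<lambda>i. fac x i n)"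
    then have "is_factor u x" by auto
    then show "finite (length ` {r. return_word x u r})"
      using assms unfolding uniformly_recurrent_def by blast
  qed
  ultimately have fin: "finite ?S" by (rule finite_subset)
  have gap: "\<exists>r. return_word x (fac x i n) r \<and> fac x (i + length r) n = fac x i n \<and> 1 \<le> length r" for i
  proof -
    obtain p' where p': "i < p'" "fac x p' n = fac x i n"
      "\<And>k. i < k \<Longrightarrow> k < p' \<Longrightarrow> fac x k n \<noteq> fac x i n"
      using next_occurrence[OF bounded_gaps_infinite[OF bg]] by metis
    have "return_word x (fac x i n) (fac x i (p' - i))" by (rule return_word_fac) (use p' in auto)
    then show ?thesis using p' by (intro exI[of _ "fac x i (p' - i)"]) auto
  qed
  show "returns_within x n (max_return x n)"
    unfolding returns_within_def
  proof
    fix i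
    obtain r where r: "return_word x (fac x i n) r" "fac x (i + length r) n = fac x i n" "1 \<le> length r"
      using gap by blast
    then have "length r \<in> ?S" by (metis (mono_tags, lifting) is_factor_fac length_fac mem_Collect_eq)
    then have "length r \<le> max_return x n" unfolding max_return_def by (rule Max_ge[OF fin])
    then show "\<exists>j. 1 \<le> j \<and> j \<le> max_return x n \<and> fac x (i + j) n = fac x i n" using r by blast
  qed
  show "max_return x n \<le> R" if R: "returns_within x n R"
    unfolding max_return_def
  proof (rule Max.boundedI[OF fin])
    show "?S \<noteq> {}" using gap[of 0] by (metis (mono_tags, lifting) empty_iff is_factor_fac length_fac mem_Collect_eq)
    fix a assume "a \<in> ?S"
    then obtain r u where ru: "a = length r" "n = length u" "return_word x u r" by auto
    then obtain p where p: "fac x p n = u" "\<And>k. p < k \<Longrightarrow> k < p + length r \<Longrightarrow> fac x k n \<noteq> u"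
      using return_word_gap by metis
    obtain j where "1 \<le> j" "j \<le> R" "fac x (p + j) n = u" using R p by (auto simp: returns_within_def)
    then show "a \<le> R" using p(2)[of "p + j"] ru by (cases "j < length r") auto
  qed
qed

lemma max_return_eq_Least:
  fixes x :: "nat \<Rightarrow> 'a::finite"
  assumes "uniformly_recurrent x"
  shows "max_return x n = (LEAST R. returns_within x n R)"
  using assms by (intro Least_equality[symmetric] returns_within_max_return max_return_le)

text \<open>A prefix that contains a factor only at its end recurs, and the occurrence of the factor that
  precedes the one at the end of the later copy lies before this copy.\<close>

lemma factor_in_prefix:
  fixes x :: "nat \<Rightarrow> 'a::finite"
  assumes "uniformly_recurrent x"
  shows "\<exists>k < max_return x n. fac x k n = fac x i n"
proof -
  have bg: "bounded_gaps x" using assms uniformly_recurrent_iff_bounded_gaps by blast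
  define k where "k = (LEAST k. fac x k n = fac x i n)"
  have k: "fac x k n = fac x i n" unfolding k_def by (rule LeastI) (rule refl)
  have min: "fac x j n \<noteq> fac x i n" if "j < k" for j using that not_less_Least unfolding k_def by blast
  obtain j where j: "k < j" "fac x j (k + n) = fac x 0 (k + n)"
    using bounded_gaps_infinite[OF bg, of "k + n" 0] unfolding infinite_nat_iff_unbounded by auto
  have cop: "fac x (j + a) n = fac x a n" if "a \<le> k" for a
    using fac_eq_mono[OF j(2), of a n] that by auto
  let ?P = "{p. p < j + k \<and> fac x p n = fac x i n}"
  have fin: "finite ?P" by auto
  have ne: "?P \<noteq> {}" using k j by force
  define p where "p = Max ?P"
  have p: "p < j + k" "fac x p n = fac x i n" using Max_in[OF fin ne] by (auto simp: p_def)
  have pj: "p < j"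
  proof (rule ccontr)
    assume "\<not> p < j"
    then have "fac x (p - j) n = fac x i n" using cop[of "p - j"] p by auto
    then show False using min[of "p - j"] p \<open>\<not> p < j\<close> by auto
  qed
  obtain h where h: "1 \<le> h" "h \<le> max_return x n" "fac x (p + h) n = fac x i n"
    using returns_within_max_return[OF assms, of n] p unfolding returns_within_def by metis
  have "j + k \<le> p + h"
  proof (rule ccontr)
    assume "\<not> j + k \<le> p + h"
    then have "p + h \<in> ?P" using h by auto
    then have "p + h \<le> p" unfolding p_def by (rule Max_ge[OF fin])
    then show False using h by simp
  qed
  then show ?thesis using k pj h by (intro exI[of _ k]) auto
qed

section \<open>Shifts and invariant measures\<close>

lemma is_factor_facD: "is_factor (fac z i n) x \<Longrightarrow> \<exists>j. fac x j n = fac z i n"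
  by (metis is_factorE length_fac)

section \<open>The word topology in terms of prefixes\<close>

lemma topspace_word_topology [simp]: "topspace word_topology = UNIV"
  by (simp add: word_topology_def)

text \<open>A basic open set of the product restricts finitely many coordinates, and these lie in a
  prefix.\<close>

lemma openin_word_topology:
  "openin word_topology U \<longleftrightarrow> (\<forall>z\<in>U. \<exists>n. \<forall>z'. fac z' 0 n = fac z 0 n \<longrightarrow> z' \<in> U)"
proof
  assume U: "openin word_topology U"
  show "\<forall>z\<in>U. \<exists>n. \<forall>z'. fac z' 0 n = fac z 0 n \<longrightarrow> z' \<in> U"
  proof
    fix z assume "z \<in> U"
    then obtain V where V: "finite {i. V i \<noteq> UNIV}" "z \<in> Pi\<^sub>E UNIV V" "Pi\<^sub>E UNIV V \<subseteq> U"
      using U unfolding word_topology_def openin_product_topology_alt by force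
    then obtain n where n: "\<And>i. V i \<noteq> UNIV \<Longrightarrow> i < n"
      by (metis (mono_tags, lifting) finite_nat_set_iff_bounded mem_Collect_eq)
    have "z' \<in> U" if "fac z' 0 n = fac z 0 n" for z'
    proof -
      have "z' i \<in> V i" for i
        using that n[of i] V(2) by (cases "V i = UNIV") (auto simp: fac_eq_iff PiE_iff)
      then show ?thesis using V(3) by auto
    qed
    then show "\<exists>n. \<forall>z'. fac z' 0 n = fac z 0 n \<longrightarrow> z' \<in> U" by blast
  qed
next
  assume U: "\<forall>z\<in>U. \<exists>n. \<forall>z'. fac z' 0 n = fac z 0 n \<longrightarrow> z' \<in> U"
  show "openin word_topology U"
    unfolding word_topology_def openin_product_topology_alt
  proof (intro ballI)
    fix z assume "z \<in> U"
    then obtain n where n: "\<And>z'. fac z' 0 n = fac z 0 n \<Longrightarrow> z' \<in> U" using U by blast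
    let ?V = "\<lambda>i. if i < n then {z i} else UNIV"
    have "{i. ?V i \<noteq> UNIV} \<subseteq> {..<n}" by auto
    then have "finite {i. ?V i \<noteq> UNIV}" using finite_subset by blast
    moreover have "Pi\<^sub>E UNIV ?V \<subseteq> U"
      by (auto intro!: n simp: fac_eq_iff PiE_iff split: if_splits)
    ultimately show "\<exists>V. finite {i \<in> UNIV. V i \<noteq> topspace (discrete_topology UNIV)} \<and>
        (\<forall>i\<in>UNIV. openin (discrete_topology UNIV) (V i)) \<and> z \<in> Pi\<^sub>E UNIV V \<and> Pi\<^sub>E UNIV V \<subseteq> U"
      by (intro exI[of _ ?V]) auto
  qed
qed

lemma openin_subtopology_word_topology:
  "openin (subtopology word_topology X) U \<longleftrightarrow>
     U \<subseteq> X \<and> (\<forall>z\<in>U. \<exists>n. \<forall>z'\<in>X. fac z' 0 n = fac z 0 n \<longrightarrow> z' \<in> U)"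
proof (intro iffI conjI)
  assume "U \<subseteq> X \<and> (\<forall>z\<in>U. \<exists>n. \<forall>z'\<in>X. fac z' 0 n = fac z 0 n \<longrightarrow> z' \<in> U)"
  then have sub: "U \<subseteq> X"
    and ex: "\<And>z. z \<in> U \<Longrightarrow> \<exists>n. \<forall>z'\<in>X. fac z' 0 n = fac z 0 n \<longrightarrow> z' \<in> U" by auto
  \<comment> \<open>The union of all full cylinders whose trace on \<open>X\<close> lies in
    \<open>U\<close>.\<close>
  define V where "V = {z'. \<exists>z\<in>U. \<exists>n. fac z' 0 n = fac z 0 n \<and>
    (\<forall>w\<in>X. fac w 0 n = fac z 0 n \<longrightarrow> w \<in> U)}"
  have "openin word_topology V"
    unfolding openin_word_topology by (auto simp: V_def) metis
  moreover have "U = V \<inter> X"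
    unfolding V_def using sub ex by blast
  ultimately show "openin (subtopology word_topology X) U"
    unfolding openin_subtopology by blast
next
  assume "openin (subtopology word_topology X) U"
  then obtain T where T: "openin word_topology T" "U = T \<inter> X" unfolding openin_subtopology by blast
  then show "U \<subseteq> X" "\<forall>z\<in>U. \<exists>n. \<forall>z'\<in>X. fac z' 0 n = fac z 0 n \<longrightarrow> z' \<in> U"
    unfolding openin_word_topology by blast+
qed

text \<open>Prefixes give a neighbourhood base, so membership in the orbit closure becomes a
  statement about factors of \<open>x\<close>.\<close>

lemma in_generated_shift_iff:
  "z \<in> generated_shift x \<longleftrightarrow> (\<forall>n. is_factor (fac z 0 n) x)"
proof
  assume z: "z \<in> generated_shift x"
  show "\<forall>n. is_factor (fac z 0 n) x"
  proof
    fix n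
    have "openin word_topology {z'. fac z' 0 n = fac z 0 n}"
      unfolding openin_word_topology by (auto intro!: exI[of _ n])
    then obtain k where "fac (sh k x) 0 n = fac z 0 n"
      using z unfolding generated_shift_def in_closure_of shift_map_funpow
      by (metis (mono_tags, lifting) mem_Collect_eq rangeE)
    then show "is_factor (fac z 0 n) x" by (metis fac_sh is_factor_fac)
  qed
next
  assume *: "\<forall>n. is_factor (fac z 0 n) x"
  show "z \<in> generated_shift x"
    unfolding generated_shift_def in_closure_of shift_map_funpow
  proof (intro conjI allI impI)
    fix U assume U: "z \<in> U \<and> openin word_topology U"
    then obtain n where n: "\<And>z'. fac z' 0 n = fac z 0 n \<Longrightarrow> z' \<in> U"
      unfolding openin_word_topology by blast
    obtain k where "fac x k n = fac z 0 n" using * by (metis is_factorE length_fac)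
    then have "sh k x \<in> U" using n[of "sh k x"] by simp
    then show "\<exists>y. y \<in> range (\<lambda>n. sh n x) \<and> y \<in> U" by blast
  qed simp
qed

lemma generated_shift_fac: "z \<in> generated_shift x \<Longrightarrow> is_factor (fac z i n) x"
  unfolding in_generated_shift_iff by (metis add_0 fac_add is_factor_append(2))

lemma self_in_generated_shift: "x \<in> generated_shift x"
  by (simp add: in_generated_shift_iff)

lemma shift_in_generated_shift: "z \<in> generated_shift x \<Longrightarrow> sh k z \<in> generated_shift x"
  by (metis fac_sh generated_shift_fac in_generated_shift_iff)

lemma shift_map_eq_sh: "shift_map = sh 1"
  by (auto simp: shift_map_def fun_eq_iff)

lemma is_shift_generated_shift: "is_shift (generated_shift x)"
  unfolding is_shift_def
  using shift_in_generated_shift[of _ x 1]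
  by (auto simp: generated_shift_def shift_map_eq_sh)

lemma is_shift_sh: "is_shift Y \<Longrightarrow> z \<in> Y \<Longrightarrow> sh k z \<in> Y"
proof (induction k)
  case (Suc k)
  then have "shift_map (sh k z) \<in> Y" by (auto simp: is_shift_def)
  then show ?case by (simp add: shift_map_def)
qed simp

lemma language_generated_shift: "language (generated_shift x) n = range (\<lambda>i. fac x i n)"
proof (intro set_eqI iffI)
  fix u assume "u \<in> language (generated_shift x) n"
  then obtain z where z: "z \<in> generated_shift x" "is_factor u z" and n: "length u = n"
    by (auto simp: language_def)
  obtain i where i: "u = fac z i n" using is_factorE[OF z(2)] n by metis
  obtain j where "fac x j n = fac z i n"
    using is_factor_facD[OF generated_shift_fac[OF z(1)]] by blast
  then show "u \<in> range (\<lambda>i. fac x i n)" using i by (metis rangeI)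
next
  fix u assume "u \<in> range (\<lambda>i. fac x i n)"
  then have "length u = n" "is_factor u x" by auto
  then show "u \<in> language (generated_shift x) n"
    using self_in_generated_shift[of x] by (auto simp: language_def)
qed

lemma cylinder_eq: "cylinder X u = {z\<in>X. fac z 0 (length u) = u}"
  by (simp add: cylinder_def fac_def)

text \<open>A closed proper subset misses the cylinder of some factor. Since this factor has bounded
  gaps in \<open>x\<close>, it occurs in every element of the orbit closure, and shifting the
  element to that occurrence leads into the missed cylinder.\<close>

lemma minimal_generated_shift:
  assumes "bounded_gaps x"
  shows "minimal_shift (generated_shift x)"
  unfolding minimal_shift_def
proof (intro conjI notI is_shift_generated_shift)
  assume "\<exists>Y. Y \<noteq> {} \<and> Y \<subset> generated_shift x \<and> is_shift Y"
  then obtain Y z z' where Y: "Y \<subseteq> generated_shift x" "is_shift Y" "z \<in> Y" "z' \<in> generated_shift x" "z' \<notin> Y"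
    by blast
  have "closedin word_topology Y" using Y by (simp add: is_shift_def)
  then have "openin word_topology (- Y)" by (simp add: closedin_def Compl_eq_Diff_UNIV)
  then obtain n where n: "\<And>w. fac w 0 n = fac z' 0 n \<Longrightarrow> w \<notin> Y"
    using Y(5) unfolding openin_word_topology by auto
  obtain i where i: "fac x i n = fac z' 0 n"
    using Y(4) unfolding in_generated_shift_iff by (metis is_factorE length_fac)
  obtain M where M: "\<And>j. \<exists>k. j \<le> k \<and> k < j + M \<and> fac x k n = fac x i n"
    using assms unfolding bounded_gaps_def by blast
  obtain p where p: "fac x p (M + n) = fac z 0 (M + n)"
    using Y(1,3) unfolding in_generated_shift_iff by (metis in_mono in_generated_shift_iff is_factorE length_fac)
  obtain d where d: "d < M" "fac x (p + d) n = fac x i n" using M[of p] by (auto simp: le_iff_add)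
  have "fac z d n = fac x (p + d) n"
    using fac_eq_mono[OF p, of d n] d by simp
  then have "fac (sh d z) 0 n = fac z' 0 n" using d i by simp
  then show False using n is_shift_sh[OF Y(2,3)] by blast
qed

section \<open>Borel sets of a shift and invariant measures\<close>

definition word_borel :: "(nat \<Rightarrow> 'a) set \<Rightarrow> (nat \<Rightarrow> 'a) measure" where
  "word_borel X = borel_of (subtopology word_topology X)"

lemma space_word_borel [simp]: "space (word_borel X) = X"
  by (simp add: word_borel_def borel_of_def space_measure_of_conv)

lemma sets_word_borel: "sets (word_borel X) = sigma_sets X {U. openin (subtopology word_topology X) U}"
proof -
  have "{U. openin (subtopology word_topology X) U} \<subseteq> Pow X" 
    by (auto simp: openin_subtopology)
  then show ?thesis
    by (simp add: word_borel_def borel_of_def)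
qed

lemma open_in_word_borel:
  "U \<subseteq> X \<Longrightarrow> (\<And>z. z \<in> U \<Longrightarrow> \<exists>n. \<forall>z'\<in>X. fac z' 0 n = fac z 0 n \<longrightarrow> z' \<in> U) \<Longrightarrow> U \<in> sets (word_borel X)"
  unfolding sets_word_borel by (rule sigma_sets.Basic) (simp add: openin_subtopology_word_topology)

lemma prefix_set_in_word_borel: "{z\<in>X. P (fac z 0 n)} \<in> sets (word_borel X)"
  by (rule open_in_word_borel) (auto intro!: exI[of _ n])

lemma cylinder_in_word_borel: "cylinder X u \<in> sets (word_borel X)"
  unfolding cylinder_eq by (rule prefix_set_in_word_borel)

text \<open>The second assumption is continuity: each prefix of the image is fixed by some prefix of
  the argument, whose length may depend on the argument.\<close>

lemma measurable_word_borel: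
  assumes "\<And>z. z \<in> X \<Longrightarrow> g z \<in> Y"
    and "\<And>z n. z \<in> X \<Longrightarrow> \<exists>m. \<forall>z'\<in>X. fac z' 0 m = fac z 0 m \<longrightarrow> fac (g z') 0 n = fac (g z) 0 n"
  shows "g \<in> measurable (word_borel X) (word_borel Y)"
proof (rule measurable_sigma_sets[OF sets_word_borel])
  show "{U. openin (subtopology word_topology Y) U} \<subseteq> Pow Y" by (auto simp: openin_subtopology)
  show "g \<in> space (word_borel X) \<rightarrow> Y" using assms(1) by auto
next
  fix U assume "U \<in> {U. openin (subtopology word_topology Y) U}"
  then have U: "\<And>z. z \<in> U \<Longrightarrow> \<exists>n. \<forall>z'\<in>Y. fac z' 0 n = fac z 0 n \<longrightarrow> z' \<in> U"
    by (auto simp: openin_subtopology_word_topology)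
  show "g -` U \<inter> space (word_borel X) \<in> sets (word_borel X)"
  proof (rule open_in_word_borel)
    fix z assume z: "z \<in> g -` U \<inter> space (word_borel X)"
    then obtain n where n: "\<And>z'. z' \<in> Y \<Longrightarrow> fac z' 0 n = fac (g z) 0 n \<Longrightarrow> z' \<in> U" using U[of "g z"] by auto
    obtain m where "\<forall>z'\<in>X. fac z' 0 m = fac z 0 m \<longrightarrow> fac (g z') 0 n = fac (g z) 0 n"
      using assms(2)[of z n] z by auto
    then show "\<exists>n. \<forall>z'\<in>X. fac z' 0 n = fac z 0 n \<longrightarrow> z' \<in> g -` U \<inter> space (word_borel X)"
      using n assms(1) by (intro exI[of _ m]) auto
  qed auto
qed

lemma measurable_shift:
  assumes "is_shift X"
  shows "shift_map \<in> measurable (word_borel X) (word_borel X)"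
proof (rule measurable_word_borel)
  fix z n
  have "\<forall>z'\<in>X. fac z' 0 (Suc n) = fac z 0 (Suc n) \<longrightarrow> fac (shift_map z') 0 n = fac (shift_map z) 0 n"
    by (auto simp: fac_eq_iff shift_map_def)
  then show "\<exists>m. \<forall>z'\<in>X. fac z' 0 m = fac z 0 m \<longrightarrow> fac (shift_map z') 0 n = fac (shift_map z) 0 n"
    by blast
qed (use assms in \<open>auto simp: is_shift_def\<close>)

locale shift_measure =
  fixes X :: "(nat \<Rightarrow> 'a) set" and \<mu> :: "(nat \<Rightarrow> 'a) measure"
  assumes shift: "is_shift X" and inv: "invariant_measure X \<mu>"
begin

sublocale prob_space \<mu>
  using inv by (simp add: invariant_measure_def)

lemma sets_eq [measurable_cong]: "sets \<mu> = sets (word_borel X)"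
  using inv by (simp add: invariant_measure_def word_borel_def)

lemma space_eq [simp]: "space \<mu> = X"
  using sets_eq_imp_space_eq[OF sets_eq] by simp

lemma measurable_shift_map [measurable]: "shift_map \<in> measurable \<mu> \<mu>"
  using measurable_shift[OF shift] by (simp add: measurable_cong_sets[OF sets_eq sets_eq])

lemma distr_shift_map: "distr \<mu> \<mu> shift_map = \<mu>"
proof (rule measure_eqI)
  fix B assume "B \<in> sets (distr \<mu> \<mu> shift_map)"
  then have B: "B \<in> sets \<mu>" by simp
  have "measure \<mu> (shift_map -` B \<inter> X) = measure \<mu> B"
    using inv B by (simp add: invariant_measure_def)
  then show "emeasure (distr \<mu> \<mu> shift_map) B = emeasure \<mu> B"
    using B by (simp add: emeasure_distr emeasure_eq_measure)
qed simp

lemma nn_integral_shift: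
  assumes "f \<in> borel_measurable \<mu>" shows "(\<integral>\<^sup>+z. f (shift_map z) \<partial>\<mu>) = (\<integral>\<^sup>+z. f z \<partial>\<mu>)"
  using nn_integral_distr[of shift_map \<mu> \<mu> f] assms distr_shift_map by simp

lemma integral_shift:
  fixes f :: "_ \<Rightarrow> real"
  assumes "f \<in> borel_measurable \<mu>" shows "(\<integral>z. f (sh j z) \<partial>\<mu>) = (\<integral>z. f z \<partial>\<mu>)"
proof (induction j)
  case (Suc j)
  have "(\<integral>z. f (sh (Suc j) z) \<partial>\<mu>) = (\<integral>z. f (sh j (shift_map z)) \<partial>\<mu>)"
    by (simp add: shift_map_def)
  also have "\<dots> = (\<integral>z. f (sh j z) \<partial>distr \<mu> \<mu> shift_map)"
  proof (rule integral_distr[symmetric])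
    have "(shift_map ^^ j) \<in> measurable \<mu> \<mu>"
      by (induction j) (auto intro: measurable_comp[OF _ measurable_shift_map] simp: id_def[symmetric])
    then show "(\<lambda>z. f (sh j z)) \<in> borel_measurable \<mu>"
      using measurable_compose[OF _ assms, of "shift_map ^^ j" \<mu>] by (simp add: shift_map_funpow)
  qed simp
  also have "\<dots> = (\<integral>z. f z \<partial>\<mu>)" using Suc by (simp add: distr_shift_map)
  finally show ?case .
qed simp

text \<open>Such a function is locally constant, so all preimages are open in \<open>X\<close>,
  whatever the codomain.\<close>

lemma prefix_function_measurable:
  assumes "\<And>z z'. z \<in> X \<Longrightarrow> z' \<in> X \<Longrightarrow> fac z' 0 n = fac z 0 n \<Longrightarrow> f z' = f z"
  shows "f \<in> measurable \<mu> (count_space UNIV)"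
proof (rule measurableI)
  fix A
  show "f -` A \<inter> space \<mu> \<in> sets \<mu>"
    unfolding sets_eq
  proof (rule open_in_word_borel)
    fix z assume "z \<in> f -` A \<inter> space \<mu>"
    then show "\<exists>n. \<forall>z'\<in>X. fac z' 0 n = fac z 0 n \<longrightarrow> z' \<in> f -` A \<inter> space \<mu>"
    proof (intro exI[of _ n] ballI impI)
      fix z' assume "z' \<in> X" "fac z' 0 n = fac z 0 n"
      then show "z' \<in> f -` A \<inter> space \<mu>" using assms[of z z'] \<open>z \<in> _\<close> by auto
    qed
  qed simp
qed simp

lemma prefix_function_borel:
  assumes "\<And>z z'. z \<in> X \<Longrightarrow> z' \<in> X \<Longrightarrow> fac z' 0 n = fac z 0 n \<Longrightarrow> f z' = f z"
  shows "f \<in> borel_measurable \<mu>"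
proof -
  have "f \<in> measurable \<mu> (count_space UNIV)"
    by (rule prefix_function_measurable) (rule assms)
  then show ?thesis using measurable_compose[of f \<mu> "count_space UNIV" "\<lambda>x. x" borel] by simp
qed

end

section \<open>Uniform frequencies\<close>

definition avg :: "((nat \<Rightarrow> 'a) \<Rightarrow> real) \<Rightarrow> nat \<Rightarrow> (nat \<Rightarrow> 'a) \<Rightarrow> real" where
  "avg s n z = (\<Sum>j<n. s (sh j z)) / real n"

definition dispersion :: "((nat \<Rightarrow> 'a) \<Rightarrow> real) \<Rightarrow> nat \<Rightarrow> nat \<Rightarrow> (nat \<Rightarrow> 'a) \<Rightarrow> real" where
  "dispersion s n N z = (\<Sum>j<N. (avg s n (sh j z) - avg s N z)\<^sup>2) / real N"

lemma dispersion_nonneg: "0 \<le> dispersion s n N z"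
  by (simp add: dispersion_def sum_nonneg)

text \<open>The instance in mind is the indicator \<open>occ u\<close> of a factor; the bounds 0 and
  1 fix the constants in the estimates below.\<close>

locale local_function =
  fixes s :: "(nat \<Rightarrow> 'a) \<Rightarrow> real" and m :: nat
  assumes bounds: "\<And>z. 0 \<le> s z" "\<And>z. s z \<le> 1"
    and local: "\<And>z z'. fac z' 0 m = fac z 0 m \<Longrightarrow> s z' = s z"
begin

lemma avg_bounds: "0 \<le> avg s n z" "avg s n z \<le> 1"
proof -
  show "0 \<le> avg s n z" by (simp add: avg_def sum_nonneg bounds)
  have "(\<Sum>j<n. s (sh j z)) \<le> (\<Sum>j<n. 1)" by (intro sum_mono bounds)
  then show "avg s n z \<le> 1" by (cases "n = 0") (auto simp: avg_def divide_le_eq)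
qed

lemma avg_local:
  assumes "fac z' 0 (n + m) = fac z 0 (n + m)" shows "avg s n z' = avg s n z"
proof -
  have "s (sh j z') = s (sh j z)" if "j < n" for j
    using fac_eq_mono[OF assms, of j m] that by (intro local) simp
  then show ?thesis by (simp add: avg_def)
qed

lemma dispersion_local:
  assumes "fac z' 0 (N + n + m) = fac z 0 (N + n + m)"
  shows "dispersion s n N z' = dispersion s n N z"
proof -
  have "avg s n (sh j z') = avg s n (sh j z)" if "j < N" for j
    using fac_eq_mono[OF assms, of j "n + m"] that by (intro avg_local) simp
  moreover have "avg s N z' = avg s N z"
    using fac_eq_mono[OF assms, of 0 "N + m"] by (intro avg_local) simp
  ultimately show ?thesis by (simp add: dispersion_def)
qed

text \<open>Each single shift exchanges one summand, and all summands lie between 0 and 1.\<close>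

lemma sum_shift_diff: "\<bar>(\<Sum>j<N. s (sh (j + i) z)) - (\<Sum>j<N. s (sh j z))\<bar> \<le> real i"
proof (induction i)
  case (Suc i)
  have "(\<Sum>j<N. s (sh (j + Suc i) z)) + s (sh i z) = (\<Sum>j<Suc N. s (sh (j + i) z))"
    by (subst sum.lessThan_Suc_shift) (simp add: algebra_simps)
  also have "\<dots> = (\<Sum>j<N. s (sh (j + i) z)) + s (sh (N + i) z)" by simp
  finally have "\<bar>(\<Sum>j<N. s (sh (j + Suc i) z)) - (\<Sum>j<N. s (sh (j + i) z))\<bar> \<le> 1"
    using bounds[of "sh i z"] bounds[of "sh (N + i) z"] by linarith
  with Suc show ?case by linarith
qed simp

text \<open>Exchanging the sums turns the left sum into the mean, over \<open>i < n\<close>, of the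
  plain sums shifted by \<open>i\<close>; each of these is off by at most \<open>i\<close>.\<close>

lemma sum_avg_diff:
  assumes "0 < n"
  shows "\<bar>(\<Sum>j<N. avg s n (sh j z)) - (\<Sum>j<N. s (sh j z))\<bar> \<le> real n"
proof -
  have "(\<Sum>j<N. avg s n (sh j z)) = (\<Sum>i<n. \<Sum>j<N. s (sh (j + i) z)) / real n"
    unfolding avg_def sum_divide_distrib[symmetric]
    by (subst sum.swap) (simp add: ac_simps)
  then have "(\<Sum>j<N. avg s n (sh j z)) - (\<Sum>j<N. s (sh j z))
      = (\<Sum>i<n. (\<Sum>j<N. s (sh (j + i) z)) - (\<Sum>j<N. s (sh j z))) / real n"
    using assms by (simp add: sum_subtractf field_simps)
  also have "\<bar>\<dots>\<bar> \<le> (\<Sum>i<n. real n) / real n"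
    unfolding abs_divide abs_of_nat
  proof (rule divide_right_mono)
    have "\<bar>\<Sum>i<n. (\<Sum>j<N. s (sh (j + i) z)) - (\<Sum>j<N. s (sh j z))\<bar>
        \<le> (\<Sum>i<n. \<bar>(\<Sum>j<N. s (sh (j + i) z)) - (\<Sum>j<N. s (sh j z))\<bar>)"
      by (rule sum_abs)
    also have "\<dots> \<le> (\<Sum>i<n. real n)"
      by (intro sum_mono order.trans[OF sum_shift_diff]) auto
    finally show "\<bar>\<Sum>i<n. (\<Sum>j<N. s (sh (j + i) z)) - (\<Sum>j<N. s (sh j z))\<bar> \<le> (\<Sum>i<n. real n)" .
  qed simp_all
  finally show ?thesis using assms by simp
qed

lemma avg_lipschitz: "\<bar>avg s N (sh i z) - avg s N z\<bar> \<le> real i / real N"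
proof -
  have "avg s N (sh i z) - avg s N z = ((\<Sum>j<N. s (sh (j + i) z)) - (\<Sum>j<N. s (sh j z))) / real N"
    by (simp add: avg_def diff_divide_distrib add.assoc)
  then show ?thesis using sum_shift_diff[where i=i and N=N and z=z] by (simp add: divide_right_mono)
qed

text \<open>If the short averages had mean exactly \<open>avg s N z\<close>, this would be the
  identity of variance and mean square minus squared mean. The mean is off by at most
  \<open>n / N\<close>, and it enters with factor 2.\<close>

lemma dispersion_le:
  assumes "0 < n" "0 < N"
  shows "dispersion s n N z \<le> (\<Sum>j<N. (avg s n (sh j z))\<^sup>2) / real N - (avg s N z)\<^sup>2 + 2 * real n / real N"
proof -
  let ?a = "\<lambda>j. avg s n (sh j z)" and ?b = "avg s N z"
  have "dispersion s n N z = (\<Sum>j<N. (?a j)\<^sup>2 - 2 * ?b * ?a j + ?b\<^sup>2) / real N"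
    unfolding dispersion_def by (simp add: power2_diff algebra_simps)
  also have "\<dots> = (\<Sum>j<N. (?a j)\<^sup>2) / real N - 2 * ?b * ((\<Sum>j<N. ?a j) / real N) + ?b\<^sup>2"
    using assms by (simp add: sum.distrib sum_subtractf sum_distrib_left[symmetric] field_simps)
  finally have eq: "dispersion s n N z = \<dots>" .
  have "(\<Sum>j<N. ?a j) \<ge> real N * ?b - real n"
    using sum_avg_diff[OF assms(1), where N=N and z=z] assms unfolding avg_def[of s N] by simp
  then have "(\<Sum>j<N. ?a j) / real N \<ge> (real N * ?b - real n) / real N"
    by (rule divide_right_mono) simp
  then have "(\<Sum>j<N. ?a j) / real N \<ge> ?b - real n / real N"
    using assms by (simp add: diff_divide_distrib)
  then have "?b * ((\<Sum>j<N. ?a j) / real N) \<ge> ?b * (?b - real n / real N)"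
    using avg_bounds by (intro mult_left_mono)
  moreover have "?b * (real n / real N) \<le> 1 * (real n / real N)"
    using avg_bounds by (intro mult_right_mono) auto
  ultimately have "?b\<^sup>2 - real n / real N \<le> ?b * ((\<Sum>j<N. ?a j) / real N)"
    unfolding right_diff_distrib power2_eq_square by linarith
  moreover have "2 * ?b * ((\<Sum>j<N. ?a j) / real N) = 2 * (?b * ((\<Sum>j<N. ?a j) / real N))"
    "2 * real n / real N = 2 * (real n / real N)" by simp_all
  ultimately show ?thesis unfolding eq by linarith
qed

end

locale local_function_measure = local_function s m + shift_measure X \<mu>
  for s :: "(nat \<Rightarrow> 'a) \<Rightarrow> real" and m and X :: "(nat \<Rightarrow> 'a) set" and \<mu>
begin

lemma avg_measurable [measurable]: "avg s n \<in> borel_measurable \<mu>"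
  by (rule prefix_function_borel[of "n + m"]) (rule avg_local)

lemma dispersion_measurable [measurable]: "dispersion s n N \<in> borel_measurable \<mu>"
  by (rule prefix_function_borel[of "N + n + m"]) (rule dispersion_local)

lemma avg_shift_measurable [measurable]: "(\<lambda>z. avg s n (sh j z)) \<in> borel_measurable \<mu>"
proof (rule prefix_function_borel[of "j + (n + m)"])
  fix z z' :: "nat \<Rightarrow> 'a" assume "fac z' 0 (j + (n + m)) = fac z 0 (j + (n + m))"
  from fac_eq_mono[OF this, of j "n + m"]
  show "avg s n (sh j z') = avg s n (sh j z)" by (intro avg_local) simp
qed

lemma integrable_avg_square: "integrable \<mu> (\<lambda>z. (avg s n (sh j z))\<^sup>2)"
  by (rule integrable_const_bound[of _ 1]) (auto simp: avg_bounds power_le_one)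

lemma integral_dispersion_le:
  assumes "0 < n" "0 < N"
  shows "(\<integral>z. dispersion s n N z \<partial>\<mu>)
    \<le> (\<integral>z. (avg s n z)\<^sup>2 \<partial>\<mu>) - (\<integral>z. (avg s N z)\<^sup>2 \<partial>\<mu>) + 2 * real n / real N"
proof -
  have int: "integrable \<mu> (\<lambda>z. (avg s n z)\<^sup>2)" for n using integrable_avg_square[of n 0] by simp
  let ?f = "\<lambda>z. (\<Sum>j<N. (avg s n (sh j z))\<^sup>2) / real N - (avg s N z)\<^sup>2 + 2 * real n / real N"
  have intf: "integrable \<mu> ?f"
    by (intro Bochner_Integration.integrable_add Bochner_Integration.integrable_diff
        integrable_divide Bochner_Integration.integrable_sum integrable_avg_square int) auto
  have "(\<integral>z. dispersion s n N z \<partial>\<mu>) \<le> (\<integral>z. ?f z \<partial>\<mu>)"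
    by (rule integral_mono_AE') (use intf dispersion_le[OF assms] order.trans[OF dispersion_nonneg dispersion_le[OF assms]] in auto)
  also have "\<dots> = (\<Sum>j<N. \<integral>z. (avg s n (sh j z))\<^sup>2 \<partial>\<mu>) / real N - (\<integral>z. (avg s N z)\<^sup>2 \<partial>\<mu>)
      + 2 * real n / real N"
    using prob_space by (simp add: integrable_avg_square int Bochner_Integration.integral_sum)
  also have "(\<Sum>j<N. \<integral>z. (avg s n (sh j z))\<^sup>2 \<partial>\<mu>) / real N = (\<integral>z. (avg s n z)\<^sup>2 \<partial>\<mu>)"
    using integral_shift[of "\<lambda>z. (avg s n z)\<^sup>2"] assms by simp
  finally show ?thesis .
qed

text \<open>Take \<open>n\<close> with \<open>V n\<close> within \<open>\<eta> / 2\<close> of the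
  infimum of \<open>V\<close>. Then \<open>V n - V N\<close> is below \<open>\<eta> / 2\<close> for
  every positive \<open>N\<close>, and the boundary term \<open>2 * n / N\<close> is small for large
  \<open>N\<close>.\<close>

lemma integral_dispersion_small:
  assumes "0 < \<eta>"
  obtains n N0 where "0 < n" "\<And>N. N0 \<le> N \<Longrightarrow> (\<integral>z. dispersion s n N z \<partial>\<mu>) \<le> \<eta>"
proof -
  define V where "V = (\<lambda>n. \<integral>z. (avg s n z)\<^sup>2 \<partial>\<mu>)"
  have V0: "0 \<le> V n" for n by (simp add: V_def)
  have bdd: "bdd_below (V ` {0<..})" using V0 by (auto intro: bdd_belowI[of _ 0])
  have "Inf (V ` {0<..}) < Inf (V ` {0<..}) + \<eta> / 2" using assms by simp
  from cInf_lessD[OF _ this] obtain v where "v \<in> V ` {0<..}" "v < Inf (V ` {0<..}) + \<eta> / 2"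
    by (auto simp: greaterThan_def)
  then obtain n where n: "0 < n" "V n < Inf (V ` {0<..}) + \<eta> / 2" by auto
  obtain N0 :: nat where N0: "4 * real n / \<eta> < real N0" using reals_Archimedean2 by blast
  show thesis
  proof (rule that[OF n(1)])
    fix N assume "N0 \<le> N"
    then have N: "4 * real n / \<eta> < real N" using N0 by simp
    moreover have "0 \<le> 4 * real n / \<eta>" using assms by simp
    ultimately have N': "0 < N" by linarith
    have "2 * real n / real N \<le> \<eta> / 2" using N N' assms by (simp add: field_simps)
    moreover have "Inf (V ` {0<..}) \<le> V N" using N' by (intro cInf_lower bdd) auto
    ultimately show "(\<integral>z. dispersion s n N z \<partial>\<mu>) \<le> \<eta>"
      using integral_dispersion_le[OF n(1) N'] n(2) unfolding V_def by linarith
  qed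
qed

end

text \<open>The bound on the sum leaves, in every block of \<open>\<rho>\<close> consecutive times,
  one with \<open>D t \<le> \<kappa>\<^sup>2\<close>. The windows of such times in neighbouring
  blocks share at least half their length. On the overlap both values of \<open>f\<close> are close
  to \<open>\<alpha>\<close> in quadratic mean, hence close to each other. There are at most
  \<open>(T + 1) / \<rho>\<close> full blocks.\<close>

lemma chain_bound:
  fixes f D \<alpha> :: "nat \<Rightarrow> real"
  assumes D: "\<And>t. D t = (\<Sum>j<N. (\<alpha> (t + j) - f t)\<^sup>2) / real N"
    and lip: "\<And>t i. \<bar>f (t + i) - f t\<bar> \<le> real i / real N"
    and \<rho>: "0 < \<rho>" "4 * \<rho> \<le> N" and \<kappa>: "0 \<le> \<kappa>"
    and sum: "(\<Sum>t\<le>T. D t) \<le> \<kappa>\<^sup>2 * real \<rho>"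
  shows "f T - f 0 \<le> 3 * real \<rho> / real N + 3 * \<kappa> * (real (T + 1) / real \<rho>)"
proof -
  have N: "0 < N" using \<rho> by simp
  have D0: "0 \<le> D t" for t by (simp add: D sum_nonneg)
  have close: "\<bar>f t - f t'\<bar> \<le> 3 * \<kappa>"
    if "D t \<le> \<kappa>\<^sup>2" "D t' \<le> \<kappa>\<^sup>2" "t \<le> t'" "t' \<le> t + 2 * \<rho>" for t t'
  proof -
    \<comment> \<open>The overlap of the two windows. It has at least \<open>N / 2\<close> positions
      because \<open>t' - t \<le> 2 * \<rho> \<le> N / 2\<close>; this yields a squared difference
      of at most \<open>8 * \<kappa>\<^sup>2\<close>, rounded up to
      \<open>(3 * \<kappa>)\<^sup>2\<close>.\<close>
    let ?I = "{t'..<t + N}"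
    have part: "(\<Sum>p\<in>?I. (\<alpha> p - f r)\<^sup>2) \<le> real N * D r" if r: "r \<le> t'" "t + N \<le> r + N" for r
    proof -
      have "(\<Sum>p\<in>?I. (\<alpha> p - f r)\<^sup>2) \<le> (\<Sum>p\<in>{r..<r + N}. (\<alpha> p - f r)\<^sup>2)"
        using r by (intro sum_mono2) auto
      also have "\<dots> = (\<Sum>j<N. (\<alpha> (r + j) - f r)\<^sup>2)"
        using sum.shift_bounds_nat_ivl[of "\<lambda>p. (\<alpha> p - f r)\<^sup>2" 0 r N]
        by (simp add: atLeast0LessThan add.commute)
      finally show ?thesis using N by (simp add: D)
    qed
    have "real N / 2 \<le> real (card ?I)" using that \<rho> by simp
    then have "real N / 2 * (f t - f t')\<^sup>2 \<le> real (card ?I) * (f t - f t')\<^sup>2"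
      by (rule mult_right_mono) simp
    also have "\<dots> = (\<Sum>p\<in>?I. (f t - f t')\<^sup>2)" by simp
    finally have "real N / 2 * (f t - f t')\<^sup>2 \<le> \<dots>" .
    also have "(\<Sum>p\<in>?I. (f t - f t')\<^sup>2) \<le> (\<Sum>p\<in>?I. 2 * (\<alpha> p - f t)\<^sup>2 + 2 * (\<alpha> p - f t')\<^sup>2)"
    proof (rule sum_mono)
      fix p
      have "0 \<le> ((\<alpha> p - f t) + (\<alpha> p - f t'))\<^sup>2" by simp
      then show "(f t - f t')\<^sup>2 \<le> 2 * (\<alpha> p - f t)\<^sup>2 + 2 * (\<alpha> p - f t')\<^sup>2"
        by (simp add: power2_eq_square algebra_simps)
    qed
    also have "\<dots> \<le> 2 * (real N * D t) + 2 * (real N * D t')"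
      using part[of t] part[of t'] that by (simp add: sum.distrib sum_distrib_left[symmetric])
    also have "\<dots> \<le> 2 * (real N * \<kappa>\<^sup>2) + 2 * (real N * \<kappa>\<^sup>2)"
      using that by (intro add_mono mult_left_mono) auto
    finally have "(f t - f t')\<^sup>2 \<le> 8 * \<kappa>\<^sup>2" using N by (simp add: field_simps)
    also have "\<dots> \<le> (3 * \<kappa>)\<^sup>2" by (simp add: power_mult_distrib)
    finally show ?thesis using \<kappa> by (metis abs_le_square_iff abs_of_nonneg mult_nonneg_nonneg zero_le_numeral)
  qed
  have block: "\<exists>t. i * \<rho> \<le> t \<and> t < (i + 1) * \<rho> \<and> D t \<le> \<kappa>\<^sup>2" if i: "(i + 1) * \<rho> \<le> T + 1" for i
  proof (rule ccontr)
    assume "\<not> ?thesis"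
    then have "\<And>t. t \<in> {i * \<rho>..<(i + 1) * \<rho>} \<Longrightarrow> \<kappa>\<^sup>2 < D t" by (auto simp: not_le)
    then have "(\<Sum>t\<in>{i * \<rho>..<(i + 1) * \<rho>}. \<kappa>\<^sup>2) < (\<Sum>t\<in>{i * \<rho>..<(i + 1) * \<rho>}. D t)"
      using \<rho> by (intro sum_strict_mono) auto
    also have "\<dots> \<le> (\<Sum>t\<le>T. D t)"
      using i D0 by (intro sum_mono2) auto
    finally show False using sum by (simp add: mult.commute)
  qed
  have main: "\<exists>t. i * \<rho> \<le> t \<and> t < (i + 1) * \<rho> \<and> D t \<le> \<kappa>\<^sup>2 \<and> f t \<le> f 0 + real \<rho> / real N + 3 * \<kappa> * real i"
    if "(i + 1) * \<rho> \<le> T + 1" for i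
    using that
  proof (induction i)
    case 0
    then obtain t where t: "t < \<rho>" "D t \<le> \<kappa>\<^sup>2" using block[of 0] by auto
    have "f t - f 0 \<le> real t / real N" using lip[of 0 t] by auto
    also have "\<dots> \<le> real \<rho> / real N" using t by (simp add: divide_right_mono)
    finally show ?case using t by (intro exI[of _ t]) auto
  next
    case (Suc i)
    then obtain t where t: "i * \<rho> \<le> t" "t < (i + 1) * \<rho>" "D t \<le> \<kappa>\<^sup>2"
      "f t \<le> f 0 + real \<rho> / real N + 3 * \<kappa> * real i" by auto
    obtain t' where t': "Suc i * \<rho> \<le> t'" "t' < (Suc i + 1) * \<rho>" "D t' \<le> \<kappa>\<^sup>2"
      using block[OF Suc.prems] by blast
    have "\<bar>f t - f t'\<bar> \<le> 3 * \<kappa>" using t t' by (intro close) (auto simp: algebra_simps)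
    then have "f t' \<le> f 0 + real \<rho> / real N + 3 * \<kappa> * real (Suc i)"
      using t(4) by (simp add: algebra_simps)
    then show ?case using t' by blast
  qed
  show ?thesis
  \<comment> \<open>A path shorter than one block is settled by the Lipschitz bound. Otherwise that
    bound costs \<open>\<rho> / N\<close> before the first good time and
    \<open>2 * \<rho> / N\<close> after the last one.\<close>
  proof (cases "T + 1 < \<rho>")
    case True
    have "f T - f 0 \<le> real T / real N" using lip[of 0 T] by auto
    also have "\<dots> \<le> 3 * real \<rho> / real N" using True by (intro divide_right_mono) auto
    also have "\<dots> \<le> 3 * real \<rho> / real N + 3 * \<kappa> * (real (T + 1) / real \<rho>)" using \<kappa> by simp
    finally show ?thesis .
  next
    case False
    define q where "q = (T + 1) div \<rho>"
    have q: "q * \<rho> \<le> T + 1" "T + 1 < (q + 1) * \<rho>" "0 < q"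
      using \<rho> False by (auto simp: q_def div_greater_zero_iff dividend_less_div_times)
    have "(q - 1 + 1) * \<rho> \<le> T + 1" using q by simp
    from main[OF this] obtain t where t: "(q - 1) * \<rho> \<le> t" "t < q * \<rho>"
      "f t \<le> f 0 + real \<rho> / real N + 3 * \<kappa> * real (q - 1)"
      using q by auto
    have tT: "t \<le> T" "T - t \<le> 2 * \<rho>" using q t by (auto simp: algebra_simps diff_mult_distrib)
    have "f T - f t \<le> real (T - t) / real N" using lip[of t "T - t"] tT by auto
    also have "\<dots> \<le> 2 * real \<rho> / real N" using tT by (intro divide_right_mono) auto
    finally have 1: "f T - f t \<le> 2 * real \<rho> / real N" .
    have "real q \<le> real (T + 1) / real \<rho>"
      using q(1) \<rho> by (simp add: le_divide_eq flip: of_nat_mult)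
    then have "3 * \<kappa> * real (q - 1) \<le> 3 * \<kappa> * (real (T + 1) / real \<rho>)"
      using \<kappa> q by (intro mult_left_mono) auto
    then show ?thesis using 1 t(3) by (simp add: add_divide_distrib)
  qed
qed

text \<open>Lets functions of infinite words be evaluated on a finite word. Letters beyond its end
  are arbitrary, but a function that depends only on a prefix does not see them.\<close>

definition word_of :: "'a list \<Rightarrow> nat \<Rightarrow> 'a" where
  "word_of w i = w ! i"

lemma fac_word_of: "length w = n \<Longrightarrow> fac (word_of w) 0 n = w"
  by (simp add: list_eq_iff_nth_eq word_of_def)

text \<open>In a shortest path of the Rauzy graph all vertices are distinct.\<close>

lemma exists_path:
  fixes y :: "nat \<Rightarrow> 'a"
  assumes g: "\<And>z z'. fac z' 0 n = fac z 0 n \<Longrightarrow> g z' = g z"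
    and rec: "\<And>i. infinite {k. fac y k n = fac y i n}"
    and P: "P (g (sh i y)) (g (sh i' y))"
  obtains c T where "inj_on (\<lambda>t. fac c t n) {..T}" "\<And>t. t \<le> T \<Longrightarrow> fac c t n \<in> range (\<lambda>i. fac y i n)"
    "P (g c) (g (sh T c))"
proof -
  define path where "path = (\<lambda>c T. (\<forall>t\<le>T. fac c t n \<in> range (\<lambda>i. fac y i n)) \<and> P (g c) (g (sh T c)))"
  \<comment> \<open>Recurrence moves the target window behind the source, so that a stretch of
    \<open>y\<close> itself is a path.\<close>
  obtain k where k: "i < k" "fac y k n = fac y i' n"
    using rec[of i'] unfolding infinite_nat_iff_unbounded by auto
  have "g (sh k y) = g (sh i' y)" using k by (intro g) simp
  then have "path (sh i y) (k - i)"
    using P k by (auto simp: path_def)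
  then have ex: "\<exists>T. \<exists>c. path c T" by blast
  define T where "T = (LEAST T. \<exists>c. path c T)"
  obtain c where c: "path c T" using LeastI_ex[OF ex] unfolding T_def by blast
  have min: "\<not> path c' T'" if "T' < T" for c' T'
    using that not_less_Least unfolding T_def by blast
  have "fac c p n \<noteq> fac c p' n" if pp: "p < p'" "p' \<le> T" for p p'
  proof
    assume eq: "fac c p n = fac c p' n"
    define d where "d = p' - p"
    \<comment> \<open>Cuts the loop from \<open>p\<close> to \<open>p'\<close> out of the path.
      Windows of \<open>c'\<close> that start at or after \<open>p\<close> are windows of
      \<open>c\<close> moved by \<open>d\<close>, even where they straddle the cut, because the
      windows of \<open>c\<close> at \<open>p\<close> and \<open>p'\<close> agree.\<close>
    define c' where "c' = (\<lambda>k. if k < p + n then c k else c (k + d))"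
    have 1: "fac c' t n = fac c t n" if "t \<le> p" for t
      using that by (auto simp: fac_eq_iff c'_def)
    have 2: "fac c' t n = fac c (t + d) n" if "p \<le> t" for t
      unfolding fac_eq_iff
    proof (intro allI impI)
      fix a assume "a < n"
      show "c' (t + a) = c (t + d + a)"
      proof (cases "t + a < p + n")
        case True
        define e where "e = t + a - p"
        have e: "t + a = p + e" using that by (simp add: e_def)
        then have "c (p + e) = c (p' + e)" using eq True unfolding fac_eq_iff by auto
        moreover have "p' + e = t + d + a" using e pp by (simp add: d_def)
        ultimately have "c (t + a) = c (t + d + a)" using e by metis
        then show ?thesis using True by (simp add: c'_def)
      next
        case False
        then show ?thesis by (simp add: c'_def algebra_simps)
      qed
    qed
    have d: "0 < d" "d \<le> T" "p \<le> T - d" using pp by (auto simp: d_def)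
    have "g c' = g c" using 1[of 0] by (intro g) simp
    moreover have "g (sh (T - d) c') = g (sh T c)" using 2[OF d(3)] d
      by (intro g) (simp only: fac_sh add_0_left le_add_diff_inverse2)
    moreover have "fac c' t n \<in> range (\<lambda>i. fac y i n)" if "t \<le> T - d" for t
      using 1[of t] 2[of t] c that d unfolding path_def by (cases "t \<le> p") auto
    ultimately have "path c' (T - d)" using c by (auto simp: path_def)
    then show False using min[of "T - d" c'] d by simp
  qed
  then have "inj_on (\<lambda>t. fac c t n) {..T}"
    unfolding inj_on_def by (metis atMost_iff linorder_neqE_nat)
  then show thesis using that c unfolding path_def by blast
qed

context local_function_measure
begin

text \<open>Cylinders of distinct words of one length are disjoint, so a sum over words, each
  carrying measure at least \<open>c\<close>, is bounded by an integral.\<close>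

lemma sum_over_words_le:
  assumes L: "finite L" "\<And>w. w \<in> L \<Longrightarrow> length w = n"
    and h: "\<And>w. 0 \<le> h w" "integrable \<mu> (\<lambda>z. h (fac z 0 n))"
    and c: "0 \<le> c" "\<And>w. w \<in> L \<Longrightarrow> c \<le> prob (cylinder X w)"
  shows "c * (\<Sum>w\<in>L. h w) \<le> (\<integral>z. h (fac z 0 n) \<partial>\<mu>)"
proof -
  have cyl: "cylinder X w \<in> events" for w
    using cylinder_in_word_borel sets_eq by blast
  have int: "integrable \<mu> (indicat_real (cylinder X w))" for w
    using cyl by (simp add: less_top[symmetric])
  have "c * (\<Sum>w\<in>L. h w) = (\<Sum>w\<in>L. c * h w)" by (rule sum_distrib_left)
  also have "\<dots> \<le> (\<Sum>w\<in>L. prob (cylinder X w) * h w)"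
    by (intro sum_mono mult_right_mono c h)
  also have "\<dots> = (\<Sum>w\<in>L. \<integral>z. indicator (cylinder X w) z * h w \<partial>\<mu>)"
    using int by (intro sum.cong) (auto simp: Int_absorb2 cylinder_eq)
  also have "\<dots> = (\<integral>z. (\<Sum>w\<in>L. indicator (cylinder X w) z * h w) \<partial>\<mu>)"
    using int by (intro Bochner_Integration.integral_sum[symmetric]) simp
  also have "\<dots> \<le> (\<integral>z. h (fac z 0 n) \<partial>\<mu>)"
  proof (rule integral_mono_AE')
    show "AE z in \<mu>. (\<Sum>w\<in>L. indicator (cylinder X w) z * h w) \<le> h (fac z 0 n)"
    proof (rule AE_I2)
      fix z assume "z \<in> space \<mu>"
      have "(\<Sum>w\<in>L. indicator (cylinder X w) z * h w) = (\<Sum>w\<in>L. if w = fac z 0 n then h w else 0)"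
        using L \<open>z \<in> space \<mu>\<close> by (intro sum.cong) (auto simp: cylinder_eq indicator_def)
      then show "(\<Sum>w\<in>L. indicator (cylinder X w) z * h w) \<le> h (fac z 0 n)"
        using L h by (simp add: sum.delta)
    qed
  qed (use h in \<open>auto intro!: sum_nonneg\<close>)
  finally show ?thesis .
qed

end

lemma oscillation_small:
  fixes y :: "nat \<Rightarrow> 'a::finite"
  assumes s: "local_function s m"
    and y: "bounded_gaps y"
    and \<mu>: "invariant_measure (generated_shift y) \<mu>"
    and \<epsilon>: "0 < \<epsilon>"
    and inf: "infinite {n. \<forall>w\<in>language (generated_shift y) n. \<epsilon> \<le> real n * measure \<mu> (cylinder (generated_shift y) w)}"
    and \<delta>: "0 < \<delta>"
  obtains N where "0 < N" "\<And>i i'. avg s N (sh i' y) - avg s N (sh i y) < \<delta>"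
proof -
  let ?X = "generated_shift y"
  interpret local_function_measure s m ?X \<mu>
    by (intro local_function_measure.intro shift_measure.intro s \<mu> is_shift_generated_shift)
  have main: "\<exists>N>0. \<forall>i i'. avg s N (sh i' y) - avg s N (sh i y) < \<delta>" if \<delta>: "0 < \<delta>" "\<delta> \<le> 1" for \<delta>
  proof -
    \<comment> \<open>With \<open>T + 1 \<le> 2 * N / \<epsilon>\<close> and
      \<open>\<rho> \<ge> \<delta> * N / 24\<close>, the second term of \<open>chain_bound\<close>
      is at most \<open>144 * \<kappa> / (\<epsilon> * \<delta>)\<close>, which this choice makes
      \<open>\<delta> / 4\<close>. The choice of \<open>\<eta>\<close> makes the total dispersion
      along the path, at most \<open>2 * \<eta> * N / \<epsilon>\<close>, no larger than
      \<open>\<kappa>\<^sup>2 * \<rho>\<close>.\<close>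
    define \<kappa> where "\<kappa> = \<epsilon> * \<delta>\<^sup>2 / 576"
    define \<eta> where "\<eta> = \<kappa>\<^sup>2 * \<epsilon> * \<delta> / 48"
    have \<kappa>: "0 < \<kappa>" using \<epsilon> \<delta> by (simp add: \<kappa>_def)
    have \<eta>: "0 < \<eta>" using \<epsilon> \<delta> \<kappa> by (simp add: \<eta>_def)
    obtain n N0 where n: "0 < n" and N0: "\<And>N. N0 \<le> N \<Longrightarrow> (\<integral>z. dispersion s n N z \<partial>\<mu>) \<le> \<eta>"
      using integral_dispersion_small[OF \<eta>] by blast
    obtain K :: nat where K: "24 / \<delta> < real K" using reals_Archimedean2 by blast
    obtain N' where N': "N0 + 2 * (n + m) + K < N'"
      and good: "\<And>w. w \<in> language ?X N' \<Longrightarrow> \<epsilon> \<le> real N' * prob (cylinder ?X w)"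
      using inf unfolding infinite_nat_iff_unbounded by blast
    \<comment> \<open>The dispersion over a window of length \<open>N\<close> reads
      \<open>N + n + m\<close> letters, so this total is made the good length. The margins in the
      choice of \<open>N'\<close> give \<open>N' \<le> 2 * N\<close> and, through \<open>K\<close>,
      \<open>\<delta> * N \<ge> 24\<close>, so that the floor in \<open>\<rho>\<close> loses at most
      a factor 2.\<close>
    define N where "N = N' - (n + m)"
    have N: "N' = N + n + m" "N0 \<le> N" "real N' \<le> 2 * real N" "0 < N" "K \<le> N" "0 < N'"
      using N' n by (auto simp: N_def)
    have \<delta>N: "24 \<le> \<delta> * real N"
    proof -
      have "24 \<le> \<delta> * real K" using K \<delta> by (simp add: field_simps)
      also have "\<dots> \<le> \<delta> * real N" using N \<delta> by (intro mult_left_mono) auto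
      finally show ?thesis .
    qed
    have "avg s N (sh i' y) - avg s N (sh i y) < \<delta>" for i i'
    proof (rule ccontr)
      assume contra: "\<not> ?thesis"
      let ?L = "range (\<lambda>i. fac y i N')"
      obtain c T where inj: "inj_on (\<lambda>t. fac c t N') {..T}"
        and path: "\<And>t. t \<le> T \<Longrightarrow> fac c t N' \<in> ?L"
        and low: "\<delta> \<le> avg s N (sh T c) - avg s N c"
      proof (rule exists_path[where g = "avg s N" and n = N' and P = "\<lambda>a b. \<delta> \<le> b - a" and y = y])
        show "avg s N z' = avg s N z" if "fac z' 0 N' = fac z 0 N'" for z z'
          using fac_eq_mono[OF that, of 0 "N + m"] N by (intro avg_local) simp
        show "\<delta> \<le> avg s N (sh i' y) - avg s N (sh i y)" using contra by simp
      qed (use bounded_gaps_infinite[OF y] in auto)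
      define f where "f = (\<lambda>t. avg s N (sh t c))"
      define D where "D = (\<lambda>t. dispersion s n N (sh t c))"
      have fin: "finite ?L" by (rule finite_range_fac)
      have lower: "\<epsilon> / real N' \<le> prob (cylinder ?X w)" if "w \<in> ?L" for w
        using good[of w] that N(6) by (simp add: language_generated_shift divide_le_eq mult.commute)
      \<comment> \<open>Used twice: with the constant 1 it bounds the length of the path, with the
        dispersion it bounds the sum of the dispersions along it.\<close>
      have weight: "\<epsilon> / real N' * (\<Sum>t\<le>T. h (fac c t N')) \<le> (\<integral>z. h (fac z 0 N') \<partial>\<mu>)"
        if h: "\<And>w. 0 \<le> h w" "integrable \<mu> (\<lambda>z. h (fac z 0 N'))" for h
      proof -
        have "(\<Sum>t\<le>T. h (fac c t N')) = (\<Sum>w\<in>(\<lambda>t. fac c t N') ` {..T}. h w)"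
          by (simp add: sum.reindex[OF inj])
        also have "\<epsilon> / real N' * \<dots> \<le> (\<integral>z. h (fac z 0 N') \<partial>\<mu>)"
          by (rule sum_over_words_le) (use h \<epsilon> lower path in auto)
        finally show ?thesis .
      qed
      have T: "real (T + 1) \<le> 2 * real N / \<epsilon>"
      proof -
        have "\<epsilon> / real N' * real (T + 1) \<le> 1"
          using weight[of "\<lambda>_. 1"] prob_space by simp
        then have "real (T + 1) \<le> real N' / \<epsilon>" using N \<epsilon> by (simp add: field_simps)
        also have "\<dots> \<le> 2 * real N / \<epsilon>" using N \<epsilon> by (intro divide_right_mono) auto
        finally show ?thesis .
      qed
      have disp: "dispersion s n N (word_of (fac z t N')) = dispersion s n N (sh t z)" for z t
        using fac_word_of[of "fac z t N'" N'] N by (intro dispersion_local) simp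
      have "integrable \<mu> (\<lambda>z. dispersion s n N z)"
      proof (rule integrable_const_bound[of _ "1 + 2 * real n / real N"])
        show "AE z in \<mu>. norm (dispersion s n N z) \<le> 1 + 2 * real n / real N"
        proof (rule AE_I2)
          fix z
          have "(\<Sum>j<N. (avg s n (sh j z))\<^sup>2) \<le> (\<Sum>j<N. 1)"
            by (intro sum_mono power_le_one avg_bounds)
          then have "(\<Sum>j<N. (avg s n (sh j z))\<^sup>2) / real N \<le> 1" using N by (simp add: divide_le_eq)
          then show "norm (dispersion s n N z) \<le> 1 + 2 * real n / real N"
            using dispersion_le[OF n N(4), of z] zero_le_power2[of "avg s N z"]
            unfolding real_norm_def abs_of_nonneg[OF dispersion_nonneg] by linarith
        qed
      qed simp
      then have "\<epsilon> / real N' * (\<Sum>t\<le>T. D t) \<le> (\<integral>z. dispersion s n N z \<partial>\<mu>)"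
        using weight[of "\<lambda>w. dispersion s n N (word_of w)"] dispersion_nonneg[of s n N]
        by (simp add: disp D_def)
      also have "\<dots> \<le> \<eta>" using N0 N by blast
      finally have "(\<Sum>t\<le>T. D t) \<le> \<eta> * real N' / \<epsilon>" using N \<epsilon> by (simp add: field_simps)
      also have "\<dots> \<le> \<eta> * (2 * real N) / \<epsilon>"
        using N \<epsilon> \<eta> by (intro divide_right_mono mult_left_mono) auto
      also have "\<dots> = \<kappa>\<^sup>2 * (\<delta> * real N / 24)" using \<epsilon> by (simp add: \<eta>_def)
      finally have sumD: "(\<Sum>t\<le>T. D t) \<le> \<kappa>\<^sup>2 * (\<delta> * real N / 24)" .
      define \<rho> where "\<rho> = nat \<lfloor>\<delta> * real N / 12\<rfloor>"
      have \<rho>: "\<delta> * real N / 24 \<le> real \<rho>" "real \<rho> \<le> \<delta> * real N / 12"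
        using \<delta>N unfolding \<rho>_def by linarith+
      have \<rho>0: "0 < real \<rho>" using \<rho> \<delta>N by linarith
      have \<rho>N: "4 * \<rho> \<le> N"
      proof -
        have "\<delta> * real N \<le> 1 * real N" using \<delta> by (intro mult_right_mono) auto
        then have "real (4 * \<rho>) \<le> real N" using \<rho> by simp
        then show ?thesis by linarith
      qed
      have "(\<Sum>t\<le>T. D t) \<le> \<kappa>\<^sup>2 * real \<rho>"
        using sumD \<rho>(1) by (meson mult_left_mono order_trans zero_le_power2)
      then have "f T - f 0 \<le> 3 * real \<rho> / real N + 3 * \<kappa> * (real (T + 1) / real \<rho>)"
      proof (intro chain_bound[where \<alpha> = "\<lambda>p. avg s n (sh p c)" and D = D])
        show "D t = (\<Sum>j<N. (avg s n (sh (t + j) c) - f t)\<^sup>2) / real N" for t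
          by (simp add: D_def f_def dispersion_def ac_simps)
        show "\<bar>f (t + i) - f t\<bar> \<le> real i / real N" for t i
          using avg_lipschitz[where N = N and i = i and z = "sh t c"] by (simp add: f_def ac_simps)
      qed (use \<rho>0 \<rho>N \<kappa> in auto)
      also have "3 * real \<rho> / real N \<le> \<delta> / 4" using \<rho>(2) N(4) by (simp add: divide_le_eq)
      also have "3 * \<kappa> * (real (T + 1) / real \<rho>) \<le> \<delta> / 4"
      proof -
        have "real (T + 1) / real \<rho> \<le> (2 * real N / \<epsilon>) / (\<delta> * real N / 24)"
          using T \<rho> \<delta>N by (intro frac_le) auto
        also have "\<dots> = 48 / (\<epsilon> * \<delta>)" using N(4) by simp
        finally have "3 * \<kappa> * (real (T + 1) / real \<rho>) \<le> 3 * \<kappa> * (48 / (\<epsilon> * \<delta>))"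
          using \<kappa> by (intro mult_left_mono) auto
        also have "\<dots> = \<delta> / 4" using \<epsilon> \<delta> by (simp add: \<kappa>_def power2_eq_square field_simps)
        finally show ?thesis .
      qed
      finally show False using low \<delta> by (simp add: f_def)
    qed
    then show ?thesis using N by blast
  qed
  obtain N where "N > 0" "\<forall>i i'. avg s N (sh i' y) - avg s N (sh i y) < min \<delta> 1"
    using main[of "min \<delta> 1"] \<delta> by auto
  then show thesis by (intro that[of N]) auto
qed

definition uniform_averages :: "((nat \<Rightarrow> 'a) \<Rightarrow> real) \<Rightarrow> (nat \<Rightarrow> 'a) \<Rightarrow> bool" where
  "uniform_averages s y \<longleftrightarrow>
     (\<forall>\<delta>>0. \<exists>N>0. \<forall>i i'. avg s N (sh i' y) - avg s N (sh i y) < \<delta>)"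

text \<open>Up to \<open>N / M\<close>, the average over \<open>M\<close> letters is the mean of the
  averages over the \<open>N\<close>-windows starting at its positions, and each of these is within
  \<open>\<delta>\<close> of the first.\<close>

lemma (in local_function) avg_approx:
  assumes osc: "\<And>i i'. avg s N (sh i' y) - avg s N (sh i y) < \<delta>" and N: "0 < N" "0 < M"
  shows "\<bar>avg s M y - avg s N y\<bar> \<le> \<delta> + real N / real M"
proof -
  have "\<bar>(\<Sum>j<M. avg s N (sh j y)) - (\<Sum>j<M. avg s N y)\<bar> \<le> (\<Sum>j<M. \<delta>)"
    unfolding sum_subtractf[symmetric]
  proof (rule order.trans[OF sum_abs sum_mono])
    fix j
    have "avg s N (sh j y) - avg s N y < \<delta>" "avg s N y - avg s N (sh j y) < \<delta>"
      using osc[of j 0] osc[of 0 j] by simp_all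
    then show "\<bar>avg s N (sh j y) - avg s N y\<bar> \<le> \<delta>" by linarith
  qed
  moreover have "\<bar>(\<Sum>j<M. avg s N (sh j y)) - (\<Sum>j<M. s (sh j y))\<bar> \<le> real N"
    by (rule sum_avg_diff[OF N(1)])
  ultimately have "\<bar>(\<Sum>j<M. s (sh j y)) - real M * avg s N y\<bar> \<le> real M * \<delta> + real N"
    unfolding sum_constant card_lessThan by linarith
  then have "\<bar>(\<Sum>j<M. s (sh j y)) - real M * avg s N y\<bar> / real M \<le> (real M * \<delta> + real N) / real M"
    by (rule divide_right_mono) simp
  moreover have "avg s M y - avg s N y = ((\<Sum>j<M. s (sh j y)) - real M * avg s N y) / real M"
    using N by (simp add: avg_def diff_divide_distrib)
  ultimately show ?thesis using N by (simp add: add_divide_distrib)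
qed

lemma (in local_function) uniform_averages_convergent:
  assumes "uniform_averages s y"
  shows "convergent (\<lambda>N. avg s N y)"
proof -
  have "Cauchy (\<lambda>N. avg s N y)"
  proof (rule metric_CauchyI)
    fix e :: real assume e: "0 < e"
    then obtain N where N: "0 < N" "\<And>i i'. avg s N (sh i' y) - avg s N (sh i y) < e / 6"
      using assms unfolding uniform_averages_def by (metis divide_pos_pos zero_less_numeral)
    obtain M0 :: nat where M0: "6 * real N / e < real M0" using reals_Archimedean2 by blast
    have close: "\<bar>avg s M y - avg s N y\<bar> < e / 2" if "M0 \<le> M" for M
    proof -
      have M: "6 * real N / e < real M" using M0 that by simp
      moreover have "0 \<le> 6 * real N / e" using e by simp
      ultimately have "0 < M" by linarith
      have "real N / real M < e / 6" using M e \<open>0 < M\<close> by (simp add: field_simps)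
      then show ?thesis using avg_approx[OF N(2,1) \<open>0 < M\<close>] e by linarith
    qed
    show "\<exists>M. \<forall>m\<ge>M. \<forall>n\<ge>M. dist (avg s m y) (avg s n y) < e"
    proof (intro exI allI impI)
      fix m n assume "M0 \<le> m" "M0 \<le> n"
      then show "dist (avg s m y) (avg s n y) < e"
        using close[of m] close[of n] unfolding dist_real_def by linarith
    qed
  qed
  then show ?thesis by (simp add: Cauchy_convergent)
qed

lemma (in local_function) uniform_averages_limit:
  assumes "uniform_averages s y" and N: "0 < N" "\<And>i i'. avg s N (sh i' y) - avg s N (sh i y) < \<delta>"
  shows "\<bar>lim (\<lambda>N. avg s N y) - avg s N y\<bar> \<le> \<delta>"
proof -
  have "(\<lambda>M. avg s M y) \<longlonglongrightarrow> lim (\<lambda>N. avg s N y)"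
    using uniform_averages_convergent[OF assms(1)] by (simp add: convergent_LIMSEQ_iff)
  then have 1: "(\<lambda>M. \<bar>avg s M y - avg s N y\<bar>) \<longlonglongrightarrow> \<bar>lim (\<lambda>N. avg s N y) - avg s N y\<bar>"
    by (intro tendsto_intros)
  have 2: "(\<lambda>M. \<delta> + real N / real M) \<longlonglongrightarrow> \<delta> + 0"
    by (intro tendsto_add tendsto_const lim_const_over_n)
  have "\<forall>\<^sub>F M in sequentially. \<bar>avg s M y - avg s N y\<bar> \<le> \<delta> + real N / real M"
    using avg_approx[OF N(2,1)] by (auto simp: eventually_sequentially intro!: exI[of _ 1])
  from tendsto_le[OF sequentially_bot 2 1 this] show ?thesis by simp
qed

section \<open>Factor frequencies and Boshernitzan's condition at infinitely many lengths\<close>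

definition occ :: "'a list \<Rightarrow> (nat \<Rightarrow> 'a) \<Rightarrow> real" where
  "occ u z = of_bool (fac z 0 (length u) = u)"

lemma local_function_occ: "local_function (occ u) (length u)"
  by unfold_locales (auto simp: occ_def)

lemma occurrence_rate_eq_avg: "occurrence_rate x u N = avg (occ u) N x"
proof -
  have "(\<Sum>j<N. occ u (sh j x)) = real (card ({..<N} \<inter> {i. occurs_at x u i}))"
    by (simp add: occ_def occurs_at_fac)
  then show ?thesis by (simp add: occurrence_rate_def avg_def Int_def)
qed

lemma boshernitzan_good_lengths:
  fixes x :: "nat \<Rightarrow> 'a::finite"
  assumes "boshernitzan x"
  obtains \<mu> \<epsilon> where "invariant_measure (generated_shift x) \<mu>" "0 < \<epsilon>"
    "infinite {n. \<forall>w\<in>language (generated_shift x) n. \<epsilon> \<le> real n * measure \<mu> (cylinder (generated_shift x) w)}"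
proof -
  let ?X = "generated_shift x"
  obtain \<mu> where \<mu>: "invariant_measure ?X \<mu>" "0 < limsup (\<lambda>n. ereal (kappa ?X \<mu> n))"
    using assms by (auto simp: boshernitzan_def boshernitzan_shift_def)
  \<comment> \<open>The limes superior may be infinite, so a real number strictly below it is
    chosen.\<close>
  obtain \<epsilon> where \<epsilon>: "0 < ereal \<epsilon>" "ereal \<epsilon> < limsup (\<lambda>n. ereal (kappa ?X \<mu> n))"
    using ereal_dense2[OF \<mu>(2)] by blast
  have "infinite {n. \<epsilon> < kappa ?X \<mu> n}"
  proof
    assume "finite {n. \<epsilon> < kappa ?X \<mu> n}"
    then obtain n0 where "\<And>n. \<epsilon> < kappa ?X \<mu> n \<Longrightarrow> n < n0"
      by (metis (mono_tags, lifting) finite_nat_set_iff_bounded mem_Collect_eq)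
    then have "\<forall>n\<ge>n0. ereal (kappa ?X \<mu> n) \<le> ereal \<epsilon>" by (metis ereal_less_eq(3) not_le)
    then have "limsup (\<lambda>n. ereal (kappa ?X \<mu> n)) \<le> ereal \<epsilon>"
      by (intro Limsup_bounded) (auto simp: eventually_sequentially)
    then show False using \<epsilon>(2) by simp
  qed
  moreover have "{n. \<epsilon> < kappa ?X \<mu> n} \<subseteq> {n. \<forall>w\<in>language ?X n. \<epsilon> \<le> real n * measure \<mu> (cylinder ?X w)}"
  proof clarify
    fix n w assume "\<epsilon> < kappa ?X \<mu> n" "w \<in> language ?X n"
    moreover have "kappa ?X \<mu> n \<le> real n * measure \<mu> (cylinder ?X w)"
      unfolding kappa_def using \<open>w \<in> _\<close> finite_range_fac[of x n]
      by (intro Min_le) (auto simp: language_generated_shift)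
    ultimately show "\<epsilon> \<le> real n * measure \<mu> (cylinder ?X w)" by simp
  qed
  ultimately have "infinite {n. \<forall>w\<in>language ?X n. \<epsilon> \<le> real n * measure \<mu> (cylinder ?X w)}"
    using infinite_super by blast
  then show thesis using that[OF \<mu>(1)] \<epsilon>(1) by simp
qed

lemma boshernitzanI:
  fixes x :: "nat \<Rightarrow> 'a::finite"
  assumes "bounded_gaps x" "invariant_measure (generated_shift x) \<mu>" "0 < \<epsilon>"
    "infinite {n. \<forall>w\<in>language (generated_shift x) n. \<epsilon> \<le> real n * measure \<mu> (cylinder (generated_shift x) w)}"
  shows "boshernitzan x"
proof -
  let ?X = "generated_shift x"
  have "0 < limsup (\<lambda>n. ereal (kappa ?X \<mu> n))"
  proof (rule ccontr)
    assume "\<not> ?thesis"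
    then have "limsup (\<lambda>n. ereal (kappa ?X \<mu> n)) < ereal \<epsilon>"
      using assms(3) by (meson ereal_less(2) le_less_trans not_le)
    from Limsup_lessD[OF this] obtain n0 where n0: "\<And>n. n0 \<le> n \<Longrightarrow> kappa ?X \<mu> n < \<epsilon>"
      by (auto simp: eventually_sequentially)
    obtain n where n: "n0 < n" "\<And>w. w \<in> language ?X n \<Longrightarrow> \<epsilon> \<le> real n * measure \<mu> (cylinder ?X w)"
      using assms(4) unfolding infinite_nat_iff_unbounded by blast
    have "\<epsilon> \<le> kappa ?X \<mu> n"
      unfolding kappa_def using n(2) finite_range_fac[of x n]
      by (intro Min.boundedI) (auto simp: language_generated_shift)
    then show False using n0[of n] n(1) by simp
  qed
  then show ?thesis
    using assms minimal_generated_shift by (auto simp: boshernitzan_def boshernitzan_shift_def)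
qed

theorem boshernitzan_uniform_averages:
  fixes y :: "nat \<Rightarrow> 'a::finite"
  assumes "local_function s m" "bounded_gaps y" "boshernitzan y"
  shows "uniform_averages s y"
proof -
  obtain \<mu> \<epsilon> where \<mu>: "invariant_measure (generated_shift y) \<mu>" "0 < \<epsilon>"
    "infinite {n. \<forall>w\<in>language (generated_shift y) n. \<epsilon> \<le> real n * measure \<mu> (cylinder (generated_shift y) w)}"
    using boshernitzan_good_lengths[OF assms(3)] .
  show ?thesis
    unfolding uniform_averages_def using oscillation_small[OF assms(1,2) \<mu>] by metis
qed

lemma boshernitzan_admits_factor_frequencies:
  fixes y :: "nat \<Rightarrow> 'a::finite"
  assumes "bounded_gaps y" "boshernitzan y"
  shows "admits_factor_frequencies y"
proof -
  have "convergent (occurrence_rate y u)" for u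
    using local_function.uniform_averages_convergent[OF local_function_occ
        boshernitzan_uniform_averages[OF local_function_occ assms]]
    by (simp add: occurrence_rate_eq_avg[abs_def])
  then show ?thesis by (simp add: admits_factor_frequencies_def)
qed

section \<open>Transducers on uniformly recurrent words\<close>

definition restart :: "('q, 'a, 'b) transducer \<Rightarrow> 'q \<Rightarrow> ('q, 'a, 'b) transducer" where
  "restart A q = A\<lparr>init_state := q\<rparr>"

lemma restart_simps [simp]:
  "init_state (restart A q) = q" "next_state (restart A q) = next_state A"
  "out_word (restart A q) = out_word A"
  by (simp_all add: restart_def)

abbreviation steps :: "('q, 'a, 'b) transducer \<Rightarrow> 'q \<Rightarrow> 'a list \<Rightarrow> 'q" where
  "steps A \<equiv> foldl (next_state A)"

fun outs :: "('q, 'a, 'b) transducer \<Rightarrow> 'q \<Rightarrow> 'a list \<Rightarrow> 'b list" where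
  "outs A q [] = []"
| "outs A q (a # w) = out_word A q a @ outs A (next_state A q a) w"

lemma outs_append: "outs A q (v @ w) = outs A q v @ outs A (steps A q v) w"
  by (induction v arbitrary: q) auto

lemma outs_restart [simp]: "outs (restart A p) q w = outs A q w"
  by (induction w arbitrary: q) auto

lemma run_state_add: "run_state A x (i + n) = steps A (run_state A x i) (fac x i n)"
  by (induction n) (auto simp: fac_Suc)

lemma output_prefix_add:
  "output_prefix A x (i + n) = output_prefix A x i @ outs A (run_state A x i) (fac x i n)"
proof (induction n)
  case (Suc n)
  have "output_prefix A x (i + Suc n)
      = output_prefix A x (i + n) @ out_word A (run_state A x (i + n)) (x (i + n))"
    by (simp add: output_prefix_def)
  then show ?case by (simp add: Suc.IH fac_Suc outs_append run_state_add)
qed simp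

lemma output_prefix_eq: "output_prefix A x n = outs A (init_state A) (fac x 0 n)"
  using output_prefix_add[of A x 0 n] by (simp add: output_prefix_def)

text \<open>Output prefixes extend each other, so every sufficiently long one shows the same letter
  as the shortest.\<close>

lemma transducer_output_nth:
  assumes "p < length (output_prefix A x N)"
  shows "transducer_output A x p = output_prefix A x N ! p"
proof -
  define N' where "N' = (LEAST N. p < length (output_prefix A x N))"
  have "p < length (output_prefix A x N')" "N' \<le> N"
    using assms unfolding N'_def by (auto intro: LeastI Least_le)
  then obtain k where "N = N' + k" by (auto simp: le_iff_add)
  then show ?thesis
    using \<open>p < length (output_prefix A x N')\<close>
    by (simp add: transducer_output_def N'_def[symmetric] output_prefix_add nth_append)
qed

abbreviation pos :: "('q, 'a, 'b) transducer \<Rightarrow> (nat \<Rightarrow> 'a) \<Rightarrow> nat \<Rightarrow> nat" where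
  "pos A x i \<equiv> length (output_prefix A x i)"

lemma fac_transducer_output:
  "fac (transducer_output A x) (pos A x i) (length (outs A (run_state A x i) (fac x i n)))
    = outs A (run_state A x i) (fac x i n)"
proof (rule nth_equalityI)
  fix a assume "a < length (fac (transducer_output A x) (pos A x i) (length (outs A (run_state A x i) (fac x i n))))"
  then have "a < length (outs A (run_state A x i) (fac x i n))" by simp
  then show "fac (transducer_output A x) (pos A x i) (length (outs A (run_state A x i) (fac x i n))) ! a
      = outs A (run_state A x i) (fac x i n) ! a"
    using transducer_output_nth[of "pos A x i + a" A x "i + n"] by (simp add: output_prefix_add)
qed simp

lemma fac_transducer_output_0:
  "fac (transducer_output (restart A q) z) 0 (length (outs A q (fac z 0 n))) = outs A q (fac z 0 n)"
  using fac_transducer_output[of "restart A q" z 0 n] by (simp add: output_prefix_def)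

lemma pos_mono: "i \<le> j \<Longrightarrow> pos A x i \<le> pos A x j"
  by (auto simp: le_iff_add output_prefix_add)

lemma transducer_output_shift:
  assumes "infinite_output A x"
  shows "sh (pos A x i) (transducer_output A x) = transducer_output (restart A (run_state A x i)) (sh i x)"
proof
  fix p
  obtain N where N: "pos A x i + p < pos A x N"
    using assms unfolding infinite_output_def by blast
  have "i \<le> N"
  proof (rule ccontr)
    assume "\<not> i \<le> N"
    then have "pos A x N \<le> pos A x i" by (intro pos_mono) simp
    then show False using N by simp
  qed
  then obtain n where n: "N = i + n" by (auto simp: le_iff_add)
  then have p: "p < length (outs A (run_state A x i) (fac x i n))"
    using N by (simp add: output_prefix_add)
  have "transducer_output A x (pos A x i + p) = outs A (run_state A x i) (fac x i n) ! p"
    using transducer_output_nth[OF N] n by (simp add: output_prefix_add)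
  moreover have "transducer_output (restart A (run_state A x i)) (sh i x) p = outs A (run_state A x i) (fac x i n) ! p"
    using transducer_output_nth[of p "restart A (run_state A x i)" "sh i x" n] p
    by (simp add: output_prefix_eq)
  ultimately show "transducer_output A x (p + pos A x i) = transducer_output (restart A (run_state A x i)) (sh i x) p"
    by (simp add: add.commute)
qed

definition has_factor :: "'a list \<Rightarrow> 'a list \<Rightarrow> bool" where
  "has_factor u v \<longleftrightarrow> (\<exists>a b. v = a @ u @ b)"

lemma has_factor_append: "has_factor u v \<Longrightarrow> has_factor u (a @ v @ b)"
  unfolding has_factor_def by (metis append.assoc)

lemma has_factor_appendI: "has_factor u v \<Longrightarrow> has_factor u (v @ b)" "has_factor u v \<Longrightarrow> has_factor u (b @ v)"
  using has_factor_append[of u v "[]" b] has_factor_append[of u v b "[]"] by simp_all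

lemma has_factor_fac:
  assumes "has_factor u (fac z i n)"
  obtains k where "i \<le> k" "k + length u \<le> i + n" "fac z k (length u) = u"
proof -
  obtain a b where ab: "fac z i n = a @ u @ b" using assms by (auto simp: has_factor_def)
  have n: "n = length a + (length u + length b)" using arg_cong[OF ab, of length] by simp
  have "fac z (i + length a) (length u) = u"
    using ab unfolding n fac_add by simp
  then show thesis using that[of "i + length a"] n by simp
qed

lemma fac_has_factor:
  assumes "i \<le> k" "k + m \<le> i + n" shows "has_factor (fac z k m) (fac z i n)"
proof -
  define a b where "a = k - i" and "b = i + n - (k + m)"
  then have "k = i + a" "n = a + (m + b)" using assms by auto
  then have "fac z i n = fac z i a @ fac z k m @ fac z (k + m) b"
    by (simp add: fac_add)
  then show ?thesis by (auto simp: has_factor_def)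
qed

section \<open>States compatible with a factor\<close>

lemma infinite_fibre:
  fixes g :: "nat \<Rightarrow> 'q::finite"
  assumes "infinite {i. P i}" shows "\<exists>q. infinite {i. P i \<and> g i = q}"
proof (rule ccontr)
  assume "\<nexists>q. infinite {i. P i \<and> g i = q}"
  then have "finite (\<Union>q. {i. P i \<and> g i = q})" by auto
  moreover have "(\<Union>q. {i. P i \<and> g i = q}) = {i. P i}" by auto
  ultimately show False using assms by simp
qed

text \<open>Requiring infinitely many positions discards transient states, which occur only because
  the run starts in one particular state.\<close>

definition states_after :: "('q, 'a, 'b) transducer \<Rightarrow> (nat \<Rightarrow> 'a) \<Rightarrow> 'a list \<Rightarrow> 'q set" where
  "states_after A x v = {q. infinite {i. fac x i (length v) = v \<and> run_state A x (i + length v) = q}}"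

locale transducer_run =
  fixes A :: "('q::finite, 'a::finite, 'b::finite) transducer" and x :: "nat \<Rightarrow> 'a"
  assumes gaps: "bounded_gaps x" and infinite_out: "infinite_output A x"
begin

abbreviation "E \<equiv> states_after A x"
abbreviation "st \<equiv> run_state A x"
abbreviation "\<delta> \<equiv> steps A"

lemma E_nonempty:
  assumes "is_factor v x" shows "E v \<noteq> {}"
proof -
  have "infinite {i. fac x i (length v) = v}"
    using bounded_gaps_infinite[OF gaps] assms by (metis is_factorE)
  then show ?thesis
    using infinite_fibre[of "\<lambda>i. fac x i (length v) = v" "\<lambda>i. st (i + length v)"]
    by (auto simp: states_after_def)
qed

lemma E_append_left: "E (u @ v) \<subseteq> E v"
proof
  fix q assume "q \<in> E (u @ v)"
  then have inf: "infinite {i. fac x i (length (u @ v)) = u @ v \<and> st (i + length (u @ v)) = q}" (is "infinite ?I")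
    by (simp add: states_after_def)
  have "(\<lambda>i. i + length u) ` ?I \<subseteq> {i. fac x i (length v) = v \<and> st (i + length v) = q}"
    by (auto simp: fac_add add.assoc)
  moreover have "infinite ((\<lambda>i. i + length u) ` ?I)"
    using inf by (simp add: finite_image_iff)
  ultimately show "q \<in> E v"
    unfolding states_after_def using infinite_super by blast
qed

text \<open>Pigeonhole on the state between \<open>v\<close> and \<open>w\<close>. The infinite set
  is recorded because it concerns all of \<open>v @ w\<close>, which says more than
  \<open>p \<in> E v\<close>.\<close>

lemma E_append_right:
  assumes "q \<in> E (v @ w)"
  obtains p where "p \<in> E v" "infinite {i. fac x i (length (v @ w)) = v @ w \<and> st (i + length v) = p}"
    "q = \<delta> p w"
proof -
  have "infinite {i. fac x i (length (v @ w)) = v @ w \<and> st (i + length (v @ w)) = q}"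
    using assms by (simp add: states_after_def)
  then obtain p where p: "infinite {i. (fac x i (length (v @ w)) = v @ w \<and> st (i + length (v @ w)) = q) \<and> st (i + length v) = p}"
    using infinite_fibre[of "\<lambda>i. fac x i (length (v @ w)) = v @ w \<and> st (i + length (v @ w)) = q" "\<lambda>i. st (i + length v)"]
    by blast
  show thesis
  proof (rule that[of p])
    show "p \<in> E v"
      unfolding states_after_def mem_Collect_eq
      by (rule infinite_super[OF _ p]) (auto simp: fac_add)
    show "infinite {i. fac x i (length (v @ w)) = v @ w \<and> st (i + length v) = p}"
      by (rule infinite_super[OF _ p]) auto
    obtain i where i: "fac x i (length (v @ w)) = v @ w" "st (i + length (v @ w)) = q" "st (i + length v) = p"
      using not_finite_existsD[OF p] by blast
    then have "fac x (i + length v) (length w) = w" by (simp add: fac_add)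
    then show "q = \<delta> p w"
      using i run_state_add[of A x "i + length v" "length w"] by (simp add: add.assoc)
  qed
qed

definition rank :: nat where
  "rank = (LEAST d. \<exists>v. is_factor v x \<and> card (E v) = d)"

definition minimal :: "'a list \<Rightarrow> bool" where
  "minimal v \<longleftrightarrow> is_factor v x \<and> card (E v) = rank"

lemma rank_le: "is_factor v x \<Longrightarrow> rank \<le> card (E v)"
  unfolding rank_def by (rule Least_le) blast

lemma minimal_exists: "\<exists>v. minimal v"
  unfolding minimal_def rank_def by (rule LeastI_ex) (use is_factor_fac in blast)

lemma minimal_append_left:
  assumes "minimal v" "is_factor (u @ v) x"
  shows "minimal (u @ v)" "E (u @ v) = E v"
proof -
  have "card (E (u @ v)) \<le> card (E v)" by (intro card_mono E_append_left) simp
  then have card: "card (E (u @ v)) = rank" "card (E v) = rank"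
    using rank_le[OF assms(2)] assms(1) by (auto simp: minimal_def)
  then show "minimal (u @ v)" using assms(2) by (simp add: minimal_def)
  show "E (u @ v) = E v" using card by (intro card_subset_eq E_append_left) auto
qed

text \<open>Let \<open>J\<close> be the states in \<open>E v\<close> that recur with the
  continuation \<open>w\<close>. The chain from \<open>rank\<close> through the cardinalities of
  \<open>E (v @ w)\<close>, the image of \<open>J\<close>, \<open>J\<close> and \<open>E v\<close>
  ends at \<open>rank\<close> again, so all are equal: every state recurs with \<open>w\<close>, and
  reading \<open>w\<close> is injective.\<close>

lemma minimal_append_right:
  assumes "minimal v" "is_factor (v @ w) x"
  shows "minimal (v @ w)" "E (v @ w) = (\<lambda>q. \<delta> q w) ` E v" "inj_on (\<lambda>q. \<delta> q w) (E v)"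
    "q \<in> E v \<Longrightarrow> infinite {i. fac x i (length (v @ w)) = v @ w \<and> st (i + length v) = q}"
proof -
  define J where "J = {p \<in> E v. infinite {i. fac x i (length (v @ w)) = v @ w \<and> st (i + length v) = p}}"
  have sub: "E (v @ w) \<subseteq> (\<lambda>q. \<delta> q w) ` J"
    unfolding J_def by (auto elim!: E_append_right)
  have J: "J \<subseteq> E v" by (auto simp: J_def)
  have "rank \<le> card (E (v @ w))" by (rule rank_le[OF assms(2)])
  also have "\<dots> \<le> card ((\<lambda>q. \<delta> q w) ` J)" by (rule card_mono[OF _ sub]) simp
  also have "\<dots> \<le> card J" by (rule card_image_le) simp
  also have "\<dots> \<le> card (E v)" by (rule card_mono[OF _ J]) simp
  finally have "rank \<le> card (E v)" .
  have v: "card (E v) = rank" using assms by (simp add: minimal_def)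
  have cJ: "card J = card (E v)" and cE: "card (E (v @ w)) = rank" and
    cI: "card ((\<lambda>q. \<delta> q w) ` J) = card J"
    using \<open>rank \<le> card (E (v @ w))\<close> \<open>card (E (v @ w)) \<le> card ((\<lambda>q. \<delta> q w) ` J)\<close>
      \<open>card ((\<lambda>q. \<delta> q w) ` J) \<le> card J\<close> \<open>card J \<le> card (E v)\<close> v by linarith+
  have JE: "J = E v" using cJ J by (intro card_subset_eq) auto
  show "minimal (v @ w)" using cE assms by (simp add: minimal_def)
  show "E (v @ w) = (\<lambda>q. \<delta> q w) ` E v"
    using sub cE cI cJ v by (intro card_subset_eq) (auto simp: JE)
  show "inj_on (\<lambda>q. \<delta> q w) (E v)" using cI by (intro eq_card_imp_inj_on) (auto simp: JE)
  show "infinite {i. fac x i (length (v @ w)) = v @ w \<and> st (i + length v) = q}" if "q \<in> E v"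
    using that JE by (auto simp: J_def)
qed

text \<open>By bounded gaps, every sufficiently long factor contains a fixed minimal one, and
  minimality survives extension on both sides.\<close>

lemma long_factors_minimal: "\<exists>R. \<forall>i. minimal (fac x i R)"
proof -
  obtain l where l: "minimal l" using minimal_exists by blast
  then obtain i0 where i0: "l = fac x i0 (length l)" by (auto simp: minimal_def elim: is_factorE)
  obtain M where M: "\<And>j. \<exists>k. j \<le> k \<and> k < j + M \<and> fac x k (length l) = l"
    using gaps i0 unfolding bounded_gaps_def by metis
  have "minimal (fac x i (M + length l))" for i
  proof -
    obtain k where k: "k < M" "fac x (i + k) (length l) = l"
      using M[of i] by (auto simp: le_iff_add)
    define b where "b = M - k"
    have "M + length l = k + (length l + b)" using k by (simp add: b_def)
    then have eq: "fac x i (M + length l) = fac x i k @ (l @ fac x (i + k + length l) b)"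
      using k by (simp only: fac_add)
    have fac: "is_factor (fac x i k @ (l @ fac x (i + k + length l) b)) x"
      unfolding eq[symmetric] by simp
    have "minimal (l @ fac x (i + k + length l) b)"
      using minimal_append_right(1)[OF l is_factor_append(2)[OF fac]] .
    then show ?thesis unfolding eq using minimal_append_left(1) fac by blast
  qed
  then show ?thesis by blast
qed

text \<open>There are only finitely many pairs of a factor of length \<open>R\<close> and a state
  outside its set, and each occurs at finitely many positions.\<close>

lemma eventually_in_E: "\<exists>s0. \<forall>i\<ge>s0. st (i + R) \<in> E (fac x i R)"
proof -
  let ?B = "\<Union>v\<in>range (\<lambda>i. fac x i R). \<Union>q\<in>- E v. {i. fac x i R = v \<and> st (i + R) = q}"
  have "finite ?B"
    by (intro finite_UN_I finite_range_fac) (auto simp: states_after_def)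
  then obtain s0 where "\<And>i. i \<in> ?B \<Longrightarrow> i < s0" by (auto simp: finite_nat_set_iff_bounded)
  then have "st (i + R) \<in> E (fac x i R)" if "s0 \<le> i" for i
    using that by fastforce
  then show ?thesis by blast
qed

end

section \<open>The tail of the run and the recurrent suffix of the output\<close>

locale transducer_tail = transducer_run A x
  for A :: "('q::finite, 'a::finite, 'b::finite) transducer" and x :: "nat \<Rightarrow> 'a" +
  fixes R s0 :: nat
  assumes minimal: "\<And>i. minimal (fac x i R)"
    and tail: "\<And>i. s0 \<le> i \<Longrightarrow> st (i + R) \<in> E (fac x i R)"
begin

text \<open>The factor of length \<open>R + n\<close> is read in two ways. As a right extension of
  its first \<open>R\<close> letters it has the image as its set of states; as a left extension of
  its last \<open>R\<close> letters it has the same set as these.\<close>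

lemma E_add:
  shows E_add_image: "E (fac x (i + n) R) = (\<lambda>q. \<delta> q (fac x (i + R) n)) ` E (fac x i R)"
    and E_add_inj: "inj_on (\<lambda>q. \<delta> q (fac x (i + R) n)) (E (fac x i R))"
    and recurs: "q \<in> E (fac x i R) \<Longrightarrow> infinite {j. fac x j (R + n) = fac x i (R + n) \<and> st (j + R) = q}"
proof -
  have eq: "fac x i (R + n) = fac x i R @ fac x (i + R) n" by (simp add: fac_add)
  have eq2: "fac x i (R + n) = fac x i n @ fac x (i + n) R" by (subst add.commute) (simp add: fac_add)
  have "is_factor (fac x i R @ fac x (i + R) n) x" unfolding eq[symmetric] by simp
  note r = minimal_append_right[OF minimal this]
  have "E (fac x i (R + n)) = E (fac x (i + n) R)"
    unfolding eq2 by (rule minimal_append_left(2)[OF minimal]) (simp flip: eq2)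
  then show "E (fac x (i + n) R) = (\<lambda>q. \<delta> q (fac x (i + R) n)) ` E (fac x i R)"
    using r(2) by (simp add: eq)
  show "inj_on (\<lambda>q. \<delta> q (fac x (i + R) n)) (E (fac x i R))" by (rule r(3))
  show "infinite {j. fac x j (R + n) = fac x i (R + n) \<and> st (j + R) = q}" if "q \<in> E (fac x i R)"
    using r(4)[OF that] by (simp add: eq)
qed

text \<open>From position \<open>s0\<close> on, the state after \<open>R\<close> more letters is
  admissible, so the suffix begins with the output of letter \<open>s0 + R\<close>.\<close>

definition start :: nat where "start = pos A x (s0 + R)"

definition y :: "nat \<Rightarrow> 'b" where "y = sh start (transducer_output A x)"

lemma is_suffix_y: "is_suffix y (transducer_output A x)"
  by (auto simp: is_suffix_def y_def shift_map_funpow)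

definition maxout :: nat where
  "maxout = Max (range (\<lambda>(q, a). length (out_word A q a)))"

lemma length_out_word_le: "length (out_word A q a) \<le> maxout"
  unfolding maxout_def by (rule Max_ge) (auto intro: rev_image_eqI[of "(q, a)"])

lemma length_outs_le: "length (outs A q w) \<le> maxout * length w"
proof (induction w arbitrary: q)
  case (Cons a w)
  show ?case using Cons[of "next_state A q a"] length_out_word_le[of q a] by simp
qed simp

lemma pos_add: "pos A x (i + n) = pos A x i + length (outs A (st i) (fac x i n))"
  by (simp add: output_prefix_add)

lemma pos_add_le: "pos A x (i + n) \<le> pos A x i + maxout * n"
  using length_outs_le[of "st i" "fac x i n"] by (simp add: pos_add)

lemma fac_y:
  assumes "s0 + R \<le> i"
  shows "fac y (pos A x i - start) (length (outs A (st i) (fac x i n))) = outs A (st i) (fac x i n)"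
proof -
  have "start \<le> pos A x i" unfolding start_def using assms by (rule pos_mono)
  then show ?thesis unfolding y_def using fac_transducer_output[of A x i n] by simp
qed

text \<open>Finds the letter that emits position \<open>p\<close>; the strict inequality skips
  letters with empty output.\<close>

lemma y_position:
  obtains i where "s0 + R \<le> i" "pos A x i \<le> start + p" "start + p < pos A x (Suc i)"
proof -
  obtain N where N: "start + p < pos A x N"
    using infinite_out unfolding infinite_output_def by blast
  define N' where "N' = (LEAST N. start + p < pos A x N)"
  have N': "start + p < pos A x N'" using N unfolding N'_def by (rule LeastI)
  have "\<not> N' \<le> s0 + R" using pos_mono[of N' "s0 + R" A x] N' by (auto simp: start_def)
  then obtain i where i: "N' = Suc i" "s0 + R \<le> i" by (cases N') auto
  moreover have "pos A x i \<le> start + p"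
    using not_less_Least[of i "\<lambda>N. start + p < pos A x N"] i unfolding N'_def by auto
  ultimately show thesis using that N' by blast
qed

lemma y_factor_covered:
  obtains i m where "s0 + R \<le> i" "has_factor (fac y p n) (outs A (st i) (fac x i m))"
proof -
  obtain i where i: "s0 + R \<le> i" "pos A x i \<le> start + p" using y_position by metis
  obtain N where N: "start + p + n < pos A x N"
    using infinite_out unfolding infinite_output_def by blast
  have "i \<le> N"
  proof (rule ccontr)
    assume "\<not> i \<le> N"
    then have "pos A x N \<le> pos A x i" by (intro pos_mono) simp
    then show False using N i by simp
  qed
  then obtain m where m: "N = i + m" by (auto simp: le_iff_add)
  have st: "start \<le> pos A x i" unfolding start_def using i by (intro pos_mono)
  have "has_factor (fac y p n) (fac y (pos A x i - start) (length (outs A (st i) (fac x i m))))"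
    using i N m st by (intro fac_has_factor) (auto simp: pos_add)
  then show thesis using that i fac_y by metis
qed

text \<open>The factor is output by some window read in an admissible state; that state recurs
  together with the whole window.\<close>

lemma fac_y_infinitely_often:
  "\<exists>j>k. \<exists>m. has_factor (fac y p n) (outs A (st (j + R)) (fac x (j + R) m))"
proof -
  obtain i m where i: "s0 + R \<le> i" "has_factor (fac y p n) (outs A (st i) (fac x i m))"
    by (rule y_factor_covered)
  define i' where "i' = i - R"
  have i': "i = i' + R" "s0 \<le> i'" using i(1) by (auto simp: i'_def)
  obtain j where j: "k < j" "fac x j (R + m) = fac x i' (R + m)" "st (j + R) = st i"
    using recurs[OF tail[OF i'(2)], of m] i' unfolding infinite_nat_iff_unbounded by auto
  have "fac x (j + R) m = fac x i m" using fac_eq_mono[OF j(2), of R m] i' by simp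
  then show ?thesis using i j by metis
qed

text \<open>Choose a continuation along which the largest number of starting states produce the given word;
  if some state were missing, it would recur with this continuation and produce the word later.\<close>

lemma synchronised_occurrence:
  obtains i m where "\<And>q. q \<in> E (fac x i R) \<Longrightarrow> has_factor (fac y p n) (outs A q (fac x (i + R) m))"
proof -
  let ?U = "fac y p n"
  define B where "B = (\<lambda>i m. {q \<in> E (fac x i R). has_factor ?U (outs A q (fac x (i + R) m))})"
  define c where "c = Max (range (\<lambda>(i, m). card (B i m)))"
  have "range (\<lambda>(i, m). card (B i m)) \<subseteq> {..card (UNIV :: 'q set)}"
    unfolding image_subset_iff split_paired_Ball_Sigma split_beta by (simp add: card_mono)
  then have fin: "finite (range (\<lambda>(i, m). card (B i m)))"
    using finite_subset by blast
  have le: "card (B i m) \<le> c" for i m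
    unfolding c_def by (rule Max_ge[OF fin]) (auto intro: rev_image_eqI[of "(i, m)"])
  obtain i m where im: "card (B i m) = c"
    using Max_in[OF fin] unfolding c_def by auto
  have "q \<in> B i m" if q: "q \<in> E (fac x i R)" for q
  proof (rule ccontr)
    assume nq: "q \<notin> B i m"
    obtain j where j: "fac x j (R + m) = fac x i (R + m)" "st (j + R) = q"
      using not_finite_existsD[OF recurs[OF q, of m]] by blast
    obtain k m' where k: "j + m < k" "has_factor ?U (outs A (st (k + R)) (fac x (k + R) m'))"
      using fac_y_infinitely_often by blast
    obtain d where d: "k = j + m + d" using k(1) by (metis less_imp_add_positive)
    let ?M = "m + (d + m')"
    have jR: "fac x j R = fac x i R" "fac x (j + R) m = fac x (i + R) m"
      using fac_eq_mono[OF j(1), of 0 R] fac_eq_mono[OF j(1), of R m] by simp_all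
    have "B i m \<subseteq> B j ?M"
      unfolding B_def by (auto simp: jR fac_add outs_append intro: has_factor_appendI)
    moreover have "q \<in> B j ?M"
    proof -
      have "outs A q (fac x (j + R) ?M) = outs A q (fac x (j + R) (m + d)) @ outs A (st (k + R)) (fac x (k + R) m')"
      proof -
        have "fac x (j + R) ?M = fac x (j + R) (m + d) @ fac x (k + R) m'"
          unfolding add.assoc[symmetric] fac_add[of x "j + R" "m + d"] by (simp add: d ac_simps)
        moreover have "\<delta> q (fac x (j + R) (m + d)) = st (k + R)"
          using run_state_add[of A x "j + R" "m + d"] j(2) by (simp add: d ac_simps)
        ultimately show ?thesis by (simp add: outs_append)
      qed
      then show ?thesis using k(2) q jR by (auto simp: B_def intro: has_factor_appendI)
    qed
    ultimately have "card (B i m) < card (B j ?M)"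
      using nq by (intro psubset_card_mono) auto
    then show False using le[of j ?M] im by simp
  qed
  then show thesis using that[of i m] by (auto simp: B_def)
qed

text \<open>The synchronised continuation has bounded gaps in \<open>x\<close>. Whatever the
  admissible state at the outset, an admissible one is in force when the continuation is reached,
  and all of them produce the factor.\<close>

lemma has_factor_outs_window:
  obtains H where "\<And>i q. q \<in> E (fac x i R) \<Longrightarrow> has_factor (fac y p n) (outs A q (fac x (i + R) H))"
proof -
  obtain i0 m where im: "\<And>q. q \<in> E (fac x i0 R) \<Longrightarrow> has_factor (fac y p n) (outs A q (fac x (i0 + R) m))"
    by (rule synchronised_occurrence) blast
  obtain M where M: "\<And>j. \<exists>k. j \<le> k \<and> k < j + M \<and> fac x k (R + m) = fac x i0 (R + m)"
    using gaps unfolding bounded_gaps_def by blast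
  show thesis
  proof (rule that[of "M + m"])
    fix i q assume q: "q \<in> E (fac x i R)"
    obtain d where d: "d < M" "fac x (i + d) (R + m) = fac x i0 (R + m)"
      using M[of i] by (auto simp: le_iff_add)
    let ?q = "\<delta> q (fac x (i + R) d)"
    have eq: "fac x (i + d) R = fac x i0 R" "fac x (i + d + R) m = fac x (i0 + R) m"
      using fac_eq_mono[OF d(2), of 0 R] fac_eq_mono[OF d(2), of R m] by simp_all
    have "?q \<in> E (fac x (i + d) R)" using q by (simp add: E_add_image)
    then have *: "has_factor (fac y p n) (outs A ?q (fac x (i + d + R) m))"
      using im[of ?q] eq by simp
    obtain e where e: "M + m = d + (m + e)" using d by (metis add.assoc add.commute less_imp_add_positive)
    have "outs A q (fac x (i + R) (M + m)) = outs A q (fac x (i + R) d) @ outs A ?q (fac x (i + d + R) m) @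
        outs A (\<delta> ?q (fac x (i + d + R) m)) (fac x (i + d + R + m) e)"
      unfolding e fac_add outs_append by (simp add: ac_simps)
    then show "has_factor (fac y p n) (outs A q (fac x (i + R) (M + m)))"
      using has_factor_append[OF *] by simp
  qed
qed

lemma bounded_gaps_y: "bounded_gaps y"
  unfolding bounded_gaps_def
proof (intro allI)
  fix p n
  obtain H where H: "\<And>i q. q \<in> E (fac x i R) \<Longrightarrow> has_factor (fac y p n) (outs A q (fac x (i + R) H))"
    by (rule has_factor_outs_window) blast
  have "\<exists>k. j \<le> k \<and> k < j + maxout * (1 + H) + 1 \<and> fac y k n = fac y p n" for j
  proof -
    obtain i where i: "s0 + R \<le> i" "pos A x i \<le> start + j" "start + j < pos A x (Suc i)"
      by (rule y_position)
    \<comment> \<open>Position \<open>j\<close> lies inside the output of letter \<open>i\<close>,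
      so the search begins with the next letter, whose output starts after \<open>j\<close>.\<close>
    define i' where "i' = Suc i - R"
    have i': "i' + R = Suc i" "s0 \<le> i'" using i by (auto simp: i'_def)
    have "has_factor (fac y p n) (outs A (st (Suc i)) (fac x (Suc i) H))"
      using H[OF tail[OF i'(2)]] i' by simp
    moreover have "fac y (pos A x (Suc i) - start) (length (outs A (st (Suc i)) (fac x (Suc i) H))) = outs A (st (Suc i)) (fac x (Suc i) H)"
      using i by (intro fac_y) simp
    ultimately have "has_factor (fac y p n) (fac y (pos A x (Suc i) - start) (length (outs A (st (Suc i)) (fac x (Suc i) H))))" by simp
    then obtain k where k: "pos A x (Suc i) - start \<le> k"
      "k + n \<le> pos A x (Suc i) - start + length (outs A (st (Suc i)) (fac x (Suc i) H))"
      "fac y k n = fac y p n"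
      by (rule has_factor_fac) simp
    have "pos A x (Suc i) + length (outs A (st (Suc i)) (fac x (Suc i) H)) \<le> pos A x i + maxout * (1 + H)"
      using pos_add_le[of i "1 + H"] pos_add[of "Suc i" H] by simp
    then show ?thesis using k i by (intro exI[of _ k]) auto
  qed
  then show "\<exists>M. \<forall>j. \<exists>k. j \<le> k \<and> k < j + M \<and> fac y k n = fac y p n"
    by (metis add.assoc)
qed

text \<open>The first letter of \<open>y\<close> is output within every \<open>H\<close> letters,
  from every admissible state; so \<open>H\<close> letters produce at least one symbol, and
  \<open>H * n\<close> letters at least \<open>n\<close>.\<close>

lemma output_growth:
  obtains G where "0 < G" "\<And>i q n. q \<in> E (fac x i R) \<Longrightarrow> n \<le> length (outs A q (fac x (i + R) (G * n)))"
proof -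
  obtain H where H: "\<And>i q. q \<in> E (fac x i R) \<Longrightarrow> has_factor (fac y 0 1) (outs A q (fac x (i + R) H))"
    by (rule has_factor_outs_window) blast
  have 1: "1 \<le> length (outs A q (fac x (i + R) H))" if "q \<in> E (fac x i R)" for i q
    using H[OF that] by (auto simp: has_factor_def)
  obtain q0 where "q0 \<in> E (fac x 0 R)" using E_nonempty[of "fac x 0 R"] by auto
  then have "0 < H" using 1[of q0 0] by (cases H) auto
  moreover have "n \<le> length (outs A q (fac x (i + R) (H * n)))" if "q \<in> E (fac x i R)" for i q n
    using that
  proof (induction n arbitrary: i q)
    case (Suc n)
    have "\<delta> q (fac x (i + R) H) \<in> E (fac x (i + H) R)" using Suc.prems by (simp add: E_add_image)
    from Suc.IH[OF this] 1[OF Suc.prems] show ?case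
      by (simp add: fac_add outs_append ac_simps)
  qed simp
  ultimately show thesis using that by blast
qed

text \<open>One letter, which emits position \<open>p\<close> at offset \<open>j\<close>, and
  \<open>G * n\<close> further letters, which emit at least \<open>n\<close> symbols.\<close>

lemma y_window:
  assumes G: "\<And>i q n. q \<in> E (fac x i R) \<Longrightarrow> n \<le> length (outs A q (fac x (i + R) (G * n)))"
  obtains i j where "s0 \<le> i" "j < length (out_word A (st (i + R)) (x (i + R)))"
    "j + n \<le> length (outs A (st (i + R)) (fac x (i + R) (1 + G * n)))"
    "pos A x (i + R) - start + j = p"
proof -
  obtain i where i: "s0 + R \<le> i" "pos A x i \<le> start + p" "start + p < pos A x (Suc i)"
    by (rule y_position)
  define i' where "i' = i - R"
  have i': "i = i' + R" "s0 \<le> i'" using i by (auto simp: i'_def)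
  define j where "j = start + p - pos A x i"
  have j: "j < length (out_word A (st i) (x i))"
    using i by (simp add: j_def output_prefix_def)
  have "st (Suc i) \<in> E (fac x (Suc i') R)" using tail[of "Suc i'"] i' by simp
  then have "n \<le> length (outs A (st (Suc i)) (fac x (Suc i) (G * n)))"
    using G[of "st (Suc i)" "Suc i'" n] i' by simp
  moreover have "fac x i (1 + G * n) = x i # fac x (Suc i) (G * n)"
    unfolding fac_add by (simp add: fac_Suc)
  ultimately have "j + n \<le> length (outs A (st i) (fac x i (1 + G * n)))" using j by simp
  moreover have "pos A x i - start + j = p"
    using pos_mono[OF i(1), of A x] i by (simp add: j_def start_def)
  ultimately show thesis using that[of i' j] i' j by simp
qed

end

section \<open>Lifting the invariant measure\<close>

lemma sum_indicator_telescope: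
  fixes z :: "nat \<Rightarrow> 'a"
  shows "(\<Sum>j<n. indicator B (sh (Suc j) z)) + indicator B z
    = (\<Sum>j<n. indicator B (sh j z)) + (indicator B (sh n z) :: ennreal)"
proof -
  have "(\<Sum>j<Suc n. indicator B (sh j z)) = indicator B z + (\<Sum>j<n. indicator B (sh (Suc j) z) :: ennreal)"
    by (subst sum.lessThan_Suc_shift) simp
  then show ?thesis by (simp add: add.commute)
qed

lemma fac_shift_map: "fac (shift_map z) i n = fac z (Suc i) n"
  by (simp add: list_eq_iff_nth_eq shift_map_def)

locale transducer_measure = transducer_tail A x R s0 + shift_measure "generated_shift x" \<mu>
  for A :: "('q::finite, 'a::finite, 'b::finite) transducer" and x :: "nat \<Rightarrow> 'a" and R s0 \<mu>
begin

abbreviation "X \<equiv> generated_shift x"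
abbreviation "Y \<equiv> generated_shift y"

text \<open>The first \<open>R\<close> letters of \<open>z\<close> serve only to determine the
  admissible states; \<open>q\<close> is the state after them, and output starts with
  \<open>z R\<close>. For other states the value \<open>y\<close> keeps the map inside
  \<open>Y\<close>; \<open>mass\<close> sums over admissible states only.\<close>

definition lift :: "'q \<Rightarrow> (nat \<Rightarrow> 'a) \<Rightarrow> nat \<Rightarrow> 'b" where
  "lift q z = (if q \<in> E (fac z 0 R) then transducer_output (restart A q) (sh R z) else y)"

lemma X_factor:
  assumes "z \<in> X" obtains i where "fac x i n = fac z 0 n"
  using assms is_factor_facD unfolding in_generated_shift_iff by blast

lemma lift_prefix:
  assumes "q \<in> E (fac z 0 R)"
  shows "fac (lift q z) 0 (length (outs A q (fac z R n))) = outs A q (fac z R n)"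
  using fac_transducer_output_0[of A q "sh R z" n] assms by (simp add: lift_def)

lemma lift_growth:
  obtains G where "0 < G"
    "\<And>z q n. z \<in> X \<Longrightarrow> q \<in> E (fac z 0 R) \<Longrightarrow> n \<le> length (outs A q (fac z R (G * n)))"
proof -
  obtain G where G: "0 < G" "\<And>i q n. q \<in> E (fac x i R) \<Longrightarrow> n \<le> length (outs A q (fac x (i + R) (G * n)))"
    by (rule output_growth) blast
  show thesis
  proof (rule that[OF G(1)])
    fix z q n assume z: "z \<in> X" "q \<in> E (fac z 0 R)"
    obtain i where i: "fac x i (R + G * n) = fac z 0 (R + G * n)" using X_factor[OF z(1)] by blast
    show "n \<le> length (outs A q (fac z R (G * n)))"
      using G(2)[of q i n] z(2) fac_eq_mono[OF i, of 0 R] fac_eq_mono[OF i, of R "G * n"] by simp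
  qed
qed

text \<open>A prefix of the lift is determined by finitely many letters of \<open>z\<close>. These
  form a factor of \<open>x\<close>, which recurs after \<open>s0\<close> in state \<open>q\<close>,
  where its output is a factor of \<open>y\<close>.\<close>

lemma lift_in:
  assumes "z \<in> X" shows "lift q z \<in> Y"
proof (cases "q \<in> E (fac z 0 R)")
  case True
  obtain G where G: "0 < G"
    "\<And>z q n. z \<in> X \<Longrightarrow> q \<in> E (fac z 0 R) \<Longrightarrow> n \<le> length (outs A q (fac z R (G * n)))"
    by (rule lift_growth) blast
  show ?thesis
    unfolding in_generated_shift_iff
  proof
    fix n
    obtain i where i: "fac x i (R + G * n) = fac z 0 (R + G * n)" using X_factor[OF assms] by blast
    have q: "q \<in> E (fac x i R)" using True fac_eq_mono[OF i, of 0 R] by simp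
    obtain j where j: "s0 < j" "fac x j (R + G * n) = fac x i (R + G * n)" "st (j + R) = q"
      using recurs[OF q, of "G * n"] unfolding infinite_nat_iff_unbounded by auto
    have "fac x (j + R) (G * n) = fac z R (G * n)"
      using fac_eq_mono[OF trans[OF j(2) i], of R "G * n"] by simp
    then have "outs A q (fac z R (G * n)) = fac y (pos A x (j + R) - start) (length (outs A q (fac z R (G * n))))"
      using fac_y[of "j + R" "G * n"] j by simp
    moreover have "fac (lift q z) 0 (length (outs A q (fac z R (G * n)))) = outs A q (fac z R (G * n))"
      by (rule lift_prefix[OF True])
    ultimately have "fac (lift q z) 0 (length (outs A q (fac z R (G * n)))) = fac y (pos A x (j + R) - start) (length (outs A q (fac z R (G * n))))"
      by simp
    from fac_eq_mono[OF this, of 0 n] G(2)[OF assms True, of n]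
    have "fac (lift q z) 0 n = fac y (pos A x (j + R) - start) n" by simp
    then show "is_factor (fac (lift q z) 0 n) y" by simp
  qed
qed (simp add: lift_def self_in_generated_shift)

lemma lift_measurable: "lift q \<in> measurable \<mu> (word_borel Y)"
proof -
  obtain G where G: "0 < G"
    "\<And>z q n. z \<in> X \<Longrightarrow> q \<in> E (fac z 0 R) \<Longrightarrow> n \<le> length (outs A q (fac z R (G * n)))"
    by (rule lift_growth) blast
  have "lift q \<in> measurable (word_borel X) (word_borel Y)"
  proof (rule measurable_word_borel)
    fix z n assume z: "z \<in> X"
    have "fac (lift q z') 0 n = fac (lift q z) 0 n"
      if z': "z' \<in> X" "fac z' 0 (R + G * n) = fac z 0 (R + G * n)" for z'
    proof -
      have eq: "fac z' 0 R = fac z 0 R" "fac z' R (G * n) = fac z R (G * n)"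
        using fac_eq_mono[OF z'(2), of 0 R] fac_eq_mono[OF z'(2), of R "G * n"] by simp_all
      show ?thesis
      proof (cases "q \<in> E (fac z 0 R)")
        case True
        then have "fac (lift q z') 0 (length (outs A q (fac z R (G * n)))) = fac (lift q z) 0 (length (outs A q (fac z R (G * n))))"
          using lift_prefix[OF True, of "G * n"] lift_prefix[of q z' "G * n"] eq by simp
        from fac_eq_mono[OF this, of 0 n] G(2)[OF z True, of n] show ?thesis by simp
      qed (simp add: lift_def eq)
    qed
    then show "\<exists>m. \<forall>z'\<in>X. fac z' 0 m = fac z 0 m \<longrightarrow> fac (lift q z') 0 n = fac (lift q z) 0 n"
      by blast
  qed (rule lift_in)
  then show ?thesis by (simp add: measurable_cong_sets[OF sets_eq refl])
qed

lemma lift_shift: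
  assumes z: "z \<in> X"
  shows states_shift: "E (fac (shift_map z) 0 R) = (\<lambda>q. next_state A q (z R)) ` E (fac z 0 R)"
    and inj_states_shift: "inj_on (\<lambda>q. next_state A q (z R)) (E (fac z 0 R))"
    and lift_next: "q \<in> E (fac z 0 R) \<Longrightarrow>
      lift (next_state A q (z R)) (shift_map z) = sh (length (out_word A q (z R))) (lift q z)"
proof -
  obtain i where i: "fac x i (R + 1) = fac z 0 (R + 1)" using X_factor[OF z] by blast
  have eq: "fac x i R = fac z 0 R" "fac x (i + 1) R = fac (shift_map z) 0 R" "fac x (i + R) 1 = [z R]"
    using fac_eq_mono[OF i, of 0 R] fac_eq_mono[OF i, of 1 R] fac_eq_mono[OF i, of R 1]
    by (simp_all add: fac_shift_map fac_Suc)
  show 1: "E (fac (shift_map z) 0 R) = (\<lambda>q. next_state A q (z R)) ` E (fac z 0 R)"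
    using E_add_image[of i 1] unfolding eq by simp
  show "inj_on (\<lambda>q. next_state A q (z R)) (E (fac z 0 R))"
    using E_add_inj[of i 1] unfolding eq by simp
  assume q: "q \<in> E (fac z 0 R)"
  obtain G where G: "0 < G"
    "\<And>z q n. z \<in> X \<Longrightarrow> q \<in> E (fac z 0 R) \<Longrightarrow> n \<le> length (outs A q (fac z R (G * n)))"
    by (rule lift_growth) blast
  have "infinite_output (restart A q) (sh R z)"
    unfolding infinite_output_def
  proof
    fix n
    show "\<exists>N. n < length (output_prefix (restart A q) (sh R z) N)"
      using G(2)[OF z q, of "Suc n"] by (intro exI[of _ "G * Suc n"]) (simp add: output_prefix_eq)
  qed
  from transducer_output_shift[OF this, of 1]
  have "sh (length (out_word A q (z R))) (transducer_output (restart A q) (sh R z))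
      = transducer_output (restart A (next_state A q (z R))) (sh R (shift_map z))"
    by (simp add: output_prefix_def restart_def shift_map_def)
  then show "lift (next_state A q (z R)) (shift_map z) = sh (length (out_word A q (z R))) (lift q z)"
    using q 1 by (simp add: lift_def)
qed

text \<open>The \<open>\<mu>\<close>-integral of \<open>mass B\<close> is, up to normalisation, the measure of \<open>B\<close> under the lift. It is
  invariant because the sum over \<open>j\<close> telescopes and the step to the next letter permutes the lifts.\<close>

definition mass :: "(nat \<Rightarrow> 'b) set \<Rightarrow> (nat \<Rightarrow> 'a) \<Rightarrow> ennreal" where
  "mass B z = (\<Sum>q\<in>E (fac z 0 R). \<Sum>j<length (out_word A q (z R)). indicator B (sh j (lift q z)))"

lemma sum_E_measurable:
  fixes f :: "'q \<Rightarrow> (nat \<Rightarrow> 'a) \<Rightarrow> ennreal"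
  assumes [measurable]: "\<And>q. f q \<in> borel_measurable \<mu>"
  shows "(\<lambda>z. \<Sum>q\<in>E (fac z 0 R). f q z) \<in> borel_measurable \<mu>"
proof -
  have [measurable]: "(\<lambda>z. indicator (E (fac z 0 R)) q :: ennreal) \<in> borel_measurable \<mu>" for q
    by (rule measurable_compose[OF prefix_function_measurable[of R "\<lambda>z. fac z 0 R"]]) auto
  \<comment> \<open>The index set depends on \<open>z\<close>; summing over all states with an
    indicator moves this dependence into the summands.\<close>
  have "(\<lambda>z. \<Sum>q\<in>E (fac z 0 R). f q z) = (\<lambda>z. \<Sum>q\<in>UNIV. indicator (E (fac z 0 R)) q * f q z)"
    by (intro ext sum.mono_neutral_cong_left) (auto simp: indicator_def)
  also have "\<dots> \<in> borel_measurable \<mu>" by measurable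
  finally show ?thesis .
qed

lemma sh_measurable: "sh j \<in> measurable (word_borel Y) (word_borel Y)"
proof (rule measurable_word_borel)
  fix z :: "nat \<Rightarrow> 'b" and n
  have "fac (sh j z') 0 n = fac (sh j z) 0 n" if "fac z' 0 (j + n) = fac z 0 (j + n)" for z'
    using fac_eq_mono[OF that, of j n] by simp
  then show "\<exists>m. \<forall>z'\<in>Y. fac z' 0 m = fac z 0 m \<longrightarrow> fac (sh j z') 0 n = fac (sh j z) 0 n"
    by blast
qed (rule shift_in_generated_shift)

lemma indicator_lift_measurable [measurable]:
  assumes "B \<in> sets (word_borel Y)"
  shows "(\<lambda>z. indicator B (sh j (lift q z)) :: ennreal) \<in> borel_measurable \<mu>"
  by (rule measurable_compose[OF lift_measurable], rule measurable_compose[OF sh_measurable])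
    (use assms in simp)

lemma mass_measurable:
  assumes [measurable]: "B \<in> sets (word_borel Y)"
  shows "mass B \<in> borel_measurable \<mu>"
  unfolding mass_def
proof (rule sum_E_measurable)
  fix q
  have [measurable]: "(\<lambda>z. indicator {..<length (out_word A q (z R))} j :: ennreal) \<in> borel_measurable \<mu>" for j
  proof (rule measurable_compose[OF prefix_function_measurable[of "Suc R" "\<lambda>z. z R"]])
    fix z z' :: "nat \<Rightarrow> 'a" assume "fac z' 0 (Suc R) = fac z 0 (Suc R)"
    then show "z' R = z R" by (simp add: fac_Suc)
  qed auto
  have "(\<lambda>z. \<Sum>j<length (out_word A q (z R)). indicator B (sh j (lift q z)))
      = (\<lambda>z. \<Sum>j<maxout. indicator {..<length (out_word A q (z R))} j * (indicator B (sh j (lift q z)) :: ennreal))"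
    using length_out_word_le order.strict_trans2
    by (intro ext sum.mono_neutral_cong_left) (fastforce simp: indicator_def)+
  also have "\<dots> \<in> borel_measurable \<mu>" by measurable
  finally show "(\<lambda>z. \<Sum>j<length (out_word A q (z R)). indicator B (sh j (lift q z)) :: ennreal) \<in> borel_measurable \<mu>" .
qed

lemma mass_Y_le: "mass Y z \<le> of_nat (card (UNIV :: 'q set) * maxout)"
proof -
  have "mass Y z \<le> (\<Sum>q\<in>E (fac z 0 R). of_nat maxout)"
    unfolding mass_def
  proof (rule sum_mono)
    fix q
    have "(\<Sum>j<length (out_word A q (z R)). indicator Y (sh j (lift q z))) \<le> (\<Sum>j<length (out_word A q (z R)). 1 :: ennreal)"
      by (intro sum_mono) (simp add: indicator_def)
    also have "\<dots> \<le> of_nat maxout" using length_out_word_le[of q "z R"] by simp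
    finally show "(\<Sum>j<length (out_word A q (z R)). indicator Y (sh j (lift q z))) \<le> (of_nat maxout :: ennreal)" .
  qed
  also have "\<dots> \<le> (\<Sum>q\<in>(UNIV :: 'q set). of_nat maxout)" by (intro sum_mono2) auto
  finally show ?thesis by simp
qed

lemma mass_mono: "B \<subseteq> C \<Longrightarrow> mass B z \<le> mass C z"
  unfolding mass_def by (intro sum_mono) (auto simp: indicator_def)

lemma suminf_mass:
  assumes "disjoint_family B" shows "(\<Sum>i. mass (B i) z) = mass (\<Union>i. B i) z"
proof -
  have "(\<Sum>i. mass (B i) z) = (\<Sum>q\<in>E (fac z 0 R). \<Sum>j<length (out_word A q (z R)). \<Sum>i. indicator (B i) (sh j (lift q z)))"
    unfolding mass_def by (simp add: suminf_sum)
  then show ?thesis using assms by (simp add: mass_def suminf_indicator)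
qed

section \<open>The lifted measure\<close>

definition total :: ennreal where "total = (\<integral>\<^sup>+z. mass Y z \<partial>\<mu>)"

definition \<nu> :: "(nat \<Rightarrow> 'b) measure" where
  "\<nu> = measure_of Y (sets (word_borel Y)) (\<lambda>B. (\<integral>\<^sup>+z. mass B z \<partial>\<mu>) * inverse total)"

lemma sets_\<nu>: "sets \<nu> = sets (word_borel Y)"
  unfolding \<nu>_def using sets.sigma_sets_eq[of "word_borel Y"] sets.space_closed[of "word_borel Y"]
  by (simp add: sets_measure_of)

lemma emeasure_\<nu>:
  assumes "B \<in> sets (word_borel Y)" shows "emeasure \<nu> B = (\<integral>\<^sup>+z. mass B z \<partial>\<mu>) * inverse total"
proof -
  have 1: "sigma_algebra Y (sets (word_borel Y))"
    using sets.sigma_algebra_axioms[of "word_borel Y"] by simp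
  have 2: "positive (sets (word_borel Y)) (\<lambda>B. (\<integral>\<^sup>+z. mass B z \<partial>\<mu>) * inverse total)"
    by (simp add: positive_def mass_def)
  have 3: "countably_additive (sets (word_borel Y)) (\<lambda>B. (\<integral>\<^sup>+z. mass B z \<partial>\<mu>) * inverse total)"
    unfolding countably_additive_def
  proof (intro allI impI)
    fix B :: "nat \<Rightarrow> (nat \<Rightarrow> 'b) set"
    assume B: "range B \<subseteq> sets (word_borel Y)" "disjoint_family B"
    have "(\<Sum>i. \<integral>\<^sup>+z. mass (B i) z \<partial>\<mu>) = (\<integral>\<^sup>+z. (\<Sum>i. mass (B i) z) \<partial>\<mu>)"
      using B(1) mass_measurable by (intro nn_integral_suminf[symmetric]) auto
    then show "(\<Sum>i. (\<integral>\<^sup>+z. mass (B i) z \<partial>\<mu>) * inverse total) = (\<integral>\<^sup>+z. mass (\<Union>i. B i) z \<partial>\<mu>) * inverse total"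
      by (simp add: suminf_mass[OF B(2)])
  qed
  show ?thesis
    unfolding \<nu>_def by (rule emeasure_measure_of_sigma[OF 1 2 3 assms])
qed

lemma total_finite: "total < \<infinity>"
proof -
  have "total \<le> (\<integral>\<^sup>+z. of_nat (card (UNIV :: 'q set) * maxout) \<partial>\<mu>)"
    unfolding total_def by (intro nn_integral_mono mass_Y_le)
  also have "\<dots> < \<infinity>" using emeasure_space_1 by (simp add: ennreal_mult_less_top of_nat_less_top)
  finally show ?thesis .
qed

lemma mass_invariant:
  assumes B: "B \<in> sets (word_borel Y)"
  shows "(\<integral>\<^sup>+z. mass (shift_map -` B \<inter> Y) z \<partial>\<mu>) = (\<integral>\<^sup>+z. mass B z \<partial>\<mu>)"
proof -
  have B': "shift_map -` B \<inter> Y \<in> sets (word_borel Y)"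
    using measurable_sets[OF measurable_shift[OF is_shift_generated_shift] B] by simp
  \<comment> \<open>The base floor of the tower. Shifting moves each floor one up, and the floor
    above the top one is the base over \<open>shift_map z\<close>; so \<open>mass\<close> of the
    preimage and of \<open>B\<close> differ by \<open>a (shift_map z) - a z\<close>, stated with
    sums since the values are in \<open>ennreal\<close>.\<close>
  define a where "a = (\<lambda>z. \<Sum>q\<in>E (fac z 0 R). indicator B (lift q z) :: ennreal)"
  have a: "a \<in> borel_measurable \<mu>"
    unfolding a_def using indicator_lift_measurable[OF B, where j = 0] by (intro sum_E_measurable) simp
  have eq: "mass (shift_map -` B \<inter> Y) z + a z = mass B z + a (shift_map z)" if z: "z \<in> X" for z
  proof -
    have ind: "indicator (shift_map -` B \<inter> Y) (sh j (lift q z)) = (indicator B (sh (Suc j) (lift q z)) :: ennreal)" for q j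
      using shift_in_generated_shift[OF lift_in[OF z]] by (simp add: indicator_def shift_map_def)
    have "mass (shift_map -` B \<inter> Y) z + a z = (\<Sum>q\<in>E (fac z 0 R).
        (\<Sum>j<length (out_word A q (z R)). indicator B (sh (Suc j) (lift q z))) + indicator B (lift q z))"
      unfolding mass_def a_def ind sum.distrib ..
    also have "\<dots> = mass B z + (\<Sum>q\<in>E (fac z 0 R). indicator B (sh (length (out_word A q (z R))) (lift q z)))"
      unfolding sum_indicator_telescope mass_def sum.distrib ..
    also have "(\<Sum>q\<in>E (fac z 0 R). indicator B (sh (length (out_word A q (z R))) (lift q z)))
        = (\<Sum>q\<in>E (fac z 0 R). indicator B (lift (next_state A q (z R)) (shift_map z)) :: ennreal)"
      using lift_next[OF z] by (intro sum.cong) simp_all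
    also have "\<dots> = a (shift_map z)"
      unfolding a_def states_shift[OF z] by (simp add: sum.reindex[OF inj_states_shift[OF z]])
    finally show ?thesis .
  qed
  have "(\<integral>\<^sup>+z. mass (shift_map -` B \<inter> Y) z \<partial>\<mu>) + (\<integral>\<^sup>+z. a z \<partial>\<mu>) = (\<integral>\<^sup>+z. mass (shift_map -` B \<inter> Y) z + a z \<partial>\<mu>)"
    by (rule nn_integral_add[symmetric]) (rule mass_measurable[OF B'] a)+
  also have "\<dots> = (\<integral>\<^sup>+z. mass B z + a (shift_map z) \<partial>\<mu>)"
    by (intro nn_integral_cong) (simp add: eq)
  also have "\<dots> = (\<integral>\<^sup>+z. mass B z \<partial>\<mu>) + (\<integral>\<^sup>+z. a (shift_map z) \<partial>\<mu>)"
    using measurable_compose[OF measurable_shift_map a] by (intro nn_integral_add mass_measurable B)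
  also have "(\<integral>\<^sup>+z. a (shift_map z) \<partial>\<mu>) = (\<integral>\<^sup>+z. a z \<partial>\<mu>)" by (rule nn_integral_shift[OF a])
  finally have eq2: "(\<integral>\<^sup>+z. a z \<partial>\<mu>) + (\<integral>\<^sup>+z. mass (shift_map -` B \<inter> Y) z \<partial>\<mu>) = (\<integral>\<^sup>+z. a z \<partial>\<mu>) + (\<integral>\<^sup>+z. mass B z \<partial>\<mu>)"
    by (simp add: add.commute)
  \<comment> \<open>Only a finite integral of \<open>a\<close> may be cancelled.\<close>
  have "(\<integral>\<^sup>+z. a z \<partial>\<mu>) \<le> (\<integral>\<^sup>+z. of_nat (card (UNIV :: 'q set)) \<partial>\<mu>)"
  proof (rule nn_integral_mono)
    fix z
    have "a z \<le> (\<Sum>q\<in>E (fac z 0 R). 1)"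
      unfolding a_def by (intro sum_mono) (simp add: indicator_def)
    also have "\<dots> \<le> (\<Sum>q\<in>(UNIV :: 'q set). 1)" by (intro sum_mono2) auto
    finally show "a z \<le> of_nat (card (UNIV :: 'q set))" by simp
  qed
  also have "\<dots> < \<infinity>" using emeasure_space_1 by (simp add: ennreal_mult_less_top of_nat_less_top)
  finally show ?thesis using eq2 by (auto simp: ennreal_add_left_cancel)
qed

text \<open>The factor at \<open>p\<close> is output at offset \<open>j\<close> by a window read in
  state \<open>q\<close>. Prepending the \<open>R\<close> letters before this window gives a word
  that makes \<open>q\<close> admissible for every \<open>z\<close> beginning with it, so floor
  \<open>j\<close> of this lift lies in the cylinder.\<close>

lemma mass_cylinder:
  obtains G where "0 < G"
    "\<And>N n p. R + 1 + G * n \<le> N \<Longrightarrow> \<exists>w\<in>language X N. \<forall>z\<in>cylinder X w. 1 \<le> mass (cylinder Y (fac y p n)) z"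
proof -
  obtain G where G: "0 < G" "\<And>i q n. q \<in> E (fac x i R) \<Longrightarrow> n \<le> length (outs A q (fac x (i + R) (G * n)))"
    by (rule output_growth) blast
  show thesis
  proof (rule that[OF G(1)])
    fix N n p assume N: "R + 1 + G * n \<le> N"
    obtain i' j where w: "s0 \<le> i'" "j < length (out_word A (st (i' + R)) (x (i' + R)))"
      "j + n \<le> length (outs A (st (i' + R)) (fac x (i' + R) (1 + G * n)))"
      "pos A x (i' + R) - start + j = p"
      by (rule y_window[OF G(2)])
    define i where "i = i' + R"
    define q where "q = st i"
    define m where "m = 1 + G * n"
    have i: "s0 + R \<le> i" using w(1) by (simp add: i_def)
    have q: "q \<in> E (fac x i' R)" using tail[OF w(1)] by (simp add: q_def i_def)
    have j: "j < length (out_word A q (x i))" and len: "j + n \<le> length (outs A q (fac x i m))"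
      and p: "pos A x i - start + j = p"
      using w by (simp_all add: i_def q_def m_def)
    have "1 \<le> mass (cylinder Y (fac y p n)) z" if z: "z \<in> cylinder X (fac x i' N)" for z
    proof -
      have zX: "z \<in> X" and zw: "fac z 0 N = fac x i' N" using z by (auto simp: cylinder_eq)
      have e1: "fac z 0 R = fac x i' R" using fac_eq_mono[OF zw, of 0 R] N by simp
      have e2: "fac z R m = fac x i m" using fac_eq_mono[OF zw, of R m] N by (simp add: i_def m_def)
      have e3: "z R = x i" using fac_eq_mono[OF zw, of R 1] N by (simp add: i_def fac_Suc)
      have qz: "q \<in> E (fac z 0 R)" using q e1 by simp
      have "fac (lift q z) 0 (length (outs A q (fac x i m))) = outs A q (fac x i m)"
        using lift_prefix[OF qz, of m] by (simp add: e2)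
      also have "\<dots> = fac y (pos A x i - start) (length (outs A q (fac x i m)))"
        using fac_y[OF i, of m] by (simp add: q_def)
      finally have "fac (lift q z) j n = fac y (pos A x i - start + j) n"
        using fac_eq_mono[of "lift q z" 0 _ y _ j n] len by simp
      also note p
      finally have "sh j (lift q z) \<in> cylinder Y (fac y p n)"
        using shift_in_generated_shift[OF lift_in[OF zX]] by (simp add: cylinder_eq)
      then have "1 = indicator (cylinder Y (fac y p n)) (sh j (lift q z))" by simp
      also have "\<dots> \<le> (\<Sum>j<length (out_word A q (z R)). indicator (cylinder Y (fac y p n)) (sh j (lift q z)) :: ennreal)"
        using j e3 by (intro member_le_sum) auto
      also have "\<dots> \<le> mass (cylinder Y (fac y p n)) z"
        unfolding mass_def using qz by (intro member_le_sum[of q]) auto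
      finally show ?thesis .
    qed
    then show "\<exists>w\<in>language X N. \<forall>z\<in>cylinder X w. 1 \<le> mass (cylinder Y (fac y p n)) z"
      by (auto simp: language_generated_shift)
  qed
qed

lemma mass_cylinder_lower:
  assumes "\<And>z. z \<in> cylinder X w \<Longrightarrow> 1 \<le> mass C z" 
  shows "ennreal (prob (cylinder X w)) \<le> (\<integral>\<^sup>+z. mass C z \<partial>\<mu>)"
proof -
  have "ennreal (prob (cylinder X w)) = (\<integral>\<^sup>+z. indicator (cylinder X w) z \<partial>\<mu>)"
    using cylinder_in_word_borel sets_eq by (subst nn_integral_indicator) (auto simp: emeasure_eq_measure)
  also have "\<dots> \<le> (\<integral>\<^sup>+z. mass C z \<partial>\<mu>)"
    using assms by (intro nn_integral_mono) (auto simp: indicator_def)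
  finally show ?thesis .
qed

theorem boshernitzan_y:
  assumes \<epsilon>: "0 < \<epsilon>" and inf: "infinite {n. \<forall>w\<in>language X n. \<epsilon> \<le> real n * prob (cylinder X w)}"
  shows "boshernitzan y"
proof -
  obtain G where G: "0 < G"
    "\<And>N n p. R + 1 + G * n \<le> N \<Longrightarrow> \<exists>w\<in>language X N. \<forall>z\<in>cylinder X w. 1 \<le> mass (cylinder Y (fac y p n)) z"
    by (rule mass_cylinder) blast
  have lower: "ennreal (\<epsilon> / real N) \<le> (\<integral>\<^sup>+z. mass (cylinder Y (fac y p n)) z \<partial>\<mu>)"
    if N: "R + 1 + G * n \<le> N" "\<forall>w\<in>language X N. \<epsilon> \<le> real N * prob (cylinder X w)" for N n p
  proof -
    obtain w where w: "w \<in> language X N" "\<And>z. z \<in> cylinder X w \<Longrightarrow> 1 \<le> mass (cylinder Y (fac y p n)) z"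
      using G(2)[OF N(1)] by blast
    have "\<epsilon> / real N \<le> prob (cylinder X w)"
      using N w(1) by (simp add: divide_le_eq mult.commute)
    then have "ennreal (\<epsilon> / real N) \<le> ennreal (prob (cylinder X w))" by (rule ennreal_leI)
    also have "\<dots> \<le> (\<integral>\<^sup>+z. mass (cylinder Y (fac y p n)) z \<partial>\<mu>)"
      by (rule mass_cylinder_lower[OF w(2)])
    finally show ?thesis .
  qed
  \<comment> \<open>The lower bound for the empty factor, whose cylinder is all of
    \<open>Y\<close>.\<close>
  have total_pos: "0 < total"
  proof -
    obtain N where N: "R + 1 < N" "\<forall>w\<in>language X N. \<epsilon> \<le> real N * prob (cylinder X w)"
      using inf unfolding infinite_nat_iff_unbounded by blast
    have "0 < ennreal (\<epsilon> / real N)" using \<epsilon> N by simp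
    also have "\<dots> \<le> (\<integral>\<^sup>+z. mass (cylinder Y (fac y 0 0)) z \<partial>\<mu>)" using N by (intro lower) auto
    also have "\<dots> \<le> total"
      unfolding total_def by (intro nn_integral_mono mass_mono) (auto simp: cylinder_eq)
    finally show ?thesis .
  qed
  have Y: "Y \<in> sets (word_borel Y)" using sets.top[of "word_borel Y"] by simp
  have sp: "space \<nu> = Y" using sets_eq_imp_space_eq[OF sets_\<nu>] by simp
  have "emeasure \<nu> (space \<nu>) = 1"
    unfolding sp emeasure_\<nu>[OF Y] total_def[symmetric]
    using total_pos total_finite by (simp add: ennreal_divide_self[unfolded divide_ennreal_def])
  then interpret nu: prob_space \<nu> by (rule prob_spaceI)
  have "measure \<nu> (shift_map -` B \<inter> Y) = measure \<nu> B" if "B \<in> sets \<nu>" for B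
  proof -
    have B: "B \<in> sets (word_borel Y)" using that sets_\<nu> by simp
    have "shift_map -` B \<inter> Y \<in> sets (word_borel Y)"
      using measurable_sets[OF measurable_shift[OF is_shift_generated_shift] B] by simp
    then show ?thesis
      using mass_invariant[OF B] B by (simp add: measure_def emeasure_\<nu>)
  qed
  then have inv: "invariant_measure Y \<nu>"
    using nu.prob_space_axioms sets_\<nu> by (simp add: invariant_measure_def word_borel_def)
  define c where "c = enn2real total"
  have c: "0 < c" "total = ennreal c"
    using total_pos total_finite by (auto simp: c_def enn2real_positive_iff less_top)
  have meas: "\<epsilon> / (real N * c) \<le> measure \<nu> (cylinder Y (fac y p n))"
    if N: "R + 1 + G * n \<le> N" "\<forall>w\<in>language X N. \<epsilon> \<le> real N * prob (cylinder X w)" for N n p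
  proof -
    have "ennreal (\<epsilon> / (real N * c)) = ennreal (\<epsilon> / real N) * inverse total"
      using c \<epsilon> by (simp add: inverse_ennreal ennreal_mult[symmetric] field_simps)
    also have "\<dots> \<le> emeasure \<nu> (cylinder Y (fac y p n))"
      unfolding emeasure_\<nu>[OF cylinder_in_word_borel] by (intro mult_right_mono lower N) simp
    finally show ?thesis by (simp add: nu.emeasure_eq_measure)
  qed
  have "infinite {n. \<forall>w\<in>language Y n. \<epsilon> / (2 * real G * c) \<le> real n * measure \<nu> (cylinder Y w)}"
    unfolding infinite_nat_iff_unbounded
  proof
    fix k
    \<comment> \<open>For \<open>n = (N - R - 1) div G\<close> the first summand gives
      \<open>N \<le> 2 * (G * n)\<close>, the source of the factor \<open>2 * G\<close> in the new
      constant; the second then gives \<open>k < n\<close>.\<close>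
    obtain N where N: "2 * (R + 1 + G) + 2 * (G * (k + 1)) < N" "\<forall>w\<in>language X N. \<epsilon> \<le> real N * prob (cylinder X w)"
      using inf unfolding infinite_nat_iff_unbounded by blast
    define n where "n = (N - R - 1) div G"
    have "N - R - 1 = G * n + (N - R - 1) mod G" "(N - R - 1) mod G < G"
      using G(1) by (simp_all add: n_def)
    then have n: "R + 1 + G * n \<le> N" "N \<le> 2 * (G * n)" using N(1) by auto
    have "G * (k + 1) < G * n" using n(2) N(1) by linarith
    then have "k < n" by (simp only: mult_less_cancel1) simp
    moreover have "\<epsilon> / (2 * real G * c) \<le> real n * measure \<nu> (cylinder Y w)" if w: "w \<in> language Y n" for w
    proof -
      obtain p where p: "w = fac y p n" using w by (auto simp: language_generated_shift)
      have rN: "real N \<le> 2 * (real G * real n)" using n(2) by (metis of_nat_le_iff of_nat_mult of_nat_numeral)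
      have N0: "0 < real N" using N(1) by simp
      have "\<epsilon> / (2 * real G * c) = \<epsilon> / c * (1 / (2 * real G))" using G by simp
      also have "\<dots> \<le> \<epsilon> / c * (real n / real N)"
        using rN N0 G(1) c \<epsilon> by (intro mult_left_mono) (auto simp: field_simps)
      also have "\<dots> = real n * (\<epsilon> / (real N * c))" by (simp add: ac_simps)
      also have "\<dots> \<le> real n * measure \<nu> (cylinder Y w)"
        unfolding p by (intro mult_left_mono meas n(1) N(2)) simp
      finally show ?thesis .
    qed
    ultimately show "\<exists>n>k. n \<in> {n. \<forall>w\<in>language Y n. \<epsilon> / (2 * real G * c) \<le> real n * measure \<nu> (cylinder Y w)}"
      by blast
  qed
  moreover have "0 < \<epsilon> / (2 * real G * c)" using \<epsilon> G c by simp
  ultimately show ?thesis using boshernitzanI[OF bounded_gaps_y inv] by blast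
qed

end

section \<open>Recursive functions\<close>

text \<open>Arguments are functions of one list, and bound variables are put in front of it. Closure
  properties thus become introduction rules that follow the shape of a term.\<close>

definition crec :: "nat \<Rightarrow> (nat list \<Rightarrow> nat) \<Rightarrow> bool" where
  "crec n F \<longleftrightarrow> (\<exists>g. partial_recursive n g \<and> (\<forall>xs. length xs = n \<longrightarrow> g xs = Some (F xs)))"

text \<open>Total access to the arguments makes \<open>arg j (tl xs) = arg (Suc j) xs\<close> hold unconditionally.\<close>

definition arg :: "nat \<Rightarrow> nat list \<Rightarrow> nat" where
  "arg j xs = (if j < length xs then xs ! j else 0)"

lemma arg_simps [simp]: "arg 0 (x # xs) = x" "arg (Suc j) (x # xs) = arg j xs" "arg j [] = 0"
  by (simp_all add: arg_def)

lemma arg_numeral [simp]: "arg (numeral k) (x # xs) = arg (pred_numeral k) xs"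
  "arg 1 (x # xs) = arg 0 xs"
  by (simp_all add: numeral_eq_Suc)

lemma arg_tl: "arg j (tl xs) = arg (Suc j) xs"
  by (cases xs) auto

lemma map_arg: "length xs = n \<Longrightarrow> map (\<lambda>i. arg i xs) [0..<n] = xs"
  by (rule nth_equalityI) (auto simp: arg_def)

lemma crec_cong:
  assumes "crec n F" "\<And>xs. length xs = n \<Longrightarrow> F xs = G xs" shows "crec n G"
  using assms unfolding crec_def by metis

lemma crec_zero: "crec n (\<lambda>_. 0)"
  unfolding crec_def using partial_recursive.zero by blast

lemma crec_arg: "crec n (\<lambda>xs. arg j xs)"
proof (cases "j < n")
  case True
  then have "\<forall>xs. length xs = n \<longrightarrow> Some (xs ! j) = Some (arg j xs)" by (simp add: arg_def)
  then show ?thesis unfolding crec_def using partial_recursive.proj[OF True] by blast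
next
  case False
  then show ?thesis by (intro crec_cong[OF crec_zero]) (simp add: arg_def)
qed

lemma crec_comp:
  assumes F: "crec (length as) F" and as: "\<And>a. a \<in> set as \<Longrightarrow> crec n a"
  shows "crec n (\<lambda>xs. F (map (\<lambda>a. a xs) as))"
proof -
  obtain f where f: "partial_recursive (length as) f" "\<And>xs. length xs = length as \<Longrightarrow> f xs = Some (F xs)"
    using F unfolding crec_def by blast
  have "\<forall>a\<in>set as. \<exists>g. partial_recursive n g \<and> (\<forall>xs. length xs = n \<longrightarrow> g xs = Some (a xs))"
    using as unfolding crec_def by blast
  then obtain h where h: "\<forall>a\<in>set as. partial_recursive n (h a) \<and> (\<forall>xs. length xs = n \<longrightarrow> h a xs = Some (a xs))"
    by (metis (no_types))
  let ?g = "\<lambda>xs. if \<forall>g\<in>set (map h as). g xs \<noteq> None then f (map (\<lambda>g. the (g xs)) (map h as)) else None"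
  have "partial_recursive n ?g"
    by (rule partial_recursive.comp) (use f h in auto)
  moreover have "?g xs = Some (F (map (\<lambda>a. a xs) as))" if "length xs = n" for xs
  proof -
    have eq: "map (\<lambda>g. the (g xs)) (map h as) = map (\<lambda>a. a xs) as" using h that by simp
    have "\<forall>g\<in>set (map h as). g xs \<noteq> None" using h that by auto
    then have "?g xs = f (map (\<lambda>g. the (g xs)) (map h as))" by (rule if_P)
    also have "\<dots> = Some (F (map (\<lambda>a. a xs) as))" unfolding eq by (rule f(2)) simp
    finally show ?thesis .
  qed
  ultimately show ?thesis unfolding crec_def by blast
qed

abbreviation "rec1 f \<equiv> crec 1 (\<lambda>xs. f (arg 0 xs))"
abbreviation "rec2 f \<equiv> crec 2 (\<lambda>xs. f (arg 0 xs) (arg 1 xs))"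
abbreviation "rec3 f \<equiv> crec 3 (\<lambda>xs. f (arg 0 xs) (arg 1 xs) (arg 2 xs))"

lemma rec1_app: "rec1 f \<Longrightarrow> crec n a \<Longrightarrow> crec n (\<lambda>xs. f (a xs))"
  using crec_comp[of "[a]" "\<lambda>xs. f (arg 0 xs)" n] by simp

lemma rec2_app: "rec2 f \<Longrightarrow> crec n a \<Longrightarrow> crec n b \<Longrightarrow> crec n (\<lambda>xs. f (a xs) (b xs))"
  using crec_comp[of "[a, b]" "\<lambda>xs. f (arg 0 xs) (arg 1 xs)" n]
  by (auto simp: numeral_eq_Suc)

lemma rec3_app: "rec3 f \<Longrightarrow> crec n a \<Longrightarrow> crec n b \<Longrightarrow> crec n c \<Longrightarrow> crec n (\<lambda>xs. f (a xs) (b xs) (c xs))"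
  using crec_comp[of "[a, b, c]" "\<lambda>xs. f (arg 0 xs) (arg 1 xs) (arg 2 xs)" n]
  by (auto simp: numeral_eq_Suc)

lemma computable_iff: "computable f \<longleftrightarrow> rec1 f"
proof -
  have "(\<forall>xs. length xs = 1 \<longrightarrow> g xs = Some (f (arg 0 xs))) \<longleftrightarrow> (\<forall>n. g [n] = Some (f n))" for g
    by (auto simp: length_Suc_conv)
  then show ?thesis by (simp add: computable_def crec_def)
qed

lemma rec1_Suc: "rec1 Suc"
proof -
  have "\<forall>xs. length xs = 1 \<longrightarrow> Some (Suc (xs ! 0)) = Some (Suc (arg 0 xs))" by (simp add: arg_def)
  then show ?thesis unfolding crec_def using partial_recursive.succ by blast
qed

lemmas crec_Suc = rec1_app[OF rec1_Suc]

lemma crec_const: "crec n (\<lambda>_. c)"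
  by (induction c) (auto intro: crec_zero crec_Suc)

lemma crec_reindex:
  assumes "crec m F" "\<And>xs. length xs = n \<Longrightarrow> h xs = map (\<lambda>j. arg j xs) js" "length js = m"
  shows "crec n (\<lambda>xs. F (h xs))"
proof (rule crec_cong)
  show "crec n (\<lambda>xs. F (map (\<lambda>a. a xs) (map arg js)))"
    by (rule crec_comp) (use assms crec_arg in auto)
qed (use assms in \<open>simp add: comp_def\<close>)

lemma crec_rec_nat:
  assumes b: "crec n b" and F: "crec n F" and G: "crec (Suc (Suc n)) (\<lambda>ys. G (arg 0 ys) (arg 1 ys) (tl (tl ys)))"
  shows "crec n (\<lambda>xs. rec_nat (F xs) (\<lambda>k r. G k r xs) (b xs))"
proof -
  obtain f where f: "partial_recursive n f" "\<And>xs. length xs = n \<Longrightarrow> f xs = Some (F xs)"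
    using F unfolding crec_def by blast
  obtain g where g: "partial_recursive (n + 2) g"
    "\<And>ys. length ys = n + 2 \<Longrightarrow> g ys = Some (G (arg 0 ys) (arg 1 ys) (tl (tl ys)))"
    using G unfolding crec_def by auto
  have "prim_rec f g k xs = Some (rec_nat (F xs) (\<lambda>k r. G k r xs) k)" if "length xs = n" for k xs
    using that f g(2) by (induction k) auto
  then have "\<forall>xs. length xs = n + 1 \<longrightarrow> prim_rec f g (hd xs) (tl xs)
      = Some (rec_nat (F (tl xs)) (\<lambda>k r. G k r (tl xs)) (arg 0 xs))"
    by (auto simp: length_Suc_conv)
  then have "crec (n + 1) (\<lambda>xs. rec_nat (F (tl xs)) (\<lambda>k r. G k r (tl xs)) (arg 0 xs))"
    unfolding crec_def using partial_recursive.prim[OF f(1) g(1)] by blast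
  then have "crec n (\<lambda>xs. (\<lambda>xs. rec_nat (F (tl xs)) (\<lambda>k r. G k r (tl xs)) (arg 0 xs))
      (map (\<lambda>a. a xs) (b # map arg [0..<n])))"
    by (intro crec_comp) (use b crec_arg in auto)
  then show ?thesis
    by (rule crec_cong) (simp add: map_arg comp_def)
qed

text \<open>Nested bound variables leave iterated tails behind; these instances let the introduction
  rules close such terms directly.\<close>

lemma crec_arg_tl:
  "crec n (\<lambda>xs. arg j (tl xs))" "crec n (\<lambda>xs. arg j (tl (tl xs)))"
  "crec n (\<lambda>xs. arg j (tl (tl (tl xs))))" "crec n (\<lambda>xs. arg j (tl (tl (tl (tl xs)))))"
  "crec n (\<lambda>xs. arg j (tl (tl (tl (tl (tl xs))))))"
  by (simp_all add: arg_tl crec_arg)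

lemma rec2_add: "rec2 (+)"
proof -
  have "crec 2 (\<lambda>xs. rec_nat (arg 0 xs) (\<lambda>k r. Suc r) (arg 1 xs))"
    by (intro crec_rec_nat crec_arg crec_Suc)
  moreover have "rec_nat a (\<lambda>k r. Suc r) b = a + b" for a b by (induction b) auto
  ultimately show ?thesis by simp
qed

lemmas crec_add = rec2_app[OF rec2_add]

lemma rec2_mult: "rec2 (*)"
proof -
  have "crec 2 (\<lambda>xs. rec_nat 0 (\<lambda>k r. r + arg 0 xs) (arg 1 xs))"
    by (intro crec_rec_nat crec_arg crec_add crec_const crec_arg_tl)
  moreover have "rec_nat 0 (\<lambda>k r. r + a) b = a * b" for a b :: nat by (induction b) auto
  ultimately show ?thesis by simp
qed

lemmas crec_mult = rec2_app[OF rec2_mult]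

lemma rec1_pred: "rec1 (\<lambda>a. a - 1)"
proof -
  have "crec 1 (\<lambda>xs. rec_nat 0 (\<lambda>k r. k) (arg 0 xs))"
    by (intro crec_rec_nat crec_arg crec_const)
  moreover have "rec_nat 0 (\<lambda>k r. k) b = b - 1" for b :: nat by (cases b) auto
  ultimately show ?thesis by simp
qed

lemma rec2_diff: "rec2 (-)"
proof -
  have "crec 2 (\<lambda>xs. rec_nat (arg 0 xs) (\<lambda>k r. r - 1) (arg 1 xs))"
    by (intro crec_rec_nat crec_arg rec1_app[OF rec1_pred])
  moreover have "rec_nat a (\<lambda>k r. r - 1) b = a - b" for a b :: nat by (induction b) auto
  ultimately show ?thesis by simp
qed

lemmas crec_diff = rec2_app[OF rec2_diff]

lemma crec_not: "crec n (\<lambda>xs. of_bool (P xs)) \<Longrightarrow> crec n (\<lambda>xs. of_bool (\<not> P xs))"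
  using crec_diff[OF crec_const[of n 1]] by (fastforce elim: crec_cong)

lemma crec_conj:
  assumes "crec n (\<lambda>xs. of_bool (P xs))" "crec n (\<lambda>xs. of_bool (Q xs))"
  shows "crec n (\<lambda>xs. of_bool (P xs \<and> Q xs))"
  using crec_mult[OF assms] by (rule crec_cong) simp

lemma crec_imp:
  assumes "crec n (\<lambda>xs. of_bool (P xs))" "crec n (\<lambda>xs. of_bool (Q xs))"
  shows "crec n (\<lambda>xs. of_bool (P xs \<longrightarrow> Q xs))"
  using crec_not[OF crec_conj[OF assms(1) crec_not[OF assms(2)]]] by (rule crec_cong) simp

lemma crec_le:
  assumes "crec n a" "crec n b" shows "crec n (\<lambda>xs. of_bool (a xs \<le> b xs))"
  using crec_diff[OF crec_const[of n 1] crec_diff[OF assms]] by (rule crec_cong) auto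

lemma crec_less:
  assumes "crec n a" "crec n b" shows "crec n (\<lambda>xs. of_bool (a xs < b xs))"
  using crec_le[OF crec_Suc[OF assms(1)] assms(2)] by (simp add: Suc_le_eq)

lemma crec_eq:
  assumes "crec n a" "crec n b" shows "crec n (\<lambda>xs. of_bool (a xs = b xs))"
  using crec_conj[OF crec_le[OF assms] crec_le[OF assms(2,1)]] by (simp add: eq_iff)

lemma crec_sum:
  assumes b: "crec n b" and F: "crec (Suc n) (\<lambda>ys. F (arg 0 ys) (tl ys))"
  shows "crec n (\<lambda>xs. \<Sum>i<b xs. F i xs)"
proof -
  \<comment> \<open>Primitive recursion supplies counter, accumulator and arguments, while the
    summand depends on counter and arguments only; reindexing drops the accumulator.\<close>
  have "crec (Suc (Suc n)) (\<lambda>ys. (\<lambda>ys. F (arg 0 ys) (tl ys)) (arg 0 ys # tl (tl ys)))"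
  proof (rule crec_reindex[OF F, where js = "0 # map (\<lambda>i. i + 2) [0..<n]"])
    fix ys :: "nat list" assume "length ys = Suc (Suc n)"
    then obtain a b zs where "ys = a # b # zs" "length zs = n" by (auto simp: length_Suc_conv)
    then show "arg 0 ys # tl (tl ys) = map (\<lambda>j. arg j ys) (0 # map (\<lambda>i. i + 2) [0..<n])"
      by (simp add: map_arg comp_def)
  qed simp
  then have "crec n (\<lambda>xs. rec_nat 0 (\<lambda>k r. r + F k xs) (b xs))"
    by (intro crec_rec_nat b crec_const crec_add crec_arg) simp
  moreover have "rec_nat 0 (\<lambda>k r. r + f k) m = (\<Sum>i<m. f i)" for f :: "nat \<Rightarrow> nat" and m
    by (induction m) auto
  ultimately show ?thesis by simp
qed

text \<open>The bounded statement is decided by counting its violations.\<close>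

lemma crec_all:
  assumes "crec n b" "crec (Suc n) (\<lambda>ys. of_bool (P (arg 0 ys) (tl ys)))"
  shows "crec n (\<lambda>xs. of_bool (\<forall>i<b xs. P i xs))"
proof (rule crec_cong)
  show "crec n (\<lambda>xs. of_bool ((\<Sum>i<b xs. of_bool (\<not> P i xs)) = (0 :: nat)))"
    by (intro crec_eq crec_const crec_sum assms crec_not)
qed auto

lemma crec_ex:
  assumes "crec n b" "crec (Suc n) (\<lambda>ys. of_bool (P (arg 0 ys) (tl ys)))"
  shows "crec n (\<lambda>xs. of_bool (\<exists>i<b xs. P i xs))"
  using crec_not[OF crec_all[OF assms(1) crec_not[OF assms(2)]]] by (rule crec_cong) simp

lemma crec_finite_sum:
  assumes "finite S" "\<And>i. i \<in> S \<Longrightarrow> crec n (F i)"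
  shows "crec n (\<lambda>xs. \<Sum>i\<in>S. F i xs)"
  using assms by (induction S rule: finite_induct) (auto intro: crec_const crec_add)

text \<open>A witness has to exist only at the argument under consideration. This form serves the
  frequencies, where the search is known to stop for positive tolerances.\<close>

lemma partial_recursive_search:
  assumes "crec (Suc n) (\<lambda>ys. of_bool (P (arg 0 ys) (tl ys)))"
  obtains g where "partial_recursive n g"
    "\<And>xs. length xs = n \<Longrightarrow> \<exists>k. P k xs \<Longrightarrow> g xs = Some (LEAST k. P k xs)"
proof -
  obtain f where f: "partial_recursive (n + 1) f"
    "\<And>ys. length ys = n + 1 \<Longrightarrow> f ys = Some (of_bool (\<not> P (arg 0 ys) (tl ys)))"
    using crec_not[OF assms] unfolding crec_def by auto
  let ?g = "\<lambda>xs. if \<exists>k. is_mu f xs k then Some (THE k. is_mu f xs k) else None"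
  have "?g xs = Some (LEAST k. P k xs)" if "length xs = n" "\<exists>k. P k xs" for xs
  proof -
    have "f (k # xs) = Some (of_bool (\<not> P k xs))" for k using f(2) that by simp
    then have mu: "is_mu f xs k \<longleftrightarrow> P k xs \<and> (\<forall>m<k. \<not> P m xs)" for k
      by (auto simp: is_mu_def)
    have L: "is_mu f xs (LEAST k. P k xs)"
    proof (rule mu[THEN iffD2], intro conjI allI impI)
      show "P (LEAST k. P k xs) xs" using that(2) by (rule LeastI_ex)
      show "\<not> P m xs" if "m < (LEAST k. P k xs)" for m using that by (rule not_less_Least)
    qed
    then have "(THE k. is_mu f xs k) = (LEAST k. P k xs)"
    proof (rule the_equality)
      fix k assume "is_mu f xs k"
      then have "P k xs" "\<And>m. P m xs \<Longrightarrow> k \<le> m" unfolding mu by (auto simp: not_less[symmetric])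
      then show "k = (LEAST k. P k xs)" by (rule Least_equality[symmetric])
    qed
    then show ?thesis using L by auto
  qed
  then show thesis using that partial_recursive.mu[OF f(1)] by blast
qed

lemma crec_Least:
  assumes "crec (Suc n) (\<lambda>ys. of_bool (P (arg 0 ys) (tl ys)))"
    and "\<And>xs. length xs = n \<Longrightarrow> \<exists>k. P k xs"
  shows "crec n (\<lambda>xs. LEAST k. P k xs)"
  using partial_recursive_search[OF assms(1)] assms(2) unfolding crec_def by metis

lemmas crec_intros = crec_arg crec_arg_tl crec_const crec_Suc crec_add crec_mult crec_diff
  crec_not crec_conj crec_imp crec_le crec_less crec_eq crec_sum crec_all crec_ex

text \<open>A finite table written as an arithmetic term in the codes, with value 0 at numbers that
  code nothing. The transition and output functions enter the programs in this form.\<close>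

definition table2 :: "('a::finite \<Rightarrow> 'b::finite \<Rightarrow> nat) \<Rightarrow> nat \<Rightarrow> nat \<Rightarrow> nat" where
  "table2 f c d = (\<Sum>a\<in>UNIV. \<Sum>b\<in>UNIV. of_bool (c = to_nat a) * of_bool (d = to_nat b) * f a b)"

lemma table2_to_nat [simp]: "table2 f (to_nat a) (to_nat b) = f a b"
proof -
  have "table2 f (to_nat a) (to_nat b) = (\<Sum>a'\<in>UNIV. \<Sum>b'\<in>UNIV. if a' = a then if b' = b then f a' b' else 0 else 0)"
    unfolding table2_def by (intro sum.cong) auto
  also have "\<dots> = (\<Sum>a'\<in>UNIV. if a' = a then f a' b else 0)"
    by (intro sum.cong) auto
  finally show ?thesis by simp
qed

lemma rec2_table2: "rec2 (table2 f)"
  unfolding table2_def by (intro crec_finite_sum crec_intros) auto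

lemma rec1_triangle: "rec1 triangle"
proof -
  have "triangle n = (\<Sum>i<Suc n. i)" for n by (induction n) auto
  then show ?thesis by (simp only:) (intro crec_intros)
qed

lemma rec2_prod_encode: "rec2 (\<lambda>a b. prod_encode (a, b))"
  unfolding prod_encode_def split_conv by (intro crec_intros rec1_app[OF rec1_triangle])

text \<open>Both components are at most the code, so one is found as a least number and the other by
  bounded search.\<close>

lemma rec1_fst_prod_decode: "rec1 (\<lambda>d. fst (prod_decode d))"
  and rec1_snd_prod_decode: "rec1 (\<lambda>d. snd (prod_decode d))"
proof -
  have "fst (prod_decode d) \<le> d" "snd (prod_decode d) \<le> d" for d
    using le_prod_encode_1[of "fst (prod_decode d)" "snd (prod_decode d)"]
      le_prod_encode_2[of "snd (prod_decode d)" "fst (prod_decode d)"] by simp_all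
  then have ex: "\<exists>b<Suc d. prod_encode (fst (prod_decode d), b) = d"
       "\<exists>a<Suc d. prod_encode (a, snd (prod_decode d)) = d" for d
    by (intro exI[of _ "snd (prod_decode d)"] exI[of _ "fst (prod_decode d)"]; simp add: less_Suc_eq_le)+
  have 1: "(LEAST a. \<exists>b<Suc d. prod_encode (a, b) = d) = fst (prod_decode d)" for d
    by (rule Least_equality) (use ex in auto)
  have 2: "(LEAST b. \<exists>a<Suc d. prod_encode (a, b) = d) = snd (prod_decode d)" for d
    by (rule Least_equality) (use ex in auto)
  show "rec1 (\<lambda>d. fst (prod_decode d))"
    unfolding 1[symmetric]
    by (intro crec_Least crec_intros rec2_app[OF rec2_prod_encode]) (use ex in blast)
  show "rec1 (\<lambda>d. snd (prod_decode d))"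
    unfolding 2[symmetric]
    by (intro crec_Least crec_intros rec2_app[OF rec2_prod_encode]) (use ex in blast)
qed

lemma length_le_list_encode: "length xs \<le> list_encode xs"
proof (induction xs)
  case (Cons a xs)
  then show ?case using le_prod_encode_2[of "list_encode xs" a] by simp
qed simp

lemma inj_word_code: "inj word_code"
  unfolding word_code_def by (rule injI) (auto simp: list_encode_eq inj_map_eq_map)

lemma rec2_word_code_fac:
  assumes "rec1 (\<lambda>i. to_nat (y i))"
  shows "rec2 (\<lambda>i l. word_code (fac y i l))"
proof -
  \<comment> \<open>\<open>list_encode\<close> adds letters at the front, so the recursion runs
    backwards from the end \<open>e\<close> of the factor.\<close>
  have "rec_nat 0 (\<lambda>k r. Suc (prod_encode (to_nat (y (e - Suc k)), r))) k = word_code (fac y (e - k) k)"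
    if "k \<le> e" for e k
    using that
  proof (induction k)
    case (Suc k)
    have "fac y (e - Suc k) (Suc k) = y (e - Suc k) # fac y (e - k) k"
      using fac_add[of y "e - Suc k" 1 k] Suc.prems by (simp add: fac_Suc Suc_diff_Suc)
    then show ?case using Suc by (simp add: word_code_def)
  qed (simp add: word_code_def)
  from this[of _ "_ + _"]
  have "rec_nat 0 (\<lambda>k r. Suc (prod_encode (to_nat (y (i + l - Suc k)), r))) l = word_code (fac y i l)" for i l
    by simp
  moreover have "rec2 (\<lambda>i l. rec_nat 0 (\<lambda>k r. Suc (prod_encode (to_nat (y (i + l - Suc k)), r))) l)"
    by (intro crec_rec_nat crec_intros rec2_app[OF rec2_prod_encode] rec1_app[OF assms])
  ultimately show ?thesis by simp
qed

lemma fac_eq_iff_to_nat: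
  "fac (x :: nat \<Rightarrow> 'a::finite) i m = fac x j m \<longleftrightarrow> (\<forall>a<m. to_nat (x (i + a)) = to_nat (x (j + a)))"
  by (simp add: fac_eq_iff)

lemma rec3_fac_eq:
  fixes x :: "nat \<Rightarrow> 'a::finite"
  assumes "rec1 (\<lambda>i. to_nat (x i))"
  shows "rec3 (\<lambda>i j m. of_bool (fac x i m = fac x j m))"
  unfolding fac_eq_iff_to_nat by (intro crec_intros rec1_app[OF assms])

section \<open>Effectivity\<close>

text \<open>With a computable \<open>c\<close>, quantifiers over all factors of a given length
  become bounded, hence decidable.\<close>

definition covers :: "(nat \<Rightarrow> 'a) \<Rightarrow> (nat \<Rightarrow> nat) \<Rightarrow> bool" where
  "covers y c \<longleftrightarrow> (\<forall>n p. \<exists>p'<c n. fac y p' n = fac y p n)"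

lemma coversE:
  assumes "covers y c" obtains p' where "p' < c n" "fac y p' n = fac y p n"
  using assms unfolding covers_def by blast

text \<open>Whether the word at \<open>i\<close> returns within \<open>R\<close> steps depends only
  on the \<open>R + n\<close> letters from \<open>i\<close>.\<close>

lemma returns_within_covers:
  assumes "covers y c"
  shows "returns_within y n R \<longleftrightarrow>
    (\<forall>i<c (R + n). \<exists>j<Suc R. 1 \<le> j \<and> fac y (i + j) n = fac y i n)"
proof
  assume *: "\<forall>i<c (R + n). \<exists>j<Suc R. 1 \<le> j \<and> fac y (i + j) n = fac y i n"
  show "returns_within y n R"
    unfolding returns_within_def
  proof
    fix i
    obtain i' where i': "i' < c (R + n)" "fac y i' (R + n) = fac y i (R + n)"
      using assms by (rule coversE)
    obtain j where j: "j < Suc R" "1 \<le> j" "fac y (i' + j) n = fac y i' n" using * i' by blast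
    have "fac y (i' + j) n = fac y (i + j) n" "fac y i' n = fac y i n"
      using fac_eq_mono[OF i'(2), of j n] fac_eq_mono[OF i'(2), of 0 n] j by simp_all
    then show "\<exists>j. 1 \<le> j \<and> j \<le> R \<and> fac y (i + j) n = fac y i n"
      using j by (intro exI[of _ j]) simp
  qed
qed (auto simp: returns_within_def less_Suc_eq_le)

lemma rec1_max_return:
  fixes y :: "nat \<Rightarrow> 'a::finite"
  assumes ur: "uniformly_recurrent y" and y: "rec1 (\<lambda>i. to_nat (y i))"
    and c: "covers y c" "rec1 c"
  shows "rec1 (max_return y)"
proof -
  have "rec1 (\<lambda>n. LEAST R. \<forall>i<c (R + n). \<exists>j<Suc R. 1 \<le> j \<and> fac y (i + j) n = fac y i n)"
  proof (intro crec_Least crec_intros rec1_app[OF c(2)] rec3_app[OF rec3_fac_eq[OF y]])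
    fix xs :: "nat list"
    show "\<exists>k. \<forall>i<c (k + arg 0 xs). \<exists>j<Suc k. 1 \<le> j \<and> fac y (i + j) (arg 0 xs) = fac y i (arg 0 xs)"
      using returns_within_max_return[OF ur, of "arg 0 xs"] returns_within_covers[OF c(1)] by blast
  qed
  then show ?thesis
    by (simp add: max_return_eq_Least[OF ur] returns_within_covers[OF c(1)])
qed

text \<open>The word is never decoded: all lengths up to the code are tried, which suffices since a
  word is no longer than its code, and injectivity of the coding excludes false matches.\<close>

definition code_occurs :: "(nat \<Rightarrow> 'a::finite) \<Rightarrow> nat \<Rightarrow> nat \<Rightarrow> bool" where
  "code_occurs y c i \<longleftrightarrow> (\<exists>l<Suc c. word_code (fac y i l) = c)"

lemma code_occurs_word_code: "code_occurs y (word_code u) i \<longleftrightarrow> fac y i (length u) = u"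
proof
  assume "code_occurs y (word_code u) i"
  then obtain l where "word_code (fac y i l) = word_code u" by (auto simp: code_occurs_def)
  then have "fac y i l = u" by (rule injD[OF inj_word_code])
  then show "fac y i (length u) = u" by auto
next
  assume "fac y i (length u) = u"
  moreover have "length u \<le> word_code u"
    using length_le_list_encode[of "map to_nat u"] by (simp add: word_code_def)
  ultimately show "code_occurs y (word_code u) i"
    unfolding code_occurs_def by (intro exI[of _ "length u"]) simp
qed

definition code_count :: "(nat \<Rightarrow> 'a::finite) \<Rightarrow> nat \<Rightarrow> nat \<Rightarrow> nat \<Rightarrow> nat" where
  "code_count y c i N = (\<Sum>j<N. of_bool (code_occurs y c (i + j)))"

lemma avg_occ_eq: "avg (occ u) N (sh i y) = real (code_count y (word_code u) i N) / real N"
proof -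
  have "fac (sh j (sh i y)) 0 (length u) = fac y (i + j) (length u)" for j
    by (simp add: list_eq_iff_nth_eq ac_simps)
  then have "(\<Sum>j<N. occ u (sh j (sh i y))) = real (code_count y (word_code u) i N)"
    unfolding occ_def code_count_def code_occurs_word_code by simp
  then show ?thesis by (simp only: avg_def)
qed

lemma rec3_code_count:
  assumes "rec1 (\<lambda>i. to_nat (y i))"
  shows "rec3 (code_count y)"
  unfolding code_count_def code_occurs_def
  by (intro crec_intros rec2_app[OF rec2_word_code_fac[OF assms]])

lemma int_encode_int: "int_encode (int k) = 2 * k"
  by (simp add: int_encode_def sum_encode_def)

lemma rat_of_code_real:
  "real_of_rat (rat_of_code (prod_encode (2 * k, m))) = real k / real (Suc m)"
proof -
  have "int_decode (2 * k) = int k"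
    using int_encode_inverse[of "int k"] by (simp only: int_encode_int)
  then show ?thesis
    by (simp add: rat_of_code_def of_rat_divide del: of_nat_Suc)
qed

text \<open>A positive numerator \<open>k\<close> has the even code \<open>2 * k\<close>, so the
  code itself can be used as twice the numerator.\<close>

lemma rat_of_code_pos:
  assumes "rat_of_code d > 0"
  shows "real_of_rat (rat_of_code d) = real (fst (prod_decode d)) / (2 * real (Suc (snd (prod_decode d))))"
proof -
  obtain a b where ab: "prod_decode d = (a, b)" by force
  have "0 < int_decode a"
    using assms by (simp add: rat_of_code_def ab zero_less_divide_iff del: of_nat_Suc)
  then have "int_encode (int (nat (int_decode a))) = a" by simp
  then have "2 * nat (int_decode a) = a" by (simp only: int_encode_int)
  then obtain k where k: "a = 2 * k" by metis
  have "d = prod_encode (2 * k, b)" using ab k by (metis prod_decode_inverse)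
  then show ?thesis using rat_of_code_real[of k b] by (simp add: k del: of_nat_Suc)
qed

text \<open>The search looks for a window length \<open>N\<close> for which the numbers of occurrences in all windows
  differ by less than \<open>N * \<delta> / 2\<close>, where the code \<open>d\<close> of \<open>\<delta>\<close> decodes to the pair of \<open>a\<close> and \<open>b\<close>
  with \<open>\<delta> = a / (2 * (b + 1))\<close>.\<close>

definition flat_window :: "(nat \<Rightarrow> 'a::finite) \<Rightarrow> (nat \<Rightarrow> nat) \<Rightarrow> nat \<Rightarrow> nat \<Rightarrow> nat \<Rightarrow> bool" where
  "flat_window y c N u d \<longleftrightarrow> 0 < N \<and> (\<forall>i<c (N + u). \<forall>i'<c (N + u).
     code_count y u i' N * (4 * Suc (snd (prod_decode d)))
       < code_count y u i N * (4 * Suc (snd (prod_decode d))) + N * fst (prod_decode d))"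

lemma flat_window_iff:
  assumes c: "covers y c" and d: "rat_of_code d > 0"
  shows "flat_window y c N (word_code u) d \<longleftrightarrow> 0 < N \<and>
    (\<forall>i i'. avg (occ u) N (sh i' y) - avg (occ u) N (sh i y) < real_of_rat (rat_of_code d) / 2)"
proof -
  let ?a = "fst (prod_decode d)" and ?b = "Suc (snd (prod_decode d))" and ?u = "word_code u"
  have cmp: "code_count y ?u i' N * (4 * ?b) < code_count y ?u i N * (4 * ?b) + N * ?a \<longleftrightarrow>
      avg (occ u) N (sh i' y) - avg (occ u) N (sh i y) < real_of_rat (rat_of_code d) / 2"
    if "0 < N" for i i'
  proof -
    have "code_count y ?u i' N * (4 * ?b) < code_count y ?u i N * (4 * ?b) + N * ?a \<longleftrightarrow>
        real (code_count y ?u i' N) * (4 * real ?b) < real (code_count y ?u i N) * (4 * real ?b) + real N * real ?a"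
      unfolding of_nat_less_iff[where 'a = real, symmetric] of_nat_add of_nat_mult of_nat_numeral ..
    also have "\<dots> \<longleftrightarrow> real (code_count y ?u i' N) / real N - real (code_count y ?u i N) / real N
        < real ?a / (2 * real ?b) / 2"
      using that by (simp add: field_simps del: of_nat_Suc)
    finally show ?thesis by (simp add: avg_occ_eq rat_of_code_pos[OF d])
  qed
  \<comment> \<open>Programs know only the code of \<open>u\<close>; as it bounds the length,
    factors of length \<open>N\<close> plus the code determine the average.\<close>
  have len: "length u \<le> ?u"
    using length_le_list_encode[of "map to_nat u"] by (simp add: word_code_def)
  have rep: "\<exists>i'<c (N + ?u). avg (occ u) N (sh i' y) = avg (occ u) N (sh i y)" for i
  proof -
    obtain i' where i': "i' < c (N + ?u)" "fac y i' (N + ?u) = fac y i (N + ?u)"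
      using c by (rule coversE)
    have "avg (occ u) N (sh i' y) = avg (occ u) N (sh i y)"
      using fac_eq_mono[OF i'(2), of 0 "N + length u"] len
      by (intro local_function.avg_local[OF local_function_occ]) simp
    then show ?thesis using i' by blast
  qed
  show ?thesis
    unfolding flat_window_def using cmp rep by metis
qed

lemma computable_frequencies:
  fixes y :: "nat \<Rightarrow> 'a::finite"
  assumes y: "rec1 (\<lambda>i. to_nat (y i))" and c: "covers y c" "rec1 c"
    and bg: "bounded_gaps y" and bosh: "boshernitzan y"
  shows "admits_computable_factor_frequencies y"
proof -
  have P: "crec (Suc 2) (\<lambda>ys. of_bool (flat_window y c (arg 0 ys) (arg 0 (tl ys)) (arg 1 (tl ys))))"
    unfolding flat_window_def
    by (intro crec_intros rec1_app[OF c(2)] rec3_app[OF rec3_code_count[OF y]]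
        rec1_app[OF rec1_fst_prod_decode] rec1_app[OF rec1_snd_prod_decode])
  obtain s where s: "partial_recursive 2 s"
    "\<And>xs. length xs = 2 \<Longrightarrow> \<exists>N. flat_window y c N (arg 0 xs) (arg 1 xs) \<Longrightarrow>
       s xs = Some (LEAST N. flat_window y c N (arg 0 xs) (arg 1 xs))"
    using partial_recursive_search[OF P] by metis
  \<comment> \<open>The code of the relative count in the first window: the numerator is coded by
    its double, and the decoding adds 1 to the second component.\<close>
  have "crec 2 (\<lambda>xs. prod_encode (2 * code_count y (arg 1 xs) 0 (arg 0 xs), arg 0 xs - 1))"
    by (intro crec_intros rec2_app[OF rec2_prod_encode] rec3_app[OF rec3_code_count[OF y]])
  then obtain h where h: "partial_recursive 2 h"
    "\<And>xs. length xs = 2 \<Longrightarrow> h xs = Some (prod_encode (2 * code_count y (arg 1 xs) 0 (arg 0 xs), arg 0 xs - 1))"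
    unfolding crec_def by blast
  define p where "p = (\<lambda>xs :: nat list. Some (xs ! 0))"
  have p: "partial_recursive 2 p" unfolding p_def by (rule partial_recursive.proj) simp
  \<comment> \<open>The search \<open>s\<close> is partial, so the composition is formed by the rule
    \<open>comp\<close> itself; \<open>p\<close> passes the code of the factor on to
    \<open>h\<close>.\<close>
  define g where "g = (\<lambda>xs. if \<forall>f\<in>set [s, p]. f xs \<noteq> None then h (map (\<lambda>f. the (f xs)) [s, p]) else None)"
  have g: "partial_recursive 2 g"
    unfolding g_def by (rule partial_recursive.comp) (use s p h in \<open>simp_all flip: numeral_2_eq_2\<close>)
  have "\<exists>r. g [word_code u, d] = Some r \<and>
      \<bar>frequency y u - real_of_rat (rat_of_code r)\<bar> < real_of_rat (rat_of_code d)"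
    if d: "rat_of_code d > 0" for u d
  proof -
    interpret local_function "occ u" "length u" by (rule local_function_occ)
    let ?\<delta> = "real_of_rat (rat_of_code d)"
    have \<delta>: "0 < ?\<delta>" using d by simp
    have ua: "uniform_averages (occ u) y"
      by (rule boshernitzan_uniform_averages[OF local_function_occ bg bosh])
    then obtain N where "0 < N" "\<forall>i i'. avg (occ u) N (sh i' y) - avg (occ u) N (sh i y) < ?\<delta> / 2"
      unfolding uniform_averages_def using \<delta> by (metis half_gt_zero)
    then have ex: "\<exists>N. flat_window y c N (word_code u) d" using flat_window_iff[OF c(1) d] by blast
    define N where "N = (LEAST N. flat_window y c N (word_code u) d)"
    have "flat_window y c N (word_code u) d" unfolding N_def using ex by (rule LeastI_ex)
    then have N: "0 < N" "\<And>i i'. avg (occ u) N (sh i' y) - avg (occ u) N (sh i y) < ?\<delta> / 2"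
      using flat_window_iff[OF c(1) d] by blast+
    have "s [word_code u, d] = Some N" using s(2)[of "[word_code u, d]"] ex by (simp add: N_def)
    then have g_eq: "g [word_code u, d] = Some (prod_encode (2 * code_count y (word_code u) 0 N, N - 1))"
      by (simp add: g_def p_def h(2))
    have "real_of_rat (rat_of_code (prod_encode (2 * code_count y (word_code u) 0 N, N - 1))) = avg (occ u) N y"
      using avg_occ_eq[where u = u and N = N and i = 0 and y = y] N(1) by (simp add: rat_of_code_real)
    \<comment> \<open>The limit only preserves a weak inequality; searching with half the tolerance
      keeps the final one strict.\<close>
    moreover have "\<bar>frequency y u - avg (occ u) N y\<bar> \<le> ?\<delta> / 2"
      using uniform_averages_limit[OF ua N] by (simp add: frequency_def occurrence_rate_eq_avg[abs_def])
    then have "\<bar>frequency y u - avg (occ u) N y\<bar> < ?\<delta>" using \<delta> by linarith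
    ultimately show ?thesis using g_eq by metis
  qed
  then show ?thesis
    unfolding admits_computable_factor_frequencies_def
    using g boshernitzan_admits_factor_frequencies[OF bg bosh] by blast
qed

section \<open>Computing the output and its factors\<close>

locale effective_tail = transducer_tail A x R s0
  for A :: "('q::finite, 'a::finite, 'b::finite) transducer" and x :: "nat \<Rightarrow> 'a" and R s0 +
  assumes x_rec: "rec1 (\<lambda>i. to_nat (x i))" and max_return_rec: "rec1 (max_return x)"
begin

lemma st_rec: "rec1 (\<lambda>i. to_nat (st i))"
proof -
  have "rec_nat (to_nat (init_state A))
      (\<lambda>k r. table2 (\<lambda>q a. to_nat (next_state A q a)) r (to_nat (x k))) n = to_nat (st n)" for n
    by (induction n) simp_all
  moreover have "rec1 (rec_nat (to_nat (init_state A))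
      (\<lambda>k r. table2 (\<lambda>q a. to_nat (next_state A q a)) r (to_nat (x k))))"
    by (intro crec_rec_nat crec_intros rec2_app[OF rec2_table2] rec1_app[OF x_rec])
  ultimately show ?thesis by simp
qed

lemma pos_rec: "rec1 (pos A x)"
proof -
  have "pos A x n = (\<Sum>i<n. table2 (\<lambda>q a. length (out_word A q a)) (to_nat (st i)) (to_nat (x i)))" for n
    by (induction n) (simp_all add: output_prefix_def)
  then show ?thesis
    by (simp only:) (intro crec_intros rec2_app[OF rec2_table2] rec1_app[OF x_rec] rec1_app[OF st_rec])
qed

lemma output_rec: "rec1 (\<lambda>p. to_nat (transducer_output A x p))"
proof -
  define idx where "idx = (\<lambda>p. LEAST i. p < pos A x (Suc i))"
  have ex: "\<exists>i. p < pos A x (Suc i)" for p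
  proof -
    obtain N where "p < pos A x N" using infinite_out unfolding infinite_output_def by blast
    then show ?thesis using pos_mono[of N "Suc N" A x] by (intro exI[of _ N]) simp
  qed
  have idx_rec: "rec1 idx"
    unfolding idx_def by (intro crec_Least crec_intros rec1_app[OF pos_rec] ex)
  \<comment> \<open>Letter \<open>idx p\<close> emits position \<open>p\<close>. A table depends
    only on state and letter, so there is one table for each offset \<open>l\<close>, and the sum
    selects the right one.\<close>
  have "to_nat (transducer_output A x p) =
      (\<Sum>l<maxout. of_bool (l = p - pos A x (idx p)) *
        table2 (\<lambda>q a. if l < length (out_word A q a) then to_nat (out_word A q a ! l) else 0)
          (to_nat (st (idx p))) (to_nat (x (idx p))))" for p
  proof -
    let ?i = "idx p" and ?w = "out_word A (st (idx p)) (x (idx p))"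
    have i: "p < pos A x (Suc ?i)" unfolding idx_def using ex by (rule LeastI_ex)
    have i': "pos A x ?i \<le> p"
    proof (cases ?i)
      case (Suc k)
      then show ?thesis using not_less_Least[of k "\<lambda>i. p < pos A x (Suc i)"] unfolding idx_def by auto
    qed (simp add: output_prefix_def)
    have l: "p - pos A x ?i < length ?w" using i i' by (simp add: output_prefix_def)
    have "transducer_output A x p = ?w ! (p - pos A x ?i)"
      using transducer_output_nth[OF i] i' by (simp add: output_prefix_def nth_append)
    moreover have "(\<Sum>l<maxout. of_bool (l = p - pos A x ?i) * (if l < length ?w then to_nat (?w ! l) else 0))
        = (\<Sum>l<maxout. if l = p - pos A x ?i then to_nat (?w ! l) else 0)"
      using l by (intro sum.cong) auto
    ultimately show ?thesis using l length_out_word_le[of "st ?i" "x ?i"] by simp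
  qed
  then show ?thesis
    by (simp only:) (intro crec_finite_sum crec_intros rec2_app[OF rec2_table2] rec1_app[OF x_rec]
        rec1_app[OF st_rec] rec1_app[OF idx_rec] rec1_app[OF pos_rec] finite_lessThan)
qed

lemma y_rec: "rec1 (\<lambda>p. to_nat (y p))"
  unfolding y_def by (intro crec_intros rec1_app[OF output_rec])

text \<open>Finitely many pairs of a factor and an admissible state each recur after
  \<open>s0\<close>. Listing positions before the constant \<open>J\<close> replaces membership in
  \<open>E\<close>, which is defined by an infinite set.\<close>

lemma all_states_early:
  obtains J where "\<And>i q. q \<in> E (fac x i R) \<Longrightarrow> \<exists>j<J. s0 \<le> j \<and> fac x j R = fac x i R \<and> st (j + R) = q"
proof -
  let ?S = "{(v, q). v \<in> range (\<lambda>i. fac x i R) \<and> q \<in> E v}"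
  have "?S \<subseteq> range (\<lambda>i. fac x i R) \<times> UNIV" by auto
  then have fin: "finite ?S" by (rule finite_subset) (simp add: finite_range_fac)
  have "\<forall>s\<in>?S. \<exists>j. s0 \<le> j \<and> fac x j R = fst s \<and> st (j + R) = snd s"
  proof clarify
    fix i q assume q: "q \<in> E (fac x i R)"
    show "\<exists>j\<ge>s0. fac x j R = fst (fac x i R, q) \<and> st (j + R) = snd (fac x i R, q)"
      using recurs[OF q, of 0] unfolding infinite_nat_iff_unbounded_le by auto
  qed
  from bchoice[OF this] obtain j where
    j: "\<And>v q. (v, q) \<in> ?S \<Longrightarrow> s0 \<le> j (v, q) \<and> fac x (j (v, q)) R = v \<and> st (j (v, q) + R) = q" by auto
  obtain J where J: "\<And>s. s \<in> ?S \<Longrightarrow> j s < J"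
    using finite_imageI[OF fin, of j] by (auto simp: finite_nat_set_iff_bounded)
  show thesis
  proof (rule that[of J])
    fix i q assume "q \<in> E (fac x i R)"
    then have "(fac x i R, q) \<in> ?S" by blast
    then show "\<exists>j<J. s0 \<le> j \<and> fac x j R = fac x i R \<and> st (j + R) = q" using j J by blast
  qed
qed

text \<open>The pairs of a factor of \<open>x\<close> and a state that occur in the tail can be found by search: by the
  minimality of the factors of length \<open>R\<close>, whether a pair occurs is decided by the state and the
  first \<open>R\<close> letters, and all pairs for length \<open>R\<close> occur before position \<open>J\<close>.\<close>

lemma y_covered: "\<exists>c. covers y c \<and> rec1 c"
proof -
  obtain G where G: "0 < G" "\<And>i q n. q \<in> E (fac x i R) \<Longrightarrow> n \<le> length (outs A q (fac x (i + R) (G * n)))"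
    by (rule output_growth) blast
  obtain J where J: "\<And>i q. q \<in> E (fac x i R) \<Longrightarrow> \<exists>j<J. s0 \<le> j \<and> fac x j R = fac x i R \<and> st (j + R) = q"
    by (rule all_states_early) blast
  \<comment> \<open>\<open>R\<close> letters to identify the admissible states, followed by the
    window of \<open>y_window\<close>.\<close>
  define m where "m = (\<lambda>n. R + (1 + G * n))"
  \<comment> \<open>The bound on \<open>i\<close> is where effective uniform recurrence of
    \<open>x\<close> enters: by \<open>factor_in_prefix\<close> these positions show all factors of
    length \<open>m n\<close>.\<close>
  define C where "C = (\<lambda>t n. \<forall>i<max_return x (m n). \<forall>j<J. s0 \<le> j \<and> fac x j R = fac x i R \<longrightarrow>
    (\<exists>k<t. s0 \<le> k \<and> fac x k (m n) = fac x i (m n) \<and> to_nat (st (k + R)) = to_nat (st (j + R))))"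
  have m_rec: "rec1 m" unfolding m_def by (intro crec_intros)
  have C_rec: "rec2 (\<lambda>t n. of_bool (C t n))"
    unfolding C_def by (intro crec_intros rec1_app[OF max_return_rec] rec1_app[OF m_rec]
        rec3_app[OF rec3_fac_eq[OF x_rec]] rec1_app[OF st_rec])
  have C_ex: "\<exists>t. C t n" for n
  proof -
    let ?P = "{(i, j). i < max_return x (m n) \<and> j < J \<and> s0 \<le> j \<and> fac x j R = fac x i R}"
    have "?P \<subseteq> {..<max_return x (m n)} \<times> {..<J}" by auto
    then have fin: "finite ?P" by (rule finite_subset) simp
    have "\<forall>s\<in>?P. \<exists>k. s0 \<le> k \<and> fac x k (m n) = fac x (fst s) (m n) \<and> st (k + R) = st (snd s + R)"
    proof clarify
      fix i j assume "s0 \<le> j" "fac x j R = fac x i R"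
      then have "st (j + R) \<in> E (fac x i R)" using tail[of j] by simp
      from recurs[OF this, of "1 + G * n"]
      show "\<exists>k\<ge>s0. fac x k (m n) = fac x (fst (i, j)) (m n) \<and> st (k + R) = st (snd (i, j) + R)"
        unfolding infinite_nat_iff_unbounded_le m_def by auto
    qed
    from bchoice[OF this] obtain k where k: "\<And>i j. (i, j) \<in> ?P \<Longrightarrow>
        s0 \<le> k (i, j) \<and> fac x (k (i, j)) (m n) = fac x i (m n) \<and> st (k (i, j) + R) = st (j + R)" by auto
    obtain t where t: "\<And>s. s \<in> ?P \<Longrightarrow> k s < t"
      using finite_imageI[OF fin, of k] by (auto simp: finite_nat_set_iff_bounded)
    have "C t n"
      unfolding C_def
    proof (intro allI impI)
      fix i j assume "i < max_return x (m n)" "j < J" "s0 \<le> j \<and> fac x j R = fac x i R"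
      then have "(i, j) \<in> ?P" by simp
      then show "\<exists>k<t. s0 \<le> k \<and> fac x k (m n) = fac x i (m n) \<and> to_nat (st (k + R)) = to_nat (st (j + R))"
        using k[of i j] t[of "(i, j)"] by (intro exI[of _ "k (i, j)"]) simp
    qed
    then show ?thesis by blast
  qed
  define t where "t = (\<lambda>n. LEAST t. C t n)"
  have t: "C (t n) n" for n unfolding t_def using C_ex by (rule LeastI_ex)
  have t_rec: "rec1 t"
    unfolding t_def by (intro crec_Least crec_intros rec2_app[OF C_rec] C_ex)
  \<comment> \<open>A window found at \<open>k < t n\<close> ends before letter
    \<open>t n + m n\<close>, so its output ends by this position.\<close>
  define c where "c = (\<lambda>n. Suc (pos A x (t n + m n)))"
  have "rec1 c"
    unfolding c_def by (intro crec_intros rec1_app[OF pos_rec] rec1_app[OF t_rec] rec1_app[OF m_rec])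
  moreover have "covers y c"
    unfolding covers_def
  proof (intro allI)
    fix n p
    obtain i j where w: "s0 \<le> i" "j < length (out_word A (st (i + R)) (x (i + R)))"
      "j + n \<le> length (outs A (st (i + R)) (fac x (i + R) (1 + G * n)))"
      "pos A x (i + R) - start + j = p"
      by (rule y_window[OF G(2)])
    let ?V = "outs A (st (i + R)) (fac x (i + R) (1 + G * n))"
    have ur: "uniformly_recurrent x" using gaps uniformly_recurrent_iff_bounded_gaps by blast
    obtain i1 where i1: "i1 < max_return x (m n)" "fac x i1 (m n) = fac x i (m n)"
      using factor_in_prefix[OF ur] by blast
    have R: "fac x i1 R = fac x i R" using fac_eq_mono[OF i1(2), of 0 R] by (simp add: m_def)
    obtain j1 where j1: "j1 < J" "s0 \<le> j1" "fac x j1 R = fac x i1 R" "st (j1 + R) = st (i + R)"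
      using J[OF tail[OF w(1)]] R by auto
    obtain k where k: "k < t n" "s0 \<le> k" "fac x k (m n) = fac x i (m n)" "st (k + R) = st (i + R)"
      using t[of n] i1 j1 unfolding C_def by (metis to_nat_split)
    have eq: "fac x (k + R) (1 + G * n) = fac x (i + R) (1 + G * n)"
      using fac_eq_mono[OF k(3), of R "1 + G * n"] by (simp add: m_def)
    have "fac y (pos A x (k + R) - start) (length ?V) = ?V"
      using fac_y[of "k + R" "1 + G * n"] k by (simp only: eq k(4))
    moreover have "fac y (pos A x (i + R) - start) (length ?V) = ?V"
      using fac_y[of "i + R" "1 + G * n"] w(1) by simp
    ultimately have "fac y (pos A x (k + R) - start) (length ?V) = fac y (pos A x (i + R) - start) (length ?V)"
      by simp
    from fac_eq_mono[OF this w(3)]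
    have "fac y (pos A x (k + R) - start + j) n = fac y p n" using w(4) by simp
    moreover have "pos A x (k + R) - start + j < c n"
    proof -
      have "pos A x (k + R) + length ?V = pos A x (k + R + (1 + G * n))"
        unfolding pos_add[of "k + R"] by (simp only: eq k(4))
      also have "\<dots> \<le> pos A x (t n + m n)" using k by (intro pos_mono) (simp add: m_def)
      finally show ?thesis using w(3) by (simp add: c_def)
    qed
    ultimately show "\<exists>p'<c n. fac y p' n = fac y p n" by blast
  qed
  ultimately show ?thesis by blast
qed

theorem effectively_uniformly_recurrent_y: "effectively_uniformly_recurrent y"
proof -
  have ur: "uniformly_recurrent y" using bounded_gaps_y uniformly_recurrent_iff_bounded_gaps by blast
  obtain c where "covers y c" "rec1 c" using y_covered by blast
  then have "rec1 (max_return y)" by (rule rec1_max_return[OF ur y_rec])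
  then show ?thesis
    using ur y_rec by (simp add: effectively_uniformly_recurrent_def computable_iff)
qed

theorem computable_frequencies_y: "boshernitzan y \<Longrightarrow> admits_computable_factor_frequencies y"
  using y_covered computable_frequencies[OF y_rec _ _ bounded_gaps_y] by blast

end

theorem theorem7p1:
  fixes A :: "('q::finite, 'a::finite, 'b::finite) transducer"
    and x :: "nat \<Rightarrow> 'a"
  assumes "uniformly_recurrent x"
    and "boshernitzan x"
    and "infinite_output A x"
  shows "(\<exists>y. is_suffix y (transducer_output A x) \<and>
              uniformly_recurrent y \<and> boshernitzan y \<and>
              admits_factor_frequencies y) \<and>
         (effectively_uniformly_recurrent x \<longrightarrow>
           (\<exists>y. is_suffix y (transducer_output A x) \<and>
                effectively_uniformly_recurrent y \<and> boshernitzan y \<and>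
                admits_computable_factor_frequencies y))"
proof -
  interpret transducer_run A x
    by unfold_locales (use assms uniformly_recurrent_iff_bounded_gaps in blast)+
  obtain R where R: "\<And>i. minimal (fac x i R)" using long_factors_minimal by blast
  obtain s0 where s0: "\<And>i. s0 \<le> i \<Longrightarrow> st (i + R) \<in> E (fac x i R)" using eventually_in_E by blast
  interpret transducer_tail A x R s0 by unfold_locales (use R s0 in auto)
  obtain \<mu> \<epsilon> where \<mu>: "invariant_measure (generated_shift x) \<mu>" and \<epsilon>: "0 < \<epsilon>"
    "infinite {n. \<forall>w\<in>language (generated_shift x) n. \<epsilon> \<le> real n * measure \<mu> (cylinder (generated_shift x) w)}"
    using boshernitzan_good_lengths[OF assms(2)] .
  interpret transducer_measure A x R s0 \<mu>
    by unfold_locales (use \<mu> is_shift_generated_shift in auto)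
  have bosh: "boshernitzan y" by (rule boshernitzan_y[OF \<epsilon>])
  have ur: "uniformly_recurrent y" using bounded_gaps_y uniformly_recurrent_iff_bounded_gaps by blast
  have "effectively_uniformly_recurrent y \<and> admits_computable_factor_frequencies y"
    if "effectively_uniformly_recurrent x"
  proof -
    \<comment> \<open>The same suffix serves both halves; effectivity of \<open>x\<close> adds
      computability to the construction already made.\<close>
    interpret effective_tail A x R s0
      by unfold_locales (use that in \<open>simp_all add: effectively_uniformly_recurrent_def computable_iff\<close>)
    show ?thesis using effectively_uniformly_recurrent_y computable_frequencies_y[OF bosh] by blast
  qed
  then show ?thesis
    using is_suffix_y bosh ur boshernitzan_admits_factor_frequencies[OF bounded_gaps_y bosh] by blast
qed

end
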